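(* Let $A \subseteq \mathbb{H}$ be an analytic (Suslin) set with $\dim A > 1$. Then \[ \dim P_{\mathbb{V}_{\theta}^{\perp}}(A) \geq \min\left\{ \frac{1+\dim A}{2},\, 2 \right\} \] for a.e. $\theta \in [0,\pi)$ (with respect to Lebesgue measure).
   Context: $\mathbb{H}$ is the first Heisenberg group, identified with $\mathbb{C}\times\mathbb{R}$ and equipped with the group law \[ (z,t)\ast(\zeta,\tau) = (z+\zeta,\ t+\tau+2\omega(z,\zeta)), \qquad \omega(z,\zeta)=\operatorname{Im}(z\overline{\zeta}). \] The Korányi metric on $\mathbb{H}$ is \[ d_{\mathbb{H}}((z,t),(\zeta,\tau)) = \left\lVert (\zeta,\tau)^{-1}\ast(z,t)\right\rVert_{\mathbb{H}}, \qquad \left\lVert (z,t)\right\rVert_{\mathbb{H}} = \left(|z|^4+t^2\right)^{1/4}. \] For every subset of $\mathbb{H}$, $\dim$ denotes its Hausdorff dimension with respect to the metric $d_{\mathbb{H}}$ (this applies both to $A$ and to its projections). For $\theta\in[0,\pi)$ let \[ \mathbb{V}_{\theta}^{\perp} = \{(\lambda_1 i e^{i\theta},\lambda_2)\in\mathbb{C}\times\mathbb{R} : \lambda_1,\lambda_2\in\mathbb{R}\}, \qquad \mathbb{V}_{\theta}=\{(\lambda e^{i\theta},0)\in\mathbb{C}\times\mathbb{R}:\lambda\in\mathbb{R}\}. \] Each $(z,t)\in\mathbb{H}$ can be uniquely written as $(z,t)=P_{\mathbb{V}_{\theta}^{\perp}}(z,t)\ast P_{\mathbb{V}_{\theta}}(z,t)$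 with $P_{\mathbb{V}_{\theta}^{\perp}}(z,t)\in\mathbb{V}_{\theta}^{\perp}$ and $P_{\mathbb{V}_{\theta}}(z,t)\in\mathbb{V}_{\theta}$; this defines the vertical projection $P_{\mathbb{V}_{\theta}^{\perp}}:\mathbb{H}\to\mathbb{V}_{\theta}^{\perp}$. Explicitly, \[ P_{\mathbb{V}_{\theta}^{\perp}}(z,t) = \left(\pi_{V_{\theta}^{\perp}}(z),\ t+2\omega(\pi_{V_{\theta}}(z),z)\right), \] where $\pi_{V_{\theta}^{\perp}}$ and $\pi_{V_{\theta}}$ are the orthogonal projections of $\mathbb{C}\cong\mathbb{R}^2$ onto the real lines through the origin with directions $ie^{i\theta}$ and $e^{i\theta}$ respectively. *)

theory Defs
  imports "HOL-Analysis.Analysis"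
begin

definition ediam :: "('a \<Rightarrow> 'a \<Rightarrow> real) \<Rightarrow> 'a set \<Rightarrow> ennreal" where
  "ediam d U = (SUP x\<in>U. SUP y\<in>U. ennreal (d x y))"

text \<open>
  The sets of an admissible cover have diameter at most \<open>\<delta>\<close>, so \<^const>\<open>enn2real\<close> only ever
  sees finite values. The exponent is meant to be positive: since \<open>0 powr 0 = 0\<close>, the value at
  \<open>s = 0\<close> is not the counting measure. The dimension below only uses \<open>s > 0\<close>.
\<close>

definition hausdorff_content :: "('a \<Rightarrow> 'a \<Rightarrow> real) \<Rightarrow> real \<Rightarrow> real \<Rightarrow> 'a set \<Rightarrow> ennreal" where
  "hausdorff_content d s \<delta> A =
     Inf {(\<Sum>i. ennreal (enn2real (ediam d (U i)) powr s)) | U :: nat \<Rightarrow> 'a set.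
            A \<subseteq> (\<Union>i. U i) \<and> (\<forall>i. ediam d (U i) \<le> ennreal \<delta>)}"

definition hausdorff_measure :: "('a \<Rightarrow> 'a \<Rightarrow> real) \<Rightarrow> real \<Rightarrow> 'a set \<Rightarrow> ennreal" where
  "hausdorff_measure d s A = (SUP \<delta>\<in>{0<..}. hausdorff_content d s \<delta> A)"

definition hausdorff_dim :: "('a \<Rightarrow> 'a \<Rightarrow> real) \<Rightarrow> 'a set \<Rightarrow> ennreal" where
  "hausdorff_dim d A = Inf {ennreal s | s. 0 < s \<and> hausdorff_measure d s A = 0}"

text \<open>Analytic (Suslin) sets: the empty set and the continuous images of the Baire space.\<close>

definition analytic_in :: "'a topology \<Rightarrow> 'a set \<Rightarrow> bool" where
  "analytic_in X A \<longleftrightarrow> A = {} \<or>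
     (\<exists>f :: (nat \<Rightarrow> nat) \<Rightarrow> 'a.
        continuous_map (product_topology (\<lambda>_. discrete_topology UNIV) UNIV) X f \<and> range f = A)"

type_synonym heis = "complex \<times> real"

definition symp :: "complex \<Rightarrow> complex \<Rightarrow> real" where
  "symp z w = Im (z * cnj w)"

definition hmult :: "heis \<Rightarrow> heis \<Rightarrow> heis" where
  "hmult p q = (fst p + fst q, snd p + snd q + 2 * symp (fst p) (fst q))"

definition hinv :: "heis \<Rightarrow> heis" where
  "hinv p = (- fst p, - snd p)"

definition koranyi_norm :: "heis \<Rightarrow> real" where
  "koranyi_norm p = root 4 (norm (fst p) ^ 4 + (snd p)\<^sup>2)"

definition koranyi_dist :: "heis \<Rightarrow> heis \<Rightarrow> real" where
  "koranyi_dist p q = koranyi_norm (hmult (hinv q) p)"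

lemma hmult_assoc: "hmult (hmult p q) r = hmult p (hmult q r)"
  by (simp add: hmult_def symp_def algebra_simps)

lemma hmult_zero [simp]: "hmult (0, 0) p = p" "hmult p (0, 0) = p"
  by (simp_all add: hmult_def symp_def)

lemma hinv_hmult [simp]: "hmult (hinv p) p = (0, 0)" "hmult p (hinv p) = (0, 0)"
  by (simp_all add: hmult_def hinv_def symp_def)

lemma koranyi_norm_eq: "koranyi_norm p = sqrt (cmod (Complex ((cmod (fst p))\<^sup>2) (snd p)))"
proof -
  have "koranyi_norm p = root (2 * 2) (norm (fst p) ^ 4 + (snd p)\<^sup>2)"
    by (simp add: koranyi_norm_def)
  also have "\<dots> = sqrt (sqrt (norm (fst p) ^ 4 + (snd p)\<^sup>2))"
    unfolding real_root_mult_exp sqrt_def ..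
  finally show ?thesis by (simp add: complex_norm power_mult[symmetric])
qed

lemma koranyi_norm_nonneg: "0 \<le> koranyi_norm p"
  by (simp add: koranyi_norm_eq)

lemma koranyi_norm_eq_0: "koranyi_norm p = 0 \<longleftrightarrow> p = (0, 0)"
  by (cases p) (auto simp: koranyi_norm_eq complex_eq_iff)

lemma koranyi_norm_hinv: "koranyi_norm (hinv p) = koranyi_norm p"
  by (simp add: koranyi_norm_def hinv_def)

lemma norm_fst_le_koranyi_norm: "norm (fst p) \<le> koranyi_norm p"
  unfolding koranyi_norm_eq
  by (rule real_le_rsqrt) (metis abs_Re_le_cmod abs_power2 abs_norm_cancel complex.sel(1))

lemma koranyi_norm_triangle: "koranyi_norm (hmult p q) \<le> koranyi_norm p + koranyi_norm q"
proof -
  define a where "a = Complex ((cmod (fst p))\<^sup>2) (snd p)"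
  define b where "b = Complex ((cmod (fst q))\<^sup>2) (snd q)"
  define c where "c = 2 * (fst p * cnj (fst q))"
  have "Complex ((cmod (fst (hmult p q)))\<^sup>2) (snd (hmult p q)) = a + b + c"
    by (simp add: a_def b_def c_def hmult_def symp_def complex_eq_iff cmod_power2)
       (simp add: power2_eq_square algebra_simps)
  then have "(koranyi_norm (hmult p q))\<^sup>2 = cmod (a + b + c)"
    by (simp add: koranyi_norm_eq)
  also have "\<dots> \<le> cmod a + cmod b + cmod c"
    by (meson norm_triangle_ineq norm_triangle_mono order_refl)
  also have "\<dots> \<le> cmod a + cmod b + 2 * (koranyi_norm p * koranyi_norm q)"
    unfolding c_def norm_mult
    by (simp, intro mult_mono norm_fst_le_koranyi_norm koranyi_norm_nonneg norm_ge_zero)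
  also have "\<dots> = (koranyi_norm p + koranyi_norm q)\<^sup>2"
    by (simp add: power2_sum a_def b_def koranyi_norm_eq)
  finally show ?thesis
    by (rule power2_le_imp_le) (intro add_nonneg_nonneg koranyi_norm_nonneg)
qed

interpretation koranyi: Metric_space UNIV koranyi_dist
proof
  fix p q r :: heis
  show "0 \<le> koranyi_dist p q"
    by (simp add: koranyi_dist_def koranyi_norm_nonneg)
  have "hinv (hmult (hinv q) p) = hmult (hinv p) q"
    by (simp add: hmult_def hinv_def symp_def algebra_simps)
  then show "koranyi_dist p q = koranyi_dist q p"
    by (metis koranyi_dist_def koranyi_norm_hinv)
  show "koranyi_dist p q = 0 \<longleftrightarrow> p = q"
    by (auto simp: koranyi_dist_def koranyi_norm_eq_0)
       (metis hinv_hmult(2) hmult_assoc hmult_zero)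
  have "hmult (hinv r) p = hmult (hmult (hinv r) q) (hmult (hinv q) p)"
    by (metis hinv_hmult(2) hmult_assoc hmult_zero(1))
  then show "koranyi_dist p r \<le> koranyi_dist p q + koranyi_dist q r"
    by (metis koranyi_dist_def koranyi_norm_triangle add.commute)
qed

lemma koranyi_mtopology: "koranyi.mtopology = euclidean"
proof (rule topology_eq[THEN iffD2], intro allI iffI)
  fix S :: "heis set"
  have cont: "continuous_on UNIV (\<lambda>q. koranyi_dist p q)" for p
    unfolding koranyi_dist_def koranyi_norm_def hmult_def hinv_def symp_def
    by (intro continuous_intros; simp)
  show "openin euclidean S" if S: "openin koranyi.mtopology S"
  proof -
    have "open (koranyi.mball p r)" for p r
    proof -
      have "koranyi.mball p r = (\<lambda>q. koranyi_dist p q) -` {..<r}" by auto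
      then show ?thesis using cont[of p] by (simp add: open_vimage)
    qed
    moreover have "S = \<Union>{koranyi.mball p r | p r. koranyi.mball p r \<subseteq> S}"
    proof (intro equalityI subsetI)
      fix p assume "p \<in> S"
      then obtain r where "r > 0" "koranyi.mball p r \<subseteq> S"
        using S unfolding koranyi.openin_mtopology by blast
      moreover have "p \<in> koranyi.mball p r" using \<open>r > 0\<close> by simp
      ultimately show "p \<in> \<Union>{koranyi.mball p r | p r. koranyi.mball p r \<subseteq> S}" by blast
    qed blast
    moreover have "open (\<Union>{koranyi.mball p r | p r. koranyi.mball p r \<subseteq> S})"
      using \<open>\<And>r p. open (koranyi.mball p r)\<close> by (intro open_Union) blast
    ultimately show ?thesis by simp
  qed
  show "openin koranyi.mtopology S" if S: "openin euclidean S"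
    unfolding koranyi.openin_mtopology
  proof (intro conjI allI impI subset_UNIV)
    fix p assume "p \<in> S"
    then obtain e where e: "e > 0" "ball p e \<subseteq> S"
      using S by (metis open_contains_ball open_openin)
    define K where "K = 2 * cmod (fst p)"
    have K: "K \<ge> 0" by (simp add: K_def)
    define r where "r = min 1 (e / (2 + K + 1))"
    have r: "r > 0" "r \<le> 1"
      using e K by (auto simp: r_def)
    have "r \<le> e / (2 + K + 1)" by (simp add: r_def)
    then have re: "r * (2 + K + 1) \<le> e"
      using K by (simp add: pos_le_divide_eq)
    have "koranyi.mball p r \<subseteq> ball p e"
    proof
      fix q assume "q \<in> koranyi.mball p r"
      then have d: "koranyi_dist q p < r" by (simp add: koranyi.commute)
      define v where "v = hmult (hinv p) q"
      have N: "koranyi_norm v < r" using d by (simp add: koranyi_dist_def v_def)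
      have 1: "cmod (fst q - fst p) < r"
        using norm_fst_le_koranyi_norm[of v] N by (simp add: v_def hmult_def hinv_def)
      have "\<bar>snd v\<bar> \<le> (koranyi_norm v)\<^sup>2"
        using abs_Im_le_cmod[of "Complex ((cmod (fst v))\<^sup>2) (snd v)"] by (simp add: koranyi_norm_eq)
      also have "\<dots> \<le> r * 1"
        unfolding power2_eq_square using N r koranyi_norm_nonneg[of v]
        by (intro mult_mono) auto
      finally have 2: "\<bar>snd v\<bar> \<le> r" by simp
      have "snd q - snd p = snd v + 2 * symp (fst p) (fst q - fst p)"
        by (simp add: v_def hmult_def hinv_def symp_def algebra_simps)
      moreover have "\<bar>symp (fst p) (fst q - fst p)\<bar> \<le> cmod (fst p) * r"
      proof -
        have "\<bar>symp (fst p) (fst q - fst p)\<bar> \<le> cmod (fst p * cnj (fst q - fst p))"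
          unfolding symp_def by (rule abs_Im_le_cmod)
        also have "\<dots> = cmod (fst p) * cmod (fst q - fst p)"
          by (simp only: norm_mult complex_mod_cnj)
        also have "\<dots> \<le> cmod (fst p) * r" using 1 by (intro mult_left_mono) auto
        finally show ?thesis .
      qed
      ultimately have 3: "\<bar>snd q - snd p\<bar> \<le> r + K * r"
        using 2 by (simp add: K_def)
      have "dist p q \<le> dist (fst p) (fst q) + dist (snd p) (snd q)"
        unfolding dist_prod_def by (rule sqrt_sum_squares_le_sum) auto
      also have "\<dots> < r + (r + K * r)"
        using 1 3 by (simp add: dist_norm norm_minus_commute)
      also have "\<dots> \<le> r * (2 + K + 1)" using r by (simp add: algebra_simps)
      finally show "q \<in> ball p e" using re by simp
    qed
    then show "\<exists>r>0. koranyi.mball p r \<subseteq> S" using e r by blast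
  qed
qed

definition horizontal_line :: "real \<Rightarrow> heis set" where
  "horizontal_line \<theta> = {(of_real l * cis \<theta>, 0) | l. True}"

definition vertical_plane :: "real \<Rightarrow> heis set" where
  "vertical_plane \<theta> = {(of_real l1 * \<i> * cis \<theta>, l2) | l1 l2. True}"

definition vertical_proj :: "real \<Rightarrow> heis \<Rightarrow> heis" where
  "vertical_proj \<theta> p =
     (THE q. q \<in> vertical_plane \<theta> \<and> (\<exists>v\<in>horizontal_line \<theta>. p = hmult q v))"

lemma vertical_decomposition:
  fixes p :: heis and \<theta> :: real
  defines "a \<equiv> fst p \<bullet> cis \<theta>" and "b \<equiv> fst p \<bullet> (\<i> * cis \<theta>)"
  defines "q \<equiv> (of_real b * \<i> * cis \<theta>, snd p + 2 * symp (of_real a * cis \<theta>) (fst p))"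
    and "v \<equiv> (of_real a * cis \<theta>, 0)"
  shows "q \<in> vertical_plane \<theta>" "v \<in> horizontal_line \<theta>" "p = hmult q v"
    and "\<lbrakk>q' \<in> vertical_plane \<theta>; v' \<in> horizontal_line \<theta>; p = hmult q' v'\<rbrakk> \<Longrightarrow> q' = q \<and> v' = v"
proof -
  have cs: "cos \<theta> * cos \<theta> + sin \<theta> * sin \<theta> = 1"
    by (metis power2_eq_square sin_cos_squared_add2)
  show "q \<in> vertical_plane \<theta>" unfolding q_def vertical_plane_def by blast
  show "v \<in> horizontal_line \<theta>" unfolding v_def horizontal_line_def by blast
  have z: "fst p = of_real b * \<i> * cis \<theta> + of_real a * cis \<theta>"
    unfolding complex_eq_iff a_def b_def inner_complex_def by simp (use cs in algebra)
  have "symp (of_real b * \<i> * cis \<theta>) (of_real a * cis \<theta>) = - symp (of_real a * cis \<theta>) (fst p)"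
    by (subst z) (simp add: symp_def algebra_simps)
  then show "p = hmult q v"
    using z by (simp add: q_def v_def hmult_def prod_eq_iff)
  assume "q' \<in> vertical_plane \<theta>" "v' \<in> horizontal_line \<theta>" and eq: "p = hmult q' v'"
  then obtain l1 l2 l where q': "q' = (of_real l1 * \<i> * cis \<theta>, l2)" and v': "v' = (of_real l * cis \<theta>, 0)"
    unfolding vertical_plane_def horizontal_line_def by blast
  have p: "fst p = of_real l1 * \<i> * cis \<theta> + of_real l * cis \<theta>"
    using eq by (simp add: q' v' hmult_def)
  have ab: "a = l" "b = l1"
    unfolding a_def b_def p inner_complex_def by (simp_all, (use cs in algebra)+)
  then have "v' = v" by (simp add: v' v_def)
  moreover have "fst q' = fst q" using ab by (simp add: q' q_def)
  moreover have "snd q' = snd q"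
    using eq \<open>p = hmult q v\<close> \<open>v' = v\<close> \<open>fst q' = fst q\<close> by (simp add: hmult_def)
  ultimately show "q' = q \<and> v' = v" by (simp add: prod_eq_iff)
qed

lemma vertical_proj_eq:
  "vertical_proj \<theta> p =
     (of_real (fst p \<bullet> (\<i> * cis \<theta>)) * \<i> * cis \<theta>,
      snd p + 2 * symp (of_real (fst p \<bullet> cis \<theta>) * cis \<theta>) (fst p))"
  unfolding vertical_proj_def
  using vertical_decomposition[where p = p and \<theta> = \<theta>] by (intro the_equality) blast+

end

theory Submission
  imports Defs
begin

text \<open>
  The proof is the energy method: if a measure \<open>\<mu>\<close> on \<open>A\<close> has finite \<open>s\<close>-energy and
  \<open>\<integral> d(P\<^sub>\<theta> p, P\<^sub>\<theta> q) powr (-\<sigma>) d\<theta> \<le> C * d(p,q) powr (-s)\<close>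
  for all \<open>p\<close>, \<open>q\<close> in its support, then for almost every angle the image of \<open>\<mu>\<close> has finite
  \<open>\<sigma>\<close>-energy, so the projection of \<open>A\<close> has dimension at least \<open>\<sigma>\<close>. What is needed is this
  kernel bound for every \<open>s > 2\<sigma> - 1\<close> with \<open>1 \<le> \<sigma> < 2\<close>; then \<open>\<sigma>\<close> can be taken as close as
  desired to the minimum of \<open>(1 + dim A) / 2\<close> and \<open>2\<close>.

  The kernel bound. Let \<open>p = (z,t)\<close>, \<open>q = (\<zeta>,\<tau>)\<close>, \<open>u = z - \<zeta>\<close>, \<open>v = z + \<zeta>\<close>. The fourth power
  of the projected distance is \<open>G\<^sup>4 + F\<^sup>2\<close> with \<open>G = Im (u e\<^sup>-\<^sup>i\<^sup>\<theta>)\<close> and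
  \<open>F = t - \<tau> - Im (u v e\<^sup>-\<^sup>2\<^sup>i\<^sup>\<theta>)\<close>. As a function of the angle, \<open>F\<close> is a constant minus a sinusoid of
  amplitude \<open>|u v|\<close>, hence \<open>|F|\<close> is at least \<open>2 |u v|\<close> times a product of two sines
  (\<open>sine_level_factorization\<close>). The dangerous angles are those close to the direction of \<open>u\<close>,
  where \<open>G\<close> is small and only \<open>F\<close> helps. There the derivative of \<open>F\<close> is
  about \<open>\<plusminus> 2 |u| Re (v e\<^sup>-\<^sup>i\<^sup>\<theta>)\<close>. If \<open>p\<close> and \<open>q\<close> are close to a point \<open>(z0,t0)\<close> with \<open>z0 \<noteq> 0\<close>,
  then \<open>v\<close> is close to \<open>2 z0\<close>, so this is comparable to \<open>|u|\<close> uniformly over the angles with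
  \<open>|Re (z0 e\<^sup>-\<^sup>i\<^sup>\<theta>)| \<ge> c\<close>: one of the two sines stays away from zero and \<open>F\<close> has only simple zeros.
  Away from the direction of \<open>u\<close> a double zero of \<open>F\<close> is possible, but there \<open>G\<close> is at
  least a multiple of \<open>|u|\<close>. Interpolating between the two gives the exponent \<open>2\<sigma> - \<beta>\<close> for
  every \<open>\<beta> < 1\<close>; the worst case is \<open>|u|\<close> of size \<open>d(p,q)\<^sup>2\<close>, which is the order of the smallest
  horizontal distance for which \<open>F\<close> can vanish at all. See \<open>vertical_proj_kernel_integral\<close>.

  Letting \<open>c\<close> tend to zero exhausts all angles but one, so it suffices to know that arbitrarily
  small pieces of \<open>A\<close> around one point off the vertical axis \<open>z = 0\<close> carry a measure. If \<open>A\<close> has too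
  little mass off the axis, then it has enough mass on it, and every vertical projection
  fixes the axis pointwise.

  The measure. No measure on the group is constructed. A nested partition of the group
  into cells, dyadic squares in \<open>z\<close> times 4-adic intervals in a sheared vertical coordinate, makes
  Hausdorff content comparable to a content \<open>M\<close> in which the covering sets form a tree. In this
  setting \<open>M\<close> is continuous along increasing unions (\<open>content_incseq_le\<close>), so that an analytic set of
  positive content contains a compact set of positive content (\<open>analytic_inner_compact\<close>), and
  splitting the content proportionally down the tree gives at every level finitely many points with
  weights that satisfy Frostman's growth condition down to that level (\<open>discrete_frostman\<close>).
  Fatou's lemma over the levels bounds the energies of the projected weights along a subsequence of
  levels for almost every angle, and compactness of the projected set together with the
  Cauchy-Schwarz inequality turns this into a lower bound for Hausdorff measure
  (\<open>hausdorff_measure_pos_if_energy_bounded\<close>).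
\<close>

section \<open>Hausdorff content over a nested partition\<close>

lemma emeasure_UN_le_nn_integral:
  fixes X :: "'i::countable \<Rightarrow> 'b set"
  assumes X: "\<And>i. i \<in> I \<Longrightarrow> X i \<in> sets M"
  shows "emeasure M (\<Union>i\<in>I. X i) \<le> (\<integral>\<^sup>+i. emeasure M (X i) \<partial>count_space I)"
proof -
  define Y where "Y i = X i - (\<Union>j\<in>{j\<in>I. to_nat j < to_nat i}. X j)" for i
  have Y: "Y i \<in> sets M" if "i \<in> I" for i
    unfolding Y_def using that X by (intro sets.Diff sets.countable_UN'') auto
  have "disjoint_family_on Y I"
    unfolding disjoint_family_on_def
  proof (intro ballI impI)
    fix i j assume "i \<in> I" "j \<in> I" "i \<noteq> j"
    then have "to_nat i < to_nat j \<or> to_nat j < to_nat i"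
      by (metis to_nat_split linorder_neqE_nat inj_to_nat injD)
    then show "Y i \<inter> Y j = {}" using \<open>i \<in> I\<close> \<open>j \<in> I\<close> by (auto simp: Y_def)
  qed
  have "x \<in> (\<Union>i\<in>I. Y i)" if "x \<in> (\<Union>i\<in>I. X i)" for x
  proof -
    from that obtain i0 where "i0 \<in> I \<and> x \<in> X i0" by blast
    from ex_has_least_nat[of "\<lambda>i. i \<in> I \<and> x \<in> X i", OF this, of to_nat]
    obtain i where "i \<in> I \<and> x \<in> X i" "\<And>j. j \<in> I \<and> x \<in> X j \<Longrightarrow> to_nat i \<le> to_nat j"
      by blast
    then have "i \<in> I" "x \<in> Y i" by (auto simp: Y_def not_le[symmetric])
    then show ?thesis by blast
  qed
  then have "(\<Union>i\<in>I. X i) \<subseteq> (\<Union>i\<in>I. Y i)" by blast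
  then have "emeasure M (\<Union>i\<in>I. X i) \<le> emeasure M (\<Union>i\<in>I. Y i)"
    using Y by (intro emeasure_mono sets.countable_UN'') auto
  also have "\<dots> = (\<integral>\<^sup>+i. emeasure M (Y i) \<partial>count_space I)"
    using Y \<open>disjoint_family_on Y I\<close> by (intro emeasure_UN_countable) auto
  also have "\<dots> \<le> (\<integral>\<^sup>+i. emeasure M (X i) \<partial>count_space I)"
    using X by (intro nn_integral_mono emeasure_mono) (auto simp: Y_def)
  finally show ?thesis .
qed

definition piece :: "(nat \<Rightarrow> 'a \<Rightarrow> 'i) \<Rightarrow> 'a set \<Rightarrow> nat \<Rightarrow> 'i \<Rightarrow> 'a set" where
  "piece cell E n i = {x \<in> E. cell n x = i}"

text \<open>
  A sequence of partitions, each refining the previous one, given by labelling points: \<open>cell n x\<close> is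
  the label of the part of level \<open>n\<close> that contains \<open>x\<close>. The trivial partition at level \<open>0\<close> gives
  the tree of cells a root and keeps every content finite.
\<close>

locale nested_cells =
  fixes cell :: "nat \<Rightarrow> 'a \<Rightarrow> 'i::countable"
  assumes cell_root: "cell 0 x = cell 0 y"
    and cell_refine: "cell (Suc n) x = cell (Suc n) y \<Longrightarrow> cell n x = cell n y"
begin

lemma cell_coarsen: "cell n x = cell n y \<Longrightarrow> m \<le> n \<Longrightarrow> cell m x = cell m y"
  by (induction n) (auto simp: le_Suc_eq dest: cell_refine)

abbreviation "pc \<equiv> piece cell"

text \<open>
  A cell of level \<open>n\<close> costs \<open>q ^ n\<close>. For cells of diameter \<open>2\<^sup>-\<^sup>n\<close> and \<open>q = 2\<^sup>-\<^sup>s\<close> this is the cost of the cell in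
  Hausdorff measure of dimension \<open>s\<close>. A measure on the set of all cells makes the usual
  rules for sums over covers available.
\<close>

definition weight :: "real \<Rightarrow> (nat \<times> 'i) measure" where
  "weight q = density (count_space UNIV) (\<lambda>v. ennreal (q ^ fst v))"

definition covers :: "(nat \<times> 'i) set \<Rightarrow> 'a set \<Rightarrow> bool" where
  "covers C E \<longleftrightarrow> (\<forall>x\<in>E. \<exists>n. (n, cell n x) \<in> C)"

definition content :: "real \<Rightarrow> 'a set \<Rightarrow> ennreal" where
  "content q E = (INF C\<in>{C. covers C E}. emeasure (weight q) C)"

lemma sets_weight [simp]: "sets (weight q) = UNIV"
  by (simp add: weight_def)

lemma weight_singleton: "emeasure (weight q) {(n, i)} = ennreal (q ^ n)"
  by (simp add: weight_def emeasure_density nn_integral_count_space_indicator[symmetric])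

lemma weight_member: "(n, i) \<in> C \<Longrightarrow> ennreal (q ^ n) \<le> emeasure (weight q) C"
  by (subst weight_singleton[symmetric, of _ _ i]) (intro emeasure_mono, auto)

lemma content_le: "covers C E \<Longrightarrow> content q E \<le> emeasure (weight q) C"
  unfolding content_def by (rule INF_lower) simp

lemma content_lessE:
  assumes "content q E < c"
  obtains C where "covers C E" "emeasure (weight q) C < c"
  using assms unfolding content_def INF_less_iff by blast

lemma content_mono: "E \<subseteq> F \<Longrightarrow> content q E \<le> content q F"
  unfolding content_def by (intro INF_superset_mono) (auto simp: covers_def)

lemma content_piece_le: "content q (pc E n i) \<le> ennreal (q ^ n)"
  unfolding weight_singleton[symmetric, of q n i]
  by (rule content_le) (auto simp: covers_def piece_def)

lemma content_le_1: "content q E \<le> 1"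
proof -
  have "content q E \<le> emeasure (weight q) {(0, cell 0 undefined)}"
    by (rule content_le) (auto simp: covers_def cell_root)
  then show ?thesis by (simp add: weight_singleton)
qed

lemma content_finite [simp]: "content q E \<noteq> top"
  using content_le_1[of q E] by (auto simp: top_unique)

lemma content_empty [simp]: "content q {} = 0"
  using content_le[of "{}" "{}" q] by (simp add: covers_def)

lemma content_UN_le: "content q (\<Union>k::nat. E k) \<le> (\<Sum>k. content q (E k))"
proof (rule ennreal_le_epsilon)
  fix e :: real assume e: "0 < e" "(\<Sum>k. content q (E k)) < top"
  have "\<exists>C. covers C (E k) \<and> emeasure (weight q) C < content q (E k) + ennreal (e * (1/2) ^ Suc k)" for k
  proof -
    have "content q (E k) < content q (E k) + ennreal (e * (1/2) ^ Suc k)"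
      using e content_finite[of q "E k"] ennreal_add_left_cancel_less[of "content q (E k)" 0 "ennreal (e * (1/2) ^ Suc k)"]
      by simp
    then show ?thesis by (elim content_lessE) blast
  qed
  then obtain C where C: "\<And>k. covers (C k) (E k)"
      "\<And>k. emeasure (weight q) (C k) < content q (E k) + ennreal (e * (1/2) ^ Suc k)"
    by metis
  have "content q (\<Union>k. E k) \<le> emeasure (weight q) (\<Union>k. C k)"
    using C(1) by (intro content_le) (fastforce simp: covers_def)
  also have "\<dots> \<le> (\<Sum>k. emeasure (weight q) (C k))"
    by (rule emeasure_subadditive_countably) auto
  also have "\<dots> \<le> (\<Sum>k. content q (E k) + ennreal (e * (1/2) ^ Suc k))"
    using C(2) by (intro suminf_le less_imp_le) auto
  also have "\<dots> = (\<Sum>k. content q (E k)) + (\<Sum>k. ennreal (e * (1/2) ^ Suc k))"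
    by (rule suminf_add[symmetric]) auto
  also have "(\<Sum>k. ennreal (e * (1/2) ^ Suc k)) = ennreal e"
  proof -
    have "(\<lambda>k. e * (1/2) ^ Suc k) sums (e * 1)"
      by (intro sums_mult power_half_series)
    then show ?thesis using e by (intro suminf_ennreal_eq) auto
  qed
  finally show "content q (\<Union>k. E k) \<le> (\<Sum>k. content q (E k)) + ennreal e" .
qed

lemma content_Un_le: "content q (E \<union> F) \<le> content q E + content q F"
proof -
  have "(\<Union>k. (\<lambda>k. if k = 0 then E else if k = Suc 0 then F else {}) k) = E \<union> F"
    by (auto split: if_splits)
  moreover have "(\<Sum>k. content q (if k = 0 then E else if k = Suc 0 then F else {}))
      = (\<Sum>k\<in>{0, Suc 0}. content q (if k = 0 then E else if k = Suc 0 then F else {}))"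
    by (rule suminf_finite) auto
  ultimately show ?thesis
    using content_UN_le[of q "\<lambda>k. if k = 0 then E else if k = Suc 0 then F else {}"] by simp
qed

lemma content_finite_UN_le:
  "finite I \<Longrightarrow> content q (\<Union>i\<in>I. E i) \<le> (\<Sum>i\<in>I. content q (E i))"
proof (induction I rule: finite_induct)
  case (insert i I)
  then show ?case
    using content_Un_le[of q "E i" "\<Union>i\<in>I. E i"] by (auto intro: order_trans add_left_mono)
qed simp

text \<open>
  In a cover that is cheaper than the cell itself no cell of level at most \<open>n\<close> occurs, so every member
  lies below exactly one child and the cover splits into covers of the children.
  This additivity is what a content whose covering sets overlap arbitrarily lacks.
\<close>

lemma content_split:
  assumes q: "0 < q" "q < 1" and less: "content q (pc E n i) < ennreal (q ^ n)"
  shows "(\<integral>\<^sup>+j. content q (pc (pc E n i) (Suc n) j) \<partial>count_space UNIV) \<le> content q (pc E n i)"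
    (is "?S \<le> _")
proof (rule ccontr)
  assume "\<not> ?thesis"
  then have "content q (pc E n i) < min ?S (ennreal (q ^ n))" using less by (simp only: min_less_iff_conj not_le)
  then obtain C where C: "covers C (pc E n i)" "emeasure (weight q) C < min ?S (ennreal (q ^ n))"
    by (rule content_lessE)
  have C2: "emeasure (weight q) C < ?S" "emeasure (weight q) C < ennreal (q ^ n)"
    using C(2) by (simp_all only: min_less_iff_conj)
  define D where "D j = {v \<in> C. n < fst v \<and> (\<exists>x. cell (fst v) x = snd v \<and> cell (Suc n) x = j)}" for j
  have "covers (D j) (pc (pc E n i) (Suc n) j)" for j
    unfolding covers_def
  proof
    fix x assume x: "x \<in> pc (pc E n i) (Suc n) j"
    then obtain m where m: "(m, cell m x) \<in> C" using C(1) by (auto simp: covers_def piece_def)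
    have "n < m"
    proof (rule ccontr)
      assume "\<not> n < m"
      then have "ennreal (q ^ n) \<le> ennreal (q ^ m)" using q by (intro ennreal_leI power_decreasing) auto
      also have "\<dots> \<le> emeasure (weight q) C" using m by (rule weight_member)
      finally show False using C2(2) by (rule leD[THEN notE])
    qed
    then show "\<exists>m. (m, cell m x) \<in> D j" using m x by (auto simp: D_def piece_def)
  qed
  then have "?S \<le> (\<integral>\<^sup>+j. emeasure (weight q) (D j) \<partial>count_space UNIV)"
    by (intro nn_integral_mono content_le) auto
  also have "\<dots> = emeasure (weight q) (\<Union>j. D j)"
  proof (rule emeasure_UN_countable[symmetric])
    show "disjoint_family D"
      unfolding disjoint_family_on_def
    proof (intro ballI impI equals0I)
      fix j k v assume "j \<noteq> k" "v \<in> D j \<inter> D k"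
      then obtain x y where "cell (fst v) x = snd v" "cell (fst v) y = snd v"
          "cell (Suc n) x = j" "cell (Suc n) y = k" "n < fst v"
        unfolding D_def by blast
      then show False using cell_coarsen[of "fst v" x y "Suc n"] \<open>j \<noteq> k\<close> by simp
    qed
  qed auto
  also have "\<dots> \<le> emeasure (weight q) C" by (rule emeasure_mono) (auto simp: D_def)
  finally show False using C2(1) by (rule leD[THEN notE])
qed

definition content_at :: "real \<Rightarrow> 'a set \<Rightarrow> (nat \<times> 'i) measure" where
  "content_at q E = density (count_space UNIV) (\<lambda>v. content q (pc E (fst v) (snd v)))"

lemma sets_content_at [simp]: "sets (content_at q E) = UNIV"
  by (simp add: content_at_def)

lemma content_at_singleton: "emeasure (content_at q E) {(n, i)} = content q (pc E n i)"
  by (simp add: content_at_def emeasure_density nn_integral_count_space_indicator[symmetric])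

text \<open>
  Pairwise disjoint cells, all of whose strict ancestors are unsaturated (cheaper to cover by smaller cells
  than by themselves): splitting repeatedly from the root downwards distributes
  the content of \<open>E\<close> among them. Formally the induction goes upwards from level \<open>N\<close>.
\<close>

lemma content_at_antichain_le:
  fixes V :: "(nat \<times> 'i) set"
  assumes q: "0 < q" "q < 1"
    and anti: "\<And>n m x. (n, cell n x) \<in> V \<Longrightarrow> (m, cell m x) \<in> V \<Longrightarrow> n < m \<Longrightarrow> False"
    and unsat: "\<And>n m x. (m, cell m x) \<in> V \<Longrightarrow> n < m \<Longrightarrow> content q (pc E n (cell n x)) < ennreal (q ^ n)"
    and real: "\<And>n i. (n, i) \<in> V \<Longrightarrow> \<exists>x. cell n x = i"
  shows "emeasure (content_at q E) V \<le> content q E"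
proof -
  define D where "D n i N = {v \<in> V. n \<le> fst v \<and> fst v \<le> N \<and> (\<exists>x. cell (fst v) x = snd v \<and> cell n x = i)}"
    for n i N
  have bound: "emeasure (content_at q E) (D n i N) \<le> content q (pc E n i)" if "n \<le> N" for n N i
    using that
  proof (induction n arbitrary: i rule: inc_induct)
    case base
    have "D N i N \<subseteq> {(N, i)}" by (auto simp: D_def)
    then show ?case
      by (subst content_at_singleton[symmetric]) (rule emeasure_mono, auto)
  next
    case (step n)
    consider "D n i N = {}" | "(n, i) \<in> V" | "D n i N \<noteq> {}" "(n, i) \<notin> V" by blast
    then show ?case
    proof cases
      case 2
      have "D n i N \<subseteq> {(n, i)}"
      proof
        fix v assume v: "v \<in> D n i N"
        obtain m j where mj: "v = (m, j)" by (cases v)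
        with v obtain x where x: "cell m x = j" "cell n x = i" "n \<le> m" "(m, j) \<in> V" by (auto simp: D_def)
        have "\<not> n < m" by (rule notI, use anti[of n x m] 2 x(1,2,4) in simp)
        with x(3) have "n = m" by linarith
        then show "v \<in> {(n, i)}" using x mj by auto
      qed
      then show ?thesis
        by (subst content_at_singleton[symmetric]) (rule emeasure_mono, auto)
    next
      case 3
      then obtain m x where x: "(m, cell m x) \<in> V" "n \<le> m" "cell n x = i" by (auto simp: D_def)
      with 3 have "n < m" by (auto simp: le_less)
      then have sat: "content q (pc E n i) < ennreal (q ^ n)" using unsat x by blast
      define J where "J = {j. \<exists>x. cell (Suc n) x = j \<and> cell n x = i}"
      have "D n i N \<subseteq> (\<Union>j\<in>J. D (Suc n) j N)"
      proof
        fix v assume v: "v \<in> D n i N"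
        then have "fst v \<noteq> n" using 3 by (auto simp: D_def)
        then show "v \<in> (\<Union>j\<in>J. D (Suc n) j N)" using v by (fastforce simp: D_def J_def)
      qed
      then have "emeasure (content_at q E) (D n i N) \<le> emeasure (content_at q E) (\<Union>j\<in>J. D (Suc n) j N)"
        by (intro emeasure_mono) auto
      also have "\<dots> \<le> (\<integral>\<^sup>+j. emeasure (content_at q E) (D (Suc n) j N) \<partial>count_space J)"
        by (rule emeasure_UN_le_nn_integral) auto
      also have "\<dots> \<le> (\<integral>\<^sup>+j. content q (pc (pc E n i) (Suc n) j) \<partial>count_space J)"
      proof (rule nn_integral_mono)
        fix j assume "j \<in> space (count_space J)"
        then obtain x where x: "cell (Suc n) x = j" "cell n x = i" by (auto simp: J_def)
        then have "pc (pc E n i) (Suc n) j = pc E (Suc n) j"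
          by (auto simp: piece_def dest: cell_refine)
        then show "emeasure (content_at q E) (D (Suc n) j N) \<le> content q (pc (pc E n i) (Suc n) j)"
          using step.IH[of j] by simp
      qed
      also have "\<dots> \<le> (\<integral>\<^sup>+j. content q (pc (pc E n i) (Suc n) j) \<partial>count_space UNIV)"
        by (subst nn_integral_count_space_indicator) (auto intro!: nn_integral_mono simp: indicator_def)
      also have "\<dots> \<le> content q (pc E n i)" using q sat by (rule content_split)
      finally show ?thesis .
    qed simp
  qed
  have "V = (\<Union>N. {v \<in> V. fst v \<le> N})" by auto
  then have "emeasure (content_at q E) V = (SUP N. emeasure (content_at q E) {v \<in> V. fst v \<le> N})"
    by (subst SUP_emeasure_incseq) (auto simp: incseq_def)
  also have "\<dots> \<le> content q E"
  proof (rule SUP_least)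
    fix N :: nat
    have "{v \<in> V. fst v \<le> N} = D 0 (cell 0 undefined) N"
      using real cell_root by (auto simp: D_def)
    moreover have "pc E 0 (cell 0 undefined) = E" using cell_root by (auto simp: piece_def)
    ultimately show "emeasure (content_at q E) {v \<in> V. fst v \<le> N} \<le> content q E"
      using bound[of 0 N "cell 0 undefined"] by simp
  qed
  finally show ?thesis .
qed

text \<open>
  Every member of a cover can be replaced by a cover of what it contains that is cheaper by the factor \<open>r\<close>;
  hence the content is at most \<open>r\<close> times itself.
\<close>

lemma content_null_if_locally_small:
  assumes q: "0 < q" "q < 1" and r: "0 < r" "r < 1"
    and small: "\<And>x n. x \<in> G \<Longrightarrow> content q (pc G n (cell n x)) < ennreal (r * q ^ n)"
  shows "content q G = 0"
proof (rule ccontr)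
  have refine: "content q G \<le> ennreal r * emeasure (weight q) C" if C: "covers C G" for C
  proof -
    define C0 where "C0 = {v \<in> C. pc G (fst v) (snd v) \<noteq> {}}"
    have "\<exists>B. covers B (pc G (fst v) (snd v)) \<and> emeasure (weight q) B < ennreal (r * q ^ fst v)"
      if v: "v \<in> C0" for v
    proof -
      obtain x where x: "x \<in> G" "snd v = cell (fst v) x"
        using v by (force simp: C0_def piece_def)
      show ?thesis using small[OF x(1), of "fst v"] unfolding x(2) by (elim content_lessE) blast
    qed
    then obtain B where B: "\<And>v. v \<in> C0 \<Longrightarrow> covers (B v) (pc G (fst v) (snd v))"
       "\<And>v. v \<in> C0 \<Longrightarrow> emeasure (weight q) (B v) < ennreal (r * q ^ fst v)"
      by metis
    have "covers (\<Union>v\<in>C0. B v) G"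
      unfolding covers_def
    proof
      fix x assume x: "x \<in> G"
      then obtain n where n: "(n, cell n x) \<in> C" using C by (auto simp: covers_def)
      have xp: "x \<in> pc G n (cell n x)" using x by (simp add: piece_def)
      then have v: "(n, cell n x) \<in> C0" using n by (auto simp: C0_def)
      then obtain m where "(m, cell m x) \<in> B (n, cell n x)"
        using B(1)[OF v] xp by (auto simp: covers_def)
      then show "\<exists>m. (m, cell m x) \<in> (\<Union>v\<in>C0. B v)" using v by blast
    qed
    then have "content q G \<le> emeasure (weight q) (\<Union>v\<in>C0. B v)" by (rule content_le)
    also have "\<dots> \<le> (\<integral>\<^sup>+v. emeasure (weight q) (B v) \<partial>count_space C0)"
      by (rule emeasure_UN_le_nn_integral) simp
    also have "\<dots> \<le> (\<integral>\<^sup>+v. ennreal r * ennreal (q ^ fst v) \<partial>count_space C0)"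
      using q r by (intro nn_integral_mono) (simp add: B(2) less_imp_le ennreal_mult[symmetric])
    also have "\<dots> = ennreal r * (\<integral>\<^sup>+v. ennreal (q ^ fst v) * indicator C0 v \<partial>count_space UNIV)"
      by (simp add: nn_integral_cmult nn_integral_count_space_indicator)
    also have "\<dots> = ennreal r * emeasure (weight q) C0"
      by (simp add: weight_def emeasure_density)
    also have "\<dots> \<le> ennreal r * emeasure (weight q) C"
      by (intro mult_left_mono emeasure_mono) (auto simp: C0_def)
    finally show ?thesis .
  qed
  assume nz: "content q G \<noteq> 0"
  obtain c where c: "content q G = ennreal c" "0 \<le> c"
    by (cases "content q G") (auto dest: arg_cong[where f="\<lambda>x. x = top"])
  with nz have "0 < c" by (auto simp: less_le)
  then have "c < c / r" using r by (simp add: field_simps)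
  then have "content q G < ennreal (c / r)" using c by (simp add: ennreal_lessI \<open>0 < c\<close> r)
  then obtain C where C: "covers C G" "emeasure (weight q) C < ennreal (c / r)"
    by (rule content_lessE)
  have "ennreal c \<le> ennreal r * emeasure (weight q) C" using refine[OF C(1)] c by simp
  also have "\<dots> < ennreal r * ennreal (c / r)"
    using r C(2) by (intro ennreal_mult_strict_left_mono) auto
  also have "\<dots> = ennreal c" using r \<open>0 < c\<close> by (simp add: ennreal_mult[symmetric])
  finally show False by simp
qed

text \<open>
  The increasing sets lemma. Call a cell near-saturated if the limit of the contents of the \<open>E k\<close>
  inside it is at least \<open>r\<close> times its cost. The maximal near-saturated cells form an antichain with
  unsaturated ancestors, so their total cost is at most \<open>L / r\<close>. A point outside all of them lies
  only in cells in which every \<open>E k\<close> is small, and such points have content zero. Now let \<open>r\<close> tend to \<open>1\<close>.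
\<close>

lemma content_incseq_le:
  assumes q: "0 < q" "q < 1" and inc: "incseq E" and L: "\<And>k. content q (E k) \<le> L"
  shows "content q (\<Union>k. E k) \<le> L"
proof -
  have key: "ennreal r * content q (\<Union>k. E k) \<le> L" if r: "0 < r" "r < 1" for r :: real
  proof -
    define lim where "lim v = (SUP k. content q (pc (E k) (fst v) (snd v)))" for v
    define near where "near n x \<longleftrightarrow> ennreal (r * q ^ n) \<le> lim (n, cell n x)" for n x
    define V where "V = {(n, cell n x) | n x. near n x \<and> (\<forall>k<n. \<not> near k x)}"
    have near_cong: "near n x \<longleftrightarrow> near n y" if "cell n x = cell n y" for n x y
      using that by (simp add: near_def)
    have VD: "near n x \<and> (\<forall>k<n. \<not> near k x)" if "(n, cell n x) \<in> V" for n x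
    proof -
      from that obtain y where y: "cell n x = cell n y" "near n y" "\<forall>k<n. \<not> near k y"
        by (auto simp: V_def)
      have "near k x \<longleftrightarrow> near k y" if "k \<le> n" for k
        by (rule near_cong[OF cell_coarsen[OF y(1) that]])
      with y show ?thesis by auto
    qed
    have "emeasure (content_at q (E k)) V \<le> content q (E k)" for k
    proof (rule content_at_antichain_le[OF q])
      fix n m x assume "(n, cell n x) \<in> V" "(m, cell m x) \<in> V" "n < m"
      then show False using VD by blast
    next
      fix n m x assume V: "(m, cell m x) \<in> V" "n < m"
      have "content q (pc (E k) n (cell n x)) \<le> lim (n, cell n x)"
        by (auto simp: lim_def intro: SUP_upper2[of k])
      also have "\<dots> < ennreal (r * q ^ n)" using VD[OF V(1)] V(2) by (auto simp: near_def)
      also have "\<dots> \<le> ennreal (q ^ n)" using q r by (intro ennreal_leI) (simp add: mult_le_cancel_right1)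
      finally show "content q (pc (E k) n (cell n x)) < ennreal (q ^ n)" .
    qed (auto simp: V_def)
    then have le_L: "emeasure (content_at q (E k)) V \<le> L" for k using L order_trans by blast
    have "ennreal r * emeasure (weight q) V = (\<integral>\<^sup>+v. ennreal r * (ennreal (q ^ fst v) * indicator V v) \<partial>count_space UNIV)"
      by (simp add: weight_def emeasure_density nn_integral_cmult)
    also have "\<dots> \<le> (\<integral>\<^sup>+v. lim v * indicator V v \<partial>count_space UNIV)"
    proof (rule nn_integral_mono)
      fix v
      show "ennreal r * (ennreal (q ^ fst v) * indicator V v) \<le> lim v * indicator V v"
      proof (cases "v \<in> V")
        case True
        then show ?thesis using q r by (auto simp: V_def near_def ennreal_mult[symmetric])
      qed simp
    qed
    also have "\<dots> = (\<integral>\<^sup>+v. (SUP k. content q (pc (E k) (fst v) (snd v)) * indicator V v) \<partial>count_space UNIV)"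
      by (simp add: lim_def SUP_mult_right_ennreal)
    also have "\<dots> = (SUP k. \<integral>\<^sup>+v. content q (pc (E k) (fst v) (snd v)) * indicator V v \<partial>count_space UNIV)"
    proof (rule nn_integral_monotone_convergence_SUP)
      show "incseq (\<lambda>k v. content q (pc (E k) (fst v) (snd v)) * indicator V v)"
        using inc by (auto simp: incseq_def le_fun_def piece_def intro!: mult_right_mono content_mono)
    qed simp
    also have "\<dots> = (SUP k. emeasure (content_at q (E k)) V)"
      by (simp add: content_at_def emeasure_density)
    also have "\<dots> \<le> L" using le_L by (rule SUP_least)
    finally have VL: "ennreal r * emeasure (weight q) V \<le> L" .
    define E' where "E' = {x \<in> (\<Union>k. E k). \<forall>n. \<not> near n x}"
    have "content q (E' \<inter> E k) = 0" for k
    proof (rule content_null_if_locally_small[OF q r])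
      fix x n assume x: "x \<in> E' \<inter> E k"
      have "content q (pc (E' \<inter> E k) n (cell n x)) \<le> content q (pc (E k) n (cell n x))"
        by (rule content_mono) (auto simp: piece_def)
      also have "\<dots> \<le> lim (n, cell n x)" by (auto simp: lim_def intro: SUP_upper2[of k])
      also have "\<dots> < ennreal (r * q ^ n)" using x by (simp add: E'_def near_def not_le)
      finally show "content q (pc (E' \<inter> E k) n (cell n x)) < ennreal (r * q ^ n)" .
    qed
    moreover have "E' = (\<Union>k. E' \<inter> E k)" by (auto simp: E'_def)
    ultimately have "content q E' = 0"
      using content_UN_le[of q "\<lambda>k. E' \<inter> E k"] by simp
    have "(\<Union>k. E k) \<subseteq> E' \<union> {x. \<exists>n. near n x}" by (auto simp: E'_def)
    then have "content q (\<Union>k. E k) \<le> content q E' + content q {x. \<exists>n. near n x}"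
      by (rule order_trans[OF content_mono content_Un_le])
    also have "content q {x. \<exists>n. near n x} \<le> emeasure (weight q) V"
    proof (rule content_le)
      show "covers V {x. \<exists>n. near n x}"
        unfolding covers_def
      proof clarify
        fix x n assume "near n x"
        then have "near (LEAST n. near n x) x" by (rule LeastI)
        moreover have "\<forall>k<(LEAST n. near n x). \<not> near k x" using not_less_Least by blast
        ultimately have "(LEAST n. near n x, cell (LEAST n. near n x) x) \<in> V" unfolding V_def by blast
        then show "\<exists>n. (n, cell n x) \<in> V" ..
      qed
    qed
    finally have "content q (\<Union>k. E k) \<le> emeasure (weight q) V"
      using \<open>content q E' = 0\<close> by simp
    then have "ennreal r * content q (\<Union>k. E k) \<le> ennreal r * emeasure (weight q) V"
      by (rule mult_left_mono) simp
    with VL show ?thesis by (rule order_trans[rotated])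
  qed
  obtain c where c: "content q (\<Union>k. E k) = ennreal c" "0 \<le> c"
    by (cases "content q (\<Union>k. E k)") (auto dest: arg_cong[where f="\<lambda>x. x = top"])
  have "((\<lambda>r. ennreal (r * c)) \<longlongrightarrow> ennreal (1 * c)) (at_left 1)"
    by (intro tendsto_intros)
  moreover have "eventually (\<lambda>r. ennreal (r * c) \<le> L) (at_left 1)"
    by (rule eventually_at_leftI[of 0]) (use key c in \<open>simp_all add: ennreal_mult\<close>)
  ultimately show ?thesis
    unfolding c(1) by (intro tendsto_upperbound[of _ "ennreal c" "at_left (1::real)"]) simp_all
qed

text \<open>
  Frostman's lemma up to a finite level. The mass of a cell is divided among its children in proportion to their
  contents. By subadditivity the contents of the children add up to at least the content of the
  cell, so the mass of a cell never exceeds its content, which in turn is at most its cost.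
\<close>

lemma discrete_frostman:
  assumes q: "0 < q" "q < 1" and fin: "\<And>n. finite (cell n ` E)"
  shows "\<exists>X w. finite X \<and> X \<subseteq> E \<and> (\<forall>x. 0 \<le> w x) \<and> (\<Sum>x\<in>X. w x) = enn2real (content q E) \<and>
      (\<forall>n\<le>N. \<forall>i. (\<Sum>x\<in>{x\<in>X. cell n x = i}. w x) \<le> q ^ n)"
proof -
  define g where "g n i = enn2real (content q (pc E n i))" for n i
  have g0: "0 \<le> g n i" for n i by (simp add: g_def)
  have g_le: "g n i \<le> q ^ n" for n i
    unfolding g_def using content_piece_le[of q E n i] q by (simp add: enn2real_leI)
  define kids where "kids n i = cell (Suc n) ` pc E n i" for n i
  have fin_kids: "finite (kids n i)" for n i
    unfolding kids_def by (rule finite_subset[OF _ fin[of "Suc n"]]) (auto simp: piece_def)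
  have g_sub: "g n i \<le> (\<Sum>j\<in>kids n i. g (Suc n) j)" for n i
  proof -
    have "pc E n i \<subseteq> (\<Union>j\<in>kids n i. pc E (Suc n) j)" by (auto simp: kids_def piece_def)
    then have "content q (pc E n i) \<le> (\<Sum>j\<in>kids n i. content q (pc E (Suc n) j))"
      by (rule order_trans[OF content_mono content_finite_UN_le[OF fin_kids]])
    also have "\<dots> = ennreal (\<Sum>j\<in>kids n i. g (Suc n) j)"
      by (subst sum_ennreal[symmetric]) (simp_all add: g_def ennreal_enn2real_if)
    finally show ?thesis unfolding g_def[of n i] by (intro enn2real_leI) (auto simp: g0 sum_nonneg)
  qed
  define rep where "rep n i = (SOME x. x \<in> pc E n i)" for n i
  have rep: "rep n i \<in> E" "cell n (rep n i) = i" if "i \<in> cell n ` E" for n i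
  proof -
    from that obtain x where "x \<in> pc E n i" by (auto simp: piece_def)
    then have "rep n i \<in> pc E n i" unfolding rep_def by (rule someI)
    then show "rep n i \<in> E" "cell n (rep n i) = i" by (auto simp: piece_def)
  qed
  have "\<exists>v. (\<forall>i. 0 \<le> v i) \<and> (\<forall>i. v i \<le> g N i) \<and> (\<Sum>i\<in>cell N ` E. v i) = enn2real (content q E) \<and>
      (\<forall>n\<le>N. \<forall>i. (\<Sum>j\<in>cell N ` pc E n i. v j) \<le> g n i)"
  proof (induction N)
    case 0
    show ?case
    proof (intro exI[of _ "g 0"] conjI allI impI)
      show "(\<Sum>i\<in>cell 0 ` E. g 0 i) = enn2real (content q E)"
      proof (cases "E = {}")
        case False
        then have "cell 0 ` E = {cell 0 undefined}" using cell_root by (auto simp: image_iff)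
        moreover have "pc E 0 (cell 0 undefined) = E" using cell_root by (auto simp: piece_def)
        ultimately show ?thesis by (simp add: g_def)
      qed simp
      fix n i assume "n \<le> (0::nat)"
      moreover have "cell 0 ` pc E 0 i \<subseteq> {i}" by (auto simp: piece_def)
      then have "(\<Sum>j\<in>cell 0 ` pc E 0 i. g 0 j) \<le> (\<Sum>j\<in>{i}. g 0 j)"
        by (intro sum_mono2) (auto simp: g0)
      ultimately show "(\<Sum>j\<in>cell 0 ` pc E n i. g 0 j) \<le> g n i" by simp
    qed (auto simp: g0)
  next
    case (Suc N)
    then obtain v where v: "\<And>i. 0 \<le> v i" "\<And>i. v i \<le> g N i"
      "(\<Sum>i\<in>cell N ` E. v i) = enn2real (content q E)"
      "\<And>n i. n \<le> N \<Longrightarrow> (\<Sum>j\<in>cell N ` pc E n i. v j) \<le> g n i" by blast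
    define par where "par j = cell N (rep (Suc N) j)" for j
    have par: "par (cell (Suc N) x) = cell N x" if "x \<in> E" for x
      unfolding par_def using rep(2)[of "cell (Suc N) x" "Suc N"] that by (auto intro: cell_refine)
    define S where "S i = (\<Sum>j\<in>kids N i. g (Suc N) j)" for i
    have S0: "0 \<le> S i" for i by (simp add: S_def g0 sum_nonneg)
    define u where "u j = v (par j) * g (Suc N) j / S (par j)" for j
    have vS: "v i \<le> S i" for i using v(2)[of i] g_sub[of N i] by (simp add: S_def)
    have u0: "0 \<le> u j" for j by (simp add: u_def v(1) g0 S0)
    have u_le: "u j \<le> g (Suc N) j" for j
    proof (cases "S (par j) = 0")
      case False
      then have "0 < S (par j)" using S0[of "par j"] by simp
      then show ?thesis
        using mult_right_mono[OF vS[of "par j"] g0[of "Suc N" j]] by (simp add: u_def divide_le_eq mult.commute)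
    qed (simp add: u_def g0)
    have sum_kids: "(\<Sum>j\<in>kids N i. u j) = v i" for i
    proof -
      have "(\<Sum>j\<in>kids N i. u j) = (\<Sum>j\<in>kids N i. v i * g (Suc N) j / S i)"
        by (intro sum.cong refl) (auto simp: u_def kids_def piece_def par)
      also have "\<dots> = v i * S i / S i" by (simp add: S_def sum_distrib_left sum_divide_distrib)
      also have "\<dots> = v i" using vS[of i] v(1)[of i] by auto
      finally show ?thesis .
    qed
    have sum_part: "(\<Sum>j\<in>cell (Suc N) ` F. u j) = (\<Sum>i\<in>cell N ` F. v i)"
      if F: "F \<subseteq> E" "\<And>x y. x \<in> F \<Longrightarrow> y \<in> E \<Longrightarrow> cell N x = cell N y \<Longrightarrow> y \<in> F" for F
    proof -
      have eq: "cell (Suc N) ` F = (\<Union>i\<in>cell N ` F. kids N i)"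
        using F by (fastforce simp: kids_def piece_def)
      have "(\<Sum>j\<in>cell (Suc N) ` F. u j) = (\<Sum>i\<in>cell N ` F. \<Sum>j\<in>kids N i. u j)"
        unfolding eq
      proof (rule sum.UNION_disjoint)
        show "finite (cell N ` F)" using F(1) fin[of N] by (meson finite_subset image_mono)
        show "\<forall>i\<in>cell N ` F. \<forall>j\<in>cell N ` F. i \<noteq> j \<longrightarrow> kids N i \<inter> kids N j = {}"
          by (auto simp: kids_def piece_def dest: cell_refine)
      qed (auto simp: fin_kids)
      then show ?thesis by (simp add: sum_kids)
    qed
    show ?case
    proof (intro exI[of _ u] conjI allI impI)
      show "(\<Sum>i\<in>cell (Suc N) ` E. u i) = enn2real (content q E)"
        using sum_part[of E] v(3) by simp
      fix n i assume n: "n \<le> Suc N"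
      show "(\<Sum>j\<in>cell (Suc N) ` pc E n i. u j) \<le> g n i"
      proof (cases "n = Suc N")
        case True
        have "cell (Suc N) ` pc E (Suc N) i \<subseteq> {i}" by (auto simp: piece_def)
        then have "(\<Sum>j\<in>cell (Suc N) ` pc E n i. u j) \<le> (\<Sum>j\<in>{i}. u j)"
          unfolding True by (intro sum_mono2) (auto simp: u0)
        then show ?thesis using u_le[of i] True by simp
      next
        case False
        with n have "n \<le> N" by simp
        moreover have "(\<Sum>j\<in>cell (Suc N) ` pc E n i. u j) = (\<Sum>j\<in>cell N ` pc E n i. v j)"
        proof (rule sum_part)
          fix x y assume "x \<in> pc E n i" "y \<in> E" "cell N x = cell N y"
          then show "y \<in> pc E n i" using cell_coarsen[of N x y n] \<open>n \<le> N\<close> by (simp add: piece_def)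
        qed (simp add: piece_def)
        ultimately show ?thesis using v(4) by simp
      qed
    qed (auto simp: u0 u_le)
  qed
  then obtain v where v: "\<And>i. 0 \<le> v i" "(\<Sum>i\<in>cell N ` E. v i) = enn2real (content q E)"
      "\<And>n i. n \<le> N \<Longrightarrow> (\<Sum>j\<in>cell N ` pc E n i. v j) \<le> g n i" by blast
  define X where "X = rep N ` cell N ` E"
  have inj: "inj_on (rep N) (cell N ` E)" by (rule inj_on_inverseI[of _ "cell N"]) (auto simp: rep)
  show ?thesis
  proof (intro exI[of _ X] exI[of _ "\<lambda>x. v (cell N x)"] conjI allI impI)
    show "finite X" using fin by (simp add: X_def)
    show "X \<subseteq> E" by (auto simp: X_def rep)
    show "(\<Sum>x\<in>X. v (cell N x)) = enn2real (content q E)"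
      unfolding X_def using v(2) inj by (simp add: sum.reindex rep)
    fix n i assume n: "n \<le> N"
    have eq: "{x \<in> X. cell n x = i} = rep N ` cell N ` pc E n i"
    proof -
      have rn: "cell n (rep N (cell N x)) = cell n x" if "x \<in> E" for x
        by (rule cell_coarsen[OF rep(2) n]) (use that in simp)
      show ?thesis
      proof (intro equalityI subsetI)
        fix y assume "y \<in> {x \<in> X. cell n x = i}"
        then obtain x where x: "x \<in> E" "y = rep N (cell N x)" "cell n y = i" by (auto simp: X_def)
        then have "x \<in> pc E n i" using rn by (simp add: piece_def)
        then show "y \<in> rep N ` cell N ` pc E n i" using x(2) by blast
      next
        fix y assume "y \<in> rep N ` cell N ` pc E n i"
        then obtain x where x: "x \<in> pc E n i" "y = rep N (cell N x)" by blast
        then have "x \<in> E" "cell n y = i" using rn by (simp_all add: piece_def)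
        then show "y \<in> {x \<in> X. cell n x = i}" using x(2) by (simp add: X_def)
      qed
    qed
    have "(\<Sum>x\<in>{x\<in>X. cell n x = i}. v (cell N x)) = (\<Sum>j\<in>cell N ` pc E n i. v j)"
      unfolding eq by (subst sum.reindex[OF inj_on_subset[OF inj]]) (auto simp: piece_def rep intro!: sum.cong)
    also have "\<dots> \<le> q ^ n" using v(3)[OF n] g_le[of n i] by (rule order_trans)
    finally show "(\<Sum>x\<in>{x\<in>X. cell n x = i}. v (cell N x)) \<le> q ^ n" .
  qed (simp add: v)
qed

end

section \<open>Compact subsets of analytic sets\<close>

definition bounded_seqs :: "(nat \<Rightarrow> nat) \<Rightarrow> nat \<Rightarrow> (nat \<Rightarrow> nat) set" where
  "bounded_seqs b k = {x. \<forall>i<k. x i \<le> b i}"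

lemma closed_bounded_seqs: "closed (bounded_seqs b k)"
proof -
  have "bounded_seqs b k = (\<Inter>i\<in>{..<k}. {x. x i \<le> b i})" by (auto simp: bounded_seqs_def)
  moreover have "closed {x::nat \<Rightarrow> nat. x i \<le> b i}" for i
    by (intro closed_Collect_le continuous_on_product_coordinates continuous_intros)
  ultimately show ?thesis by auto
qed

lemma compact_dominated_seqs: "compact {x::nat \<Rightarrow> nat. \<forall>i. x i \<le> b i}"
proof -
  have "{x::nat \<Rightarrow> nat. \<forall>i. x i \<le> b i} = PiE UNIV (\<lambda>i. {..b i})" by (auto simp: PiE_def)
  moreover have "compactin (product_topology (\<lambda>_. euclidean) UNIV) (PiE UNIV (\<lambda>i. {..b i}))"
    by (subst compactin_PiE) (auto intro: finite_imp_compact)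
  ultimately show ?thesis by (simp add: euclidean_product_topology)
qed

text \<open>
  The sets \<open>bounded_seqs b k\<close> decrease to a compact set but are not compact themselves, so the usual
  nested intersection argument needs one compact box that contains a point from each of them.
\<close>

lemma bounded_seqs_subset_open:
  assumes U: "open U" "{x. \<forall>i. x i \<le> b i} \<subseteq> U"
  shows "\<exists>k. bounded_seqs b k \<subseteq> U"
proof (rule ccontr)
  assume "\<not> ?thesis"
  then have "\<forall>k. \<exists>x. x \<in> bounded_seqs b k \<and> x \<notin> U" by blast
  then obtain x where x: "\<And>k. x k \<in> bounded_seqs b k" "\<And>k. x k \<notin> U" by metis
  \<comment> \<open>All the \<open>x k\<close> lie in one compact box, since \<open>x k i \<le> b i\<close> as soon as \<open>i < k\<close>.\<close>
  define c where "c i = max (b i) (Max ((\<lambda>k. x k i) ` {..i}))" for i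
  have "x k i \<le> c i" for k i
  proof (cases "k \<le> i")
    case True
    then have "x k i \<le> Max ((\<lambda>k. x k i) ` {..i})" by (intro Max_ge) auto
    then show ?thesis by (simp add: c_def)
  next
    case False
    then show ?thesis using x(1)[of k] by (simp add: bounded_seqs_def c_def max.coboundedI1)
  qed
  then have xc: "x k \<in> {y. \<forall>i. y i \<le> c i}" for k by blast
  have "{y. \<forall>i. y i \<le> c i} \<inter> (\<Inter>k\<in>UNIV. bounded_seqs b k \<inter> - U) \<noteq> {}"
  proof (rule compact_imp_fip_image[OF compact_dominated_seqs])
    show "closed (bounded_seqs b k \<inter> - U)" for k
      using U(1) by (intro closed_Int closed_bounded_seqs) (simp add: closed_Compl)
    fix I' :: "nat set" assume I': "finite I'"
    then obtain m where m: "\<And>k. k \<in> I' \<Longrightarrow> k \<le> m" by (meson finite_nat_set_iff_bounded_le)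
    have "x m \<in> (\<Inter>k\<in>I'. bounded_seqs b k \<inter> - U)"
      using x(1)[of m] x(2)[of m] m by (fastforce simp: bounded_seqs_def)
    then show "{y. \<forall>i. y i \<le> c i} \<inter> (\<Inter>k\<in>I'. bounded_seqs b k \<inter> - U) \<noteq> {}"
      using xc[of m] by blast
  qed
  then obtain y where y: "\<And>k. y \<in> bounded_seqs b k" "y \<notin> U" by blast
  from y(1) have "\<forall>i. y i \<le> b i" unfolding bounded_seqs_def by blast
  with y(2) U(2) show False by blast
qed

text \<open>
  Cells need not be open. The assumption allows each cell to be replaced by an open
  neighbourhood at the price of a constant factor.
\<close>

locale topological_cells = nested_cells cell for cell :: "nat \<Rightarrow> 'a::t2_space \<Rightarrow> 'i::countable" +
  fixes N :: nat
  assumes cell_nhd: "\<exists>U J. open U \<and> {y. cell n y = i} \<subseteq> U \<and> finite J \<and> card J \<le> N \<and> cell n ` U \<subseteq> J"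
begin

text \<open>
  Choquet's capacitability argument. The increasing sets lemma allows to bound one coordinate of the
  Baire space after the other while the content stays above \<open>c\<close>; the image of the resulting compact
  box is the desired set. If it had content zero, a cheap cover by open neighbourhoods
  of cells would already cover the image at a finite stage. The constant lost in passing to open
  neighbourhoods matters only in this last step, where it is harmless.
\<close>

lemma analytic_inner_compact:
  fixes f :: "(nat \<Rightarrow> nat) \<Rightarrow> 'a"
  assumes q: "0 < q" "q < 1" and f: "continuous_on UNIV f" and Z: "closed Z"
    and pos: "content q (range f \<inter> Z) \<noteq> 0"
  shows "\<exists>K. compact K \<and> K \<subseteq> range f \<inter> Z \<and> content q K \<noteq> 0"
proof -
  from pos obtain c where c: "0 < c" "c < content q (range f \<inter> Z)"
    using dense[of 0 "content q (range f \<inter> Z)"] by (auto simp: zero_less_iff_neq_zero)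
  define P where "P b k \<longleftrightarrow> c < content q (f ` bounded_seqs b k \<inter> Z)" for b k
  have P0: "P b 0" for b using c by (simp add: P_def bounded_seqs_def)
  have step: "\<exists>b'. P b' (Suc k) \<and> (\<forall>i<k. b' i = b i)" if "P b k" for b k
  proof (rule ccontr)
    assume "\<not> ?thesis"
    then have le: "content q (f ` bounded_seqs (b(k := n)) (Suc k) \<inter> Z) \<le> c" for n
      by (auto simp: P_def not_less dest!: spec[of _ "b(k := n)"])
    have "bounded_seqs b k = (\<Union>n. bounded_seqs (b(k := n)) (Suc k))"
      by (auto simp: bounded_seqs_def less_Suc_eq)
    then have "f ` bounded_seqs b k \<inter> Z = (\<Union>n. f ` bounded_seqs (b(k := n)) (Suc k) \<inter> Z)" by blast
    also have "content q \<dots> \<le> c"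
    proof (rule content_incseq_le[OF q _ le])
      show "incseq (\<lambda>n. f ` bounded_seqs (b(k := n)) (Suc k) \<inter> Z)"
        by (fastforce simp: incseq_def bounded_seqs_def less_Suc_eq)
    qed
    finally show False using that by (simp add: P_def)
  qed
  have "\<exists>B. \<forall>k. P (B k) k \<and> (\<forall>i<k. B (Suc k) i = B k i)"
    using P0 step by (intro dependent_nat_choice) auto
  then obtain B where B: "\<And>k. P (B k) k" "\<And>k i. i < k \<Longrightarrow> B (Suc k) i = B k i" by blast
  define b where "b i = B (Suc i) i" for i
  have "B k i = b i" if "i < k" for i k
    using that B(2) by (induction k) (auto simp: b_def less_Suc_eq)
  then have "bounded_seqs (B k) k = bounded_seqs b k" for k by (auto simp: bounded_seqs_def)
  with B(1) have b: "c < content q (f ` bounded_seqs b k \<inter> Z)" for k by (simp add: P_def)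
  define C where "C = {x. \<forall>i. x i \<le> b i}"
  have "content q (f ` C \<inter> Z) \<noteq> 0"
  proof
    assume "content q (f ` C \<inter> Z) = 0"
    obtain c' where c': "c = ennreal c'" "0 < c'"
      using c content_finite[of q "range f \<inter> Z"] by (cases c) auto
    have "content q (f ` C \<inter> Z) < ennreal (c' / (N + 1))"
      using \<open>content q (f ` C \<inter> Z) = 0\<close> c' by (simp add: ennreal_lessI)
    then obtain \<V> where V: "covers \<V> (f ` C \<inter> Z)" "emeasure (weight q) \<V> < ennreal (c' / (N + 1))"
      by (rule content_lessE)
    obtain U J where U: "\<And>n i. open (U n i)" "\<And>n i y. cell n y = i \<Longrightarrow> y \<in> U n i"
        "\<And>n i. finite (J n i)" "\<And>n i. card (J n i) \<le> N" "\<And>n i. cell n ` U n i \<subseteq> J n i"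
      using cell_nhd by (simp add: subset_iff) metis
    define W where "W = (\<Union>v\<in>\<V>. U (fst v) (snd v))"
    have "open W" unfolding W_def using U(1) by blast
    have fCW: "f ` C \<inter> Z \<subseteq> W"
    proof
      fix y assume "y \<in> f ` C \<inter> Z"
      then obtain n where n: "(n, cell n y) \<in> \<V>" using V(1) by (auto simp: covers_def)
      have "y \<in> U n (cell n y)" by (rule U(2)) simp
      with n show "y \<in> W" unfolding W_def by force
    qed
    have "open (f -` (W \<union> - Z))"
      using f \<open>open W\<close> Z by (intro open_vimage) (auto simp: closed_def)
    moreover have "C \<subseteq> f -` (W \<union> - Z)" using fCW by blast
    ultimately obtain k where k: "bounded_seqs b k \<subseteq> f -` (W \<union> - Z)"
      using bounded_seqs_subset_open unfolding C_def by metis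
    have "content q (f ` bounded_seqs b k \<inter> Z) \<le> content q W"
      using k by (intro content_mono) auto
    also have "\<dots> \<le> emeasure (weight q) (\<Union>v\<in>\<V>. Pair (fst v) ` J (fst v) (snd v))"
    proof (rule content_le, unfold covers_def, rule ballI)
      fix y assume "y \<in> W"
      then obtain n i where ni: "(n, i) \<in> \<V>" "y \<in> U n i" by (auto simp: W_def)
      then have "cell n y \<in> J n i" using U(5) by blast
      with ni(1) show "\<exists>m. (m, cell m y) \<in> (\<Union>v\<in>\<V>. Pair (fst v) ` J (fst v) (snd v))" by force
    qed
    also have "\<dots> \<le> (\<integral>\<^sup>+v. emeasure (weight q) (Pair (fst v) ` J (fst v) (snd v)) \<partial>count_space \<V>)"
      by (rule emeasure_UN_le_nn_integral) simp
    also have "\<dots> \<le> (\<integral>\<^sup>+v. ennreal (N + 1) * ennreal (q ^ fst v) \<partial>count_space \<V>)"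
    proof (rule nn_integral_mono)
      fix v
      have "emeasure (weight q) (Pair (fst v) ` J (fst v) (snd v))
          = (\<Sum>w\<in>Pair (fst v) ` J (fst v) (snd v). emeasure (weight q) {w})"
        using U(3) by (intro emeasure_eq_sum_singleton) auto
      also have "\<dots> = (\<Sum>w\<in>Pair (fst v) ` J (fst v) (snd v). ennreal (q ^ fst v))"
        by (intro sum.cong refl) (auto simp: weight_singleton)
      also have "\<dots> = of_nat (card (J (fst v) (snd v))) * ennreal (q ^ fst v)"
        by (simp add: card_image inj_on_def)
      also have "\<dots> \<le> ennreal (N + 1) * ennreal (q ^ fst v)"
        using U(4)[of "fst v" "snd v"] unfolding ennreal_of_nat_eq_real_of_nat
        by (intro mult_right_mono ennreal_leI) simp_all
      finally show "emeasure (weight q) (Pair (fst v) ` J (fst v) (snd v)) \<le> ennreal (N + 1) * ennreal (q ^ fst v)" .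
    qed
    also have "\<dots> = ennreal (N + 1) * emeasure (weight q) \<V>"
      by (simp add: nn_integral_cmult nn_integral_count_space_indicator weight_def emeasure_density)
    also have "\<dots> \<le> ennreal (N + 1) * ennreal (c' / (N + 1))"
      by (intro mult_left_mono less_imp_le[OF V(2)]) simp
    also have "\<dots> = c" using c' by (simp add: ennreal_mult[symmetric] del: ennreal_plus)
    finally show False using b[of k] by (simp add: leD)
  qed
  moreover have "compact (f ` C \<inter> Z)"
    using compact_continuous_image[OF continuous_on_subset[OF f subset_UNIV] compact_dominated_seqs[of b]] Z
    by (intro compact_Int_closed) (auto simp: C_def)
  moreover have "f ` C \<inter> Z \<subseteq> range f \<inter> Z" by blast
  ultimately show ?thesis by blast
qed

end

section \<open>A nested partition of the Heisenberg group\<close>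

lemma symp_diff_left: "symp (a - b) c = symp a c - symp b c"
  and symp_diff_right: "symp a (b - c) = symp a b - symp a c"
  and symp_self [simp]: "symp a a = 0"
  and symp_commute: "symp a b = - symp b a"
  by (simp_all add: symp_def algebra_simps)

lemma abs_symp_le: "\<bar>symp a b\<bar> \<le> norm a * norm b"
  using abs_Im_le_cmod[of "a * cnj b"] by (simp add: symp_def norm_mult)

lemma koranyi_dist_power4:
  "koranyi_dist p q ^ 4 = norm (fst p - fst q) ^ 4 + (snd p - snd q + 2 * symp (fst p) (fst q))\<^sup>2"
proof -
  have "koranyi_dist p q ^ 4 = norm (fst p - fst q) ^ 4 + (snd p - snd q - 2 * symp (fst q) (fst p))\<^sup>2"
    unfolding koranyi_dist_def koranyi_norm_def
    by (subst real_root_pow_pos2) (auto simp: hmult_def hinv_def symp_def algebra_simps norm_minus_commute)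
  then show ?thesis by (simp add: symp_commute[of "fst q"])
qed

lemma koranyi_dist_nonneg: "0 \<le> koranyi_dist p q"
  by (simp add: koranyi_dist_def koranyi_norm_nonneg)

lemma norm_fst_diff_le_koranyi: "norm (fst p - fst q) \<le> koranyi_dist p q"
proof (rule power_le_imp_le_base[of _ 3])
  show "norm (fst p - fst q) ^ Suc 3 \<le> koranyi_dist p q ^ Suc 3"
    using koranyi_dist_power4[of p q] by (simp add: eval_nat_numeral)
qed (rule koranyi_dist_nonneg)

lemma vertical_gap_le_koranyi:
  "\<bar>snd p - snd q + 2 * symp (fst p) (fst q)\<bar> \<le> (koranyi_dist p q)\<^sup>2"
proof (rule power2_le_imp_le)
  show "\<bar>snd p - snd q + 2 * symp (fst p) (fst q)\<bar>\<^sup>2 \<le> ((koranyi_dist p q)\<^sup>2)\<^sup>2"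
    using koranyi_dist_power4[of p q] by (simp flip: power_mult)
qed simp

lemma koranyi_dist_le:
  assumes "0 \<le> r" "norm (fst p - fst q) \<le> r" "\<bar>snd p - snd q + 2 * symp (fst p) (fst q)\<bar> \<le> r\<^sup>2"
  shows "koranyi_dist p q \<le> 2 * r"
proof (rule power_le_imp_le_base[of _ 3])
  have "norm (fst p - fst q) ^ 4 \<le> r ^ 4" using assms by (intro power_mono) auto
  moreover have "\<bar>snd p - snd q + 2 * symp (fst p) (fst q)\<bar>\<^sup>2 \<le> (r\<^sup>2)\<^sup>2"
    using assms by (intro power_mono) auto
  ultimately have "koranyi_dist p q ^ 4 \<le> 2 * r ^ 4"
    unfolding koranyi_dist_power4 by (simp flip: power_mult)
  also have "\<dots> \<le> (2 * r) ^ 4" using assms(1) by (simp add: power_mult_distrib)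
  finally show "koranyi_dist p q ^ Suc 3 \<le> (2 * r) ^ Suc 3" by (simp add: eval_nat_numeral)
qed (use assms in simp)

definition dyadic :: "nat \<Rightarrow> complex \<Rightarrow> complex" where
  "dyadic n z = Complex (of_int \<lfloor>2 ^ n * Re z\<rfloor> / 2 ^ n) (of_int \<lfloor>2 ^ n * Im z\<rfloor> / 2 ^ n)"

lemma dyadic_near: "norm (z - dyadic n z) \<le> 2 * (1/2) ^ n"
proof -
  have *: "\<bar>x - of_int \<lfloor>2 ^ n * x\<rfloor> / 2 ^ n\<bar> \<le> (1/2) ^ n" for x :: real
  proof -
    have "x - of_int \<lfloor>2 ^ n * x\<rfloor> / 2 ^ n = (2 ^ n * x - of_int \<lfloor>2 ^ n * x\<rfloor>) * (1/2) ^ n"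
      by (simp add: field_simps)
    also have "\<bar>\<dots>\<bar> \<le> 1 * (1/2) ^ n"
      unfolding abs_mult by (intro mult_mono) (auto; linarith)+
    finally show ?thesis by simp
  qed
  have "norm (z - dyadic n z) \<le> \<bar>Re (z - dyadic n z)\<bar> + \<bar>Im (z - dyadic n z)\<bar>" by (rule cmod_le)
  also have "\<dots> \<le> (1/2) ^ n + (1/2) ^ n" using * by (intro add_mono) (auto simp: dyadic_def)
  finally show ?thesis by simp
qed

lemma dyadic_tendsto: "(\<lambda>n. dyadic n z) \<longlonglongrightarrow> z"
proof (rule Lim_null_comparison[THEN LIM_zero_cancel])
  show "\<forall>\<^sub>F n in sequentially. norm (dyadic n z - z) \<le> 2 * (1/2) ^ n"
    using dyadic_near by (simp add: norm_minus_commute)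
  show "(\<lambda>n. 2 * (1/2) ^ n :: real) \<longlonglongrightarrow> 0"
    by (intro tendsto_mult_right_zero LIMSEQ_power_zero) simp
qed

lemma norm_dyadic_diff_le: "norm (dyadic m z - dyadic n z) \<le> 2 * (1/2) ^ m + 2 * (1/2) ^ n"
  using dyadic_near[of z m] dyadic_near[of z n]
  by (metis dist_norm dist_triangle_le add_mono dist_commute)

text \<open>
  The dyadic approximations of \<open>z\<close> lift to a polygonal path of horizontal steps in the group, and the
  series is its height. Subtracting \<open>shear z\<close> from the vertical coordinate straightens the group on all
  dyadic scales at once: within a dyadic square of level \<open>n\<close> the sheared height differs from the
  group-invariant height difference only by a multiple of \<open>4\<^sup>-\<^sup>n\<close>
  (\<open>shear_difference\<close>). So ordinary intervals in the sheared height give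
  nested cells that are comparable to balls, which boxes in the original coordinates are not.
\<close>

definition shear :: "complex \<Rightarrow> real" where
  "shear z = (\<Sum>k. 2 * symp (dyadic k z) (dyadic (Suc k) z))"

lemma summable_shear: "summable (\<lambda>k. 2 * symp (dyadic k z) (dyadic (Suc k) z))"
proof (rule summable_comparison_test)
  have "norm (2 * symp (dyadic k z) (dyadic (Suc k) z)) \<le> (8 * (norm z + 2)) * (1/2) ^ k" for k
  proof -
    have "symp (dyadic k z) (dyadic (Suc k) z) = symp (dyadic k z) (dyadic (Suc k) z - dyadic k z)"
      by (simp add: symp_diff_right)
    also have "\<bar>\<dots>\<bar> \<le> norm (dyadic k z) * norm (dyadic (Suc k) z - dyadic k z)" by (rule abs_symp_le)
    also have "\<dots> \<le> (norm z + 2) * (4 * (1/2) ^ k)"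
    proof (intro mult_mono)
      have "norm (dyadic k z) \<le> norm z + norm (z - dyadic k z)" by (metis norm_triangle_sub norm_minus_commute)
      also have "norm (z - dyadic k z) \<le> 2"
        using dyadic_near[of z k] power_le_one[of "1/2::real" k] by linarith
      finally show "norm (dyadic k z) \<le> norm z + 2" by simp
      show "norm (dyadic (Suc k) z - dyadic k z) \<le> 4 * (1/2) ^ k"
        using norm_dyadic_diff_le[of "Suc k" z k] by (simp add: field_simps)
    qed auto
    finally show ?thesis unfolding real_norm_def abs_mult by (simp add: algebra_simps)
  qed
  then show "\<exists>N. \<forall>k\<ge>N. norm (2 * symp (dyadic k z) (dyadic (Suc k) z)) \<le> (8 * (norm z + 2)) * (1/2) ^ k"
    by blast
  show "summable (\<lambda>k. (8 * (norm z + 2)) * (1/2) ^ k)" by (intro summable_mult summable_geometric) simp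
qed

text \<open>
  From level \<open>n\<close> on, the series telescopes to \<open>2 * symp (dyadic n z) z\<close> up to the terms
  \<open>symp (dyadic k z - dyadic n z) (dyadic (k + 1) z - dyadic k z)\<close>, which are at most a multiple of \<open>2\<^sup>-\<^sup>n 2\<^sup>-\<^sup>k\<close>.
\<close>

lemma shear_tail:
  "\<bar>shear z - (\<Sum>k<n. 2 * symp (dyadic k z) (dyadic (Suc k) z)) - 2 * symp (dyadic n z) z\<bar> \<le> 64 * (1/4) ^ n"
proof -
  define T where "T m = (\<Sum>k<m. 2 * symp (dyadic k z) (dyadic (Suc k) z))" for m
  have T: "T (n + m) - T n - 2 * symp (dyadic n z) (dyadic (n + m) z)
      = (\<Sum>k<m. 2 * symp (dyadic (n + k) z - dyadic n z) (dyadic (n + Suc k) z - dyadic (n + k) z))" for m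
    by (induction m) (simp_all add: T_def symp_diff_left symp_diff_right)
  have "\<bar>T (n + m) - T n - 2 * symp (dyadic n z) (dyadic (n + m) z)\<bar> \<le> 64 * (1/4) ^ n" for m
  proof -
    have "\<bar>T (n + m) - T n - 2 * symp (dyadic n z) (dyadic (n + m) z)\<bar> \<le> (\<Sum>k<m. 32 * (1/4) ^ n * (1/2) ^ k)"
      unfolding T
    proof (rule order_trans[OF sum_abs], rule sum_mono)
      fix k
      have "\<bar>symp (dyadic (n + k) z - dyadic n z) (dyadic (n + Suc k) z - dyadic (n + k) z)\<bar>
         \<le> norm (dyadic (n + k) z - dyadic n z) * norm (dyadic (n + Suc k) z - dyadic (n + k) z)"
        by (rule abs_symp_le)
      also have "\<dots> \<le> (4 * (1/2) ^ n) * (4 * (1/2) ^ (n + k))"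
      proof (intro mult_mono)
        show "norm (dyadic (n + k) z - dyadic n z) \<le> 4 * (1/2) ^ n"
          using norm_dyadic_diff_le[of "n + k" z n] power_decreasing[of n "n + k" "1/2::real"] by linarith
        show "norm (dyadic (n + Suc k) z - dyadic (n + k) z) \<le> 4 * (1/2) ^ (n + k)"
        proof -
          have "(0::real) \<le> (1/2) ^ (n + k)" by simp
          then show ?thesis
            using norm_dyadic_diff_le[of "n + Suc k" z "n + k"] unfolding add_Suc_right power_Suc by linarith
        qed
      qed auto
      also have "\<dots> = 16 * (1/4) ^ n * (1/2) ^ k"
        by (simp add: power_add power_mult_distrib[symmetric])
      finally show "\<bar>2 * symp (dyadic (n + k) z - dyadic n z) (dyadic (n + Suc k) z - dyadic (n + k) z)\<bar>
         \<le> 32 * (1/4) ^ n * (1/2) ^ k" by simp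
    qed
    also have "\<dots> = 32 * (1/4) ^ n * (\<Sum>k<m. (1/2) ^ k)" by (simp add: sum_distrib_left)
    also have "\<dots> \<le> 32 * (1/4) ^ n * 2"
      by (intro mult_left_mono) (simp_all add: geometric_sum)
    finally show ?thesis by simp
  qed
  moreover have "(\<lambda>m. \<bar>T (n + m) - T n - 2 * symp (dyadic n z) (dyadic (n + m) z)\<bar>)
      \<longlonglongrightarrow> \<bar>shear z - T n - 2 * symp (dyadic n z) z\<bar>"
  proof -
    have "T \<longlonglongrightarrow> shear z"
      unfolding T_def shear_def by (rule summable_LIMSEQ[OF summable_shear])
    then have T1: "(\<lambda>m. T (n + m)) \<longlonglongrightarrow> shear z" by (subst add.commute) (rule LIMSEQ_ignore_initial_segment)
    have "(\<lambda>m. dyadic (n + m) z) \<longlonglongrightarrow> z"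
      by (subst add.commute) (rule LIMSEQ_ignore_initial_segment[OF dyadic_tendsto])
    then have "(\<lambda>m. symp (dyadic n z) (dyadic (n + m) z)) \<longlonglongrightarrow> symp (dyadic n z) z"
      unfolding symp_def by (intro tendsto_intros)
    with T1 show ?thesis by (intro tendsto_intros)
  qed
  ultimately show ?thesis unfolding T_def[symmetric] by (intro tendsto_upperbound) auto
qed

lemma dyadic_eq_mono:
  assumes "dyadic n z = dyadic n w" "m \<le> n" shows "dyadic m z = dyadic m w"
proof -
  have fl: "\<lfloor>2 ^ m * x\<rfloor> = \<lfloor>2 ^ n * x\<rfloor> div 2 ^ (n - m)" for x :: real
  proof -
    have "(2::real) ^ n = 2 ^ m * 2 ^ (n - m)" using assms(2) by (simp flip: power_add)
    then have "2 ^ m * x = 2 ^ n * x / real_of_int (2 ^ (n - m))" by simp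
    then show ?thesis
      using floor_divide_real_eq_div[of "2 ^ (n - m)" "2 ^ n * x"] by (metis zero_le_numeral zero_le_power)
  qed
  show ?thesis
    using assms(1) unfolding dyadic_def fl by simp
qed

text \<open>
  The first \<open>n\<close> terms of the two series agree, and the remaining linear parts \<open>symp c z\<close> and \<open>symp c w\<close>, with \<open>c\<close> the
  common corner of the square, combine with \<open>symp z w\<close> into \<open>symp (z - c) (w - c)\<close>.
\<close>

lemma shear_difference:
  assumes same: "dyadic n z = dyadic n w"
  shows "\<bar>shear z - shear w + 2 * symp z w\<bar> \<le> 144 * (1/4) ^ n"
proof -
  define c where "c = dyadic n z"
  define S where "S = (\<Sum>k<n. 2 * symp (dyadic k z) (dyadic (Suc k) z))"
  have S': "(\<Sum>k<n. 2 * symp (dyadic k w) (dyadic (Suc k) w)) = S"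
    unfolding S_def using dyadic_eq_mono[OF same] by (intro sum.cong refl) auto
  have z: "\<bar>shear z - S - 2 * symp c z\<bar> \<le> 64 * (1/4) ^ n"
    using shear_tail[of z n] by (simp only: S_def c_def)
  have w: "\<bar>shear w - S - 2 * symp c w\<bar> \<le> 64 * (1/4) ^ n"
    using shear_tail[of w n] S' same by (simp only: c_def)
  have "\<bar>symp (z - c) (w - c)\<bar> \<le> norm (z - c) * norm (w - c)" by (rule abs_symp_le)
  also have "\<dots> \<le> (2 * (1/2) ^ n) * (2 * (1/2) ^ n)"
    using dyadic_near[of z n] dyadic_near[of w n] same by (intro mult_mono) (simp_all add: c_def)
  also have "\<dots> = 4 * (1/4) ^ n" by (simp add: power_mult_distrib[symmetric])
  finally have "\<bar>symp (z - c) (w - c)\<bar> \<le> 4 * (1/4) ^ n" .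
  moreover have "symp (z - c) (w - c) = symp z w + symp c z - symp c w"
    using symp_commute[of z c] by (simp add: symp_diff_left symp_diff_right)
  ultimately show ?thesis using z w unfolding abs_le_iff by linarith
qed

fun hcell :: "nat \<Rightarrow> heis \<Rightarrow> int \<times> int \<times> int" where
  "hcell 0 p = (0, 0, 0)"
| "hcell (Suc n) p = (\<lfloor>2 ^ n * Re (fst p)\<rfloor>, \<lfloor>2 ^ n * Im (fst p)\<rfloor>, \<lfloor>4 ^ n * (snd p - shear (fst p))\<rfloor>)"

lemma hcell_dyadic: "hcell (Suc n) p = hcell (Suc n) q \<Longrightarrow> dyadic n (fst p) = dyadic n (fst q)"
  by (simp add: dyadic_def)

lemma hcell_refine:
  assumes "hcell (Suc n) p = hcell (Suc n) q" shows "hcell n p = hcell n q"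
proof (cases n)
  case (Suc m)
  have fl: "\<lfloor>b ^ m * x\<rfloor> = \<lfloor>b ^ n * x\<rfloor> div c" if "b = real_of_int c" "c > 0" for b x :: real and c
  proof -
    have "b ^ m * x = b ^ n * x / real_of_int c" using that Suc by (simp add: field_simps)
    then show ?thesis using that by (simp only: floor_divide_real_eq_div less_imp_le)
  qed
  have fl2: "\<lfloor>2 ^ m * x\<rfloor> = \<lfloor>2 ^ n * x\<rfloor> div 2" "\<lfloor>4 ^ m * x\<rfloor> = \<lfloor>4 ^ n * x\<rfloor> div 4" for x :: real
    by (rule fl; simp)+
  have "hcell n r = (\<lfloor>2 ^ n * Re (fst r)\<rfloor> div 2, \<lfloor>2 ^ n * Im (fst r)\<rfloor> div 2,
      \<lfloor>4 ^ n * (snd r - shear (fst r))\<rfloor> div 4)" for r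
    unfolding fl2[symmetric] using Suc by simp
  with assms show ?thesis by simp
qed simp

lemma hcell_gap:
  assumes "dyadic n (fst p) = dyadic n (fst q)"
  shows "\<bar>(snd p - snd q + 2 * symp (fst p) (fst q))
      - ((snd p - shear (fst p)) - (snd q - shear (fst q)))\<bar> \<le> 144 * (1/4) ^ n"
  using shear_difference[OF assms] by (simp add: algebra_simps)

lemma hcell_diam:
  assumes "hcell (Suc n) p = hcell (Suc n) q" shows "koranyi_dist p q \<le> 26 * (1/2) ^ n"
proof -
  let ?a = "snd p - shear (fst p)" and ?b = "snd q - shear (fst q)"
  have same: "dyadic n (fst p) = dyadic n (fst q)" using assms by (rule hcell_dyadic)
  have "\<lfloor>4 ^ n * ?a\<rfloor> = \<lfloor>4 ^ n * ?b\<rfloor>" using assms by simp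
  then have "\<bar>4 ^ n * ?a - 4 ^ n * ?b\<bar> \<le> 1" by linarith
  moreover have "4 ^ n * ?a - 4 ^ n * ?b = 4 ^ n * (?a - ?b)" by (simp add: algebra_simps)
  ultimately have "\<bar>?a - ?b\<bar> * 4 ^ n \<le> 1" by (simp only: abs_mult) (simp add: mult.commute)
  then have "\<bar>?a - ?b\<bar> \<le> (1/4) ^ n" by (simp add: field_simps power_divide)
  then have 1: "\<bar>snd p - snd q + 2 * symp (fst p) (fst q)\<bar> \<le> 145 * (1/4) ^ n"
    using hcell_gap[OF same] by linarith
  have 2: "norm (fst p - fst q) \<le> 4 * (1/2) ^ n"
    using norm_triangle_le_diff dyadic_near[of "fst p" n] dyadic_near[of "fst q" n] same
      norm_triangle_ineq4[of "fst p - dyadic n (fst p)" "fst q - dyadic n (fst q)"] by simp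
  have "koranyi_dist p q \<le> 2 * (13 * (1/2) ^ n)"
  proof (rule koranyi_dist_le)
    have "(13 * (1/2) ^ n)\<^sup>2 = 169 * (1/4::real) ^ n"
      by (simp add: power_mult_distrib power2_eq_square power_mult_distrib[symmetric])
    then show "\<bar>snd p - snd q + 2 * symp (fst p) (fst q)\<bar> \<le> (13 * (1/2) ^ n)\<^sup>2" using 1 by simp
    have "(0::real) \<le> (1/2) ^ n" by simp
    then show "norm (fst p - fst q) \<le> 13 * (1/2) ^ n" using 2 by linarith
  qed simp
  then show ?thesis by simp
qed

lemma finite_card_int_spread:
  fixes A :: "int set"
  assumes "\<And>x y. x \<in> A \<Longrightarrow> y \<in> A \<Longrightarrow> \<bar>x - y\<bar> \<le> int m"
  shows "finite A \<and> card A \<le> 2 * m + 1"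
proof (cases "A = {}")
  case False
  then obtain a where "a \<in> A" by blast
  then have "A \<subseteq> {a - int m..a + int m}" using assms[of _ a] by (fastforce simp: abs_le_iff)
  then show ?thesis
    using card_mono[of "{a - int m..a + int m}" A] finite_subset[of A "{a - int m..a + int m}"] by auto
qed simp

text \<open>
  Bounded overlap: a set whose diameter is comparable to the size of the cells meets a bounded number of them.
  It meets boundedly many dyadic squares, and above each square its sheared heights spread over a bounded multiple
  of \<open>4\<^sup>-\<^sup>n\<close>.
\<close>

lemma hcell_overlap:
  fixes R :: nat
  assumes D: "\<And>p q. p \<in> D \<Longrightarrow> q \<in> D \<Longrightarrow> koranyi_dist p q \<le> R * (1/2) ^ n"
  shows "finite (hcell (Suc n) ` D) \<and> card (hcell (Suc n) ` D) \<le> (2 * R + 3)\<^sup>2 * (2 * R\<^sup>2 + 293)"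
proof -
  define X where "X = (\<lambda>p. \<lfloor>2 ^ n * Re (fst p)\<rfloor>) ` D"
  define Y where "Y = (\<lambda>p. \<lfloor>2 ^ n * Im (fst p)\<rfloor>) ` D"
  define T where "T x y = (\<lambda>p. \<lfloor>4 ^ n * (snd p - shear (fst p))\<rfloor>) `
      {p \<in> D. \<lfloor>2 ^ n * Re (fst p)\<rfloor> = x \<and> \<lfloor>2 ^ n * Im (fst p)\<rfloor> = y}" for x y
  have fl: "\<bar>\<lfloor>a\<rfloor> - \<lfloor>b\<rfloor>\<bar> \<le> int (m + 1)" if "\<bar>a - b\<bar> \<le> real m" for a b :: real and m
    using that by linarith
  have *: "\<bar>2 ^ n * a - 2 ^ n * b\<bar> \<le> real R" if "\<bar>a - b\<bar> \<le> real R * (1/2) ^ n" for a b :: real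
  proof -
    have "2 ^ n * a - 2 ^ n * b = 2 ^ n * (a - b)" by (simp add: algebra_simps)
    then show ?thesis using mult_left_mono[OF that, of "2 ^ n"] by (simp add: abs_mult power_divide)
  qed
  have nd: "norm (fst p - fst q) \<le> R * (1/2) ^ n" if "p \<in> D" "q \<in> D" for p q
    using norm_fst_diff_le_koranyi D[OF that] by (rule order_trans)
  have X: "finite X \<and> card X \<le> 2 * (R + 1) + 1"
    unfolding X_def
  proof (intro finite_card_int_spread, elim imageE, simp only:)
    fix p q assume "p \<in> D" "q \<in> D"
    then have "\<bar>Re (fst p) - Re (fst q)\<bar> \<le> R * (1/2) ^ n"
      using nd[of p q] abs_Re_le_cmod[of "fst p - fst q"] by simp
    then show "\<bar>\<lfloor>2 ^ n * Re (fst p)\<rfloor> - \<lfloor>2 ^ n * Re (fst q)\<rfloor>\<bar> \<le> int (R + 1)" by (intro fl *)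
  qed
  have Y: "finite Y \<and> card Y \<le> 2 * (R + 1) + 1"
    unfolding Y_def
  proof (intro finite_card_int_spread, elim imageE, simp only:)
    fix p q assume "p \<in> D" "q \<in> D"
    then have "\<bar>Im (fst p) - Im (fst q)\<bar> \<le> R * (1/2) ^ n"
      using nd[of p q] abs_Im_le_cmod[of "fst p - fst q"] by simp
    then show "\<bar>\<lfloor>2 ^ n * Im (fst p)\<rfloor> - \<lfloor>2 ^ n * Im (fst q)\<rfloor>\<bar> \<le> int (R + 1)" by (intro fl *)
  qed
  have T: "finite (T x y) \<and> card (T x y) \<le> 2 * (R\<^sup>2 + 144 + 1) + 1" for x y
    unfolding T_def
  proof (intro finite_card_int_spread, elim imageE, simp only: mem_Collect_eq, elim conjE)
    fix p q assume p: "p \<in> D" "\<lfloor>2 ^ n * Re (fst p)\<rfloor> = x" "\<lfloor>2 ^ n * Im (fst p)\<rfloor> = y"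
      and q: "q \<in> D" "\<lfloor>2 ^ n * Re (fst q)\<rfloor> = x" "\<lfloor>2 ^ n * Im (fst q)\<rfloor> = y"
    define a where "a = snd p - shear (fst p)"
    define b where "b = snd q - shear (fst q)"
    have "dyadic n (fst p) = dyadic n (fst q)" using p q by (simp add: dyadic_def)
    note gap = hcell_gap[OF this, folded a_def b_def]
    have "\<bar>snd p - snd q + 2 * symp (fst p) (fst q)\<bar> \<le> (koranyi_dist p q)\<^sup>2"
      by (rule vertical_gap_le_koranyi)
    also have "\<dots> \<le> (R * (1/2) ^ n)\<^sup>2" using D p(1) q(1) koranyi_dist_nonneg by (intro power_mono)
    also have "\<dots> = R\<^sup>2 * (1/4) ^ n" by (simp add: power_mult_distrib power2_eq_square flip: power_mult_distrib)
    finally have "\<bar>a - b\<bar> \<le> (real R)\<^sup>2 * (1/4) ^ n + 144 * (1/4) ^ n"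
      using gap unfolding of_nat_power by linarith
    then have "\<bar>a - b\<bar> \<le> real (R\<^sup>2 + 144) * (1/4) ^ n" by (simp add: algebra_simps)
    moreover have "4 ^ n * a - 4 ^ n * b = 4 ^ n * (a - b)" by (simp add: algebra_simps)
    ultimately have "\<bar>4 ^ n * a - 4 ^ n * b\<bar> \<le> real (R\<^sup>2 + 144)"
      using mult_left_mono[of "\<bar>a - b\<bar>" "real (R\<^sup>2 + 144) * (1/4) ^ n" "4 ^ n"]
      by (simp add: abs_mult power_divide)
    from fl[OF this] show "\<bar>\<lfloor>4 ^ n * (snd p - shear (fst p))\<rfloor> - \<lfloor>4 ^ n * (snd q - shear (fst q))\<rfloor>\<bar> \<le> int (R\<^sup>2 + 144 + 1)"
      by (simp only: a_def b_def)
  qed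
  have sub: "hcell (Suc n) ` D \<subseteq> (SIGMA x:X. SIGMA y:Y. T x y)"
    by (auto simp: X_def Y_def T_def)
  have fin: "finite (SIGMA x:X. SIGMA y:Y. T x y)" using X Y T by auto
  have "card (hcell (Suc n) ` D) \<le> card (SIGMA x:X. SIGMA y:Y. T x y)" using sub fin by (rule card_mono[rotated])
  also have "\<dots> = (\<Sum>x\<in>X. \<Sum>y\<in>Y. card (T x y))"
    using X Y T by (subst card_SigmaI; simp)+
  also have "\<dots> \<le> (\<Sum>x\<in>X. \<Sum>y\<in>Y. 2 * (R\<^sup>2 + 144 + 1) + 1)" using T by (intro sum_mono) blast
  also have "\<dots> = card X * (card Y * (2 * (R\<^sup>2 + 144 + 1) + 1))" by simp
  also have "\<dots> \<le> (2 * (R + 1) + 1) * ((2 * (R + 1) + 1) * (2 * (R\<^sup>2 + 144 + 1) + 1))"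
    using X Y by (intro mult_mono) auto
  also have "\<dots> = (2 * R + 3)\<^sup>2 * (2 * R\<^sup>2 + 291)" by (simp add: power2_eq_square algebra_simps)
  also have "\<dots> \<le> (2 * R + 3)\<^sup>2 * (2 * R\<^sup>2 + 293)" by simp
  finally show ?thesis using sub fin finite_subset by blast
qed

lemma open_koranyi_ball: "open {q. koranyi_dist q p < r}"
proof -
  have "openin koranyi.mtopology (koranyi.mball p r)" by (rule koranyi.openin_mball)
  moreover have "koranyi.mball p r = {q. koranyi_dist q p < r}" by (auto simp: koranyi.commute)
  ultimately show ?thesis unfolding koranyi_mtopology by simp
qed

text \<open>
  The bound of \<open>hcell_overlap\<close> for \<open>R = 28\<close>: the \<open>2\<^sup>-\<^sup>n\<close>-neighbourhood of a cell of diameter at most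
  \<open>26 * 2\<^sup>-\<^sup>n\<close> has diameter at most \<open>28 * 2\<^sup>-\<^sup>n\<close>.
\<close>

definition overlap :: nat where "overlap = (2 * 28 + 3)\<^sup>2 * (2 * 28\<^sup>2 + 293)"

interpretation hcells: topological_cells hcell overlap
proof
  fix p q :: heis and n
  show "hcell 0 p = hcell 0 q" by simp
  show "hcell (Suc n) p = hcell (Suc n) q \<Longrightarrow> hcell n p = hcell n q" by (rule hcell_refine)
next
  fix n :: nat and i :: "int \<times> int \<times> int"
  show "\<exists>U J. open U \<and> {y. hcell n y = i} \<subseteq> U \<and> finite J \<and> card J \<le> overlap \<and> hcell n ` U \<subseteq> J"
  proof (cases n)
    case 0
    show ?thesis
      by (rule exI[of _ UNIV], rule exI[of _ "{(0, 0, 0)}"]) (auto simp: 0 overlap_def)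
  next
    case (Suc m)
    define U where "U = (\<Union>y\<in>{y. hcell n y = i}. {q. koranyi_dist q y < (1/2) ^ m})"
    have "koranyi_dist p q \<le> real 28 * (1/2) ^ m" if pq: "p \<in> U" "q \<in> U" for p q
    proof -
      from pq(1) obtain y where y1: "hcell n y = i" "koranyi_dist p y < (1/2) ^ m" unfolding U_def by blast
      from pq(2) obtain z where z1: "hcell n z = i" "koranyi_dist q z < (1/2) ^ m" unfolding U_def by blast
      have y: "hcell (Suc m) y = hcell (Suc m) z" "koranyi_dist p y < (1/2) ^ m" "koranyi_dist q z < (1/2) ^ m"
        using y1 z1 unfolding Suc by (simp_all only:)
      have "koranyi_dist p q \<le> koranyi_dist p y + (koranyi_dist y z + koranyi_dist z q)"
        using koranyi.triangle[of p y q] koranyi.triangle[of y z q] by simp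
      also have "koranyi_dist z q = koranyi_dist q z" by (rule koranyi.commute)
      finally show ?thesis using y(2,3) hcell_diam[OF y(1)] by simp
    qed
    from hcell_overlap[OF this]
    have "finite (hcell n ` U)" "card (hcell n ` U) \<le> overlap" unfolding Suc overlap_def by auto
    moreover have "open U" unfolding U_def by (intro open_UN ballI open_koranyi_ball)
    moreover have "{y. hcell n y = i} \<subseteq> U"
    proof
      fix y assume "y \<in> {y. hcell n y = i}"
      moreover have "koranyi_dist y y < (1/2) ^ m" by simp
      ultimately show "y \<in> U" unfolding U_def by blast
    qed
    ultimately show ?thesis by blast
  qed
qed

section \<open>Integrating the projected distance over the angle\<close>

lemma sin_ge_third:
  assumes "0 \<le> x" "x \<le> pi / 2" shows "x / 3 \<le> sin (x::real)"
proof (cases "x \<le> pi / 3")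
  case True
  have "sin 0 - 0 / 3 \<le> sin x - x / 3"
  proof (rule DERIV_nonneg_imp_nondecreasing[OF assms(1)])
    fix y assume y: "0 \<le> y" "y \<le> x"
    then have "cos (pi / 3) \<le> cos y" using True by (intro cos_monotone_0_pi_le) auto
    then show "\<exists>d. ((\<lambda>x. sin x - x / 3) has_real_derivative d) (at y) \<and> 0 \<le> d"
      by (intro exI[of _ "cos y - 1 / 3"] conjI) (auto intro!: derivative_eq_intros simp: cos_60)
  qed
  then show ?thesis by simp
next
  case False
  then have "sin (pi / 3) \<le> sin x" using assms by (intro sin_monotone_2pi_le) auto
  moreover have "(17 / 10 :: real) \<le> sqrt 3" by (rule real_le_rsqrt) (simp add: power2_eq_square)
  ultimately show ?thesis using assms pi_less_4 by (simp add: sin_60)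
qed

lemma abs_sin_ge_third:
  assumes "\<bar>u\<bar> < pi"
  shows "min \<bar>u\<bar> (pi - \<bar>u\<bar>) / 3 \<le> \<bar>sin (u::real)\<bar>"
proof -
  have "\<bar>sin u\<bar> = sin \<bar>u\<bar>" using sin_ge_zero[of "\<bar>u\<bar>"] assms by (auto simp: abs_if)
  moreover have "min \<bar>u\<bar> (pi - \<bar>u\<bar>) / 3 \<le> sin \<bar>u\<bar>"
  proof (cases "\<bar>u\<bar> \<le> pi / 2")
    case True then show ?thesis using sin_ge_third[of "\<bar>u\<bar>"] by linarith
  next
    case False then show ?thesis using sin_ge_third[of "pi - \<bar>u\<bar>"] assms by simp
  qed
  ultimately show ?thesis by simp
qed

lemma nn_integral_abs_powr:
  fixes g L b :: real
  assumes g: "g < 1" and L: "0 \<le> L"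
  shows "(\<integral>\<^sup>+x. ennreal (\<bar>x - b\<bar> powr (-g)) * indicator {b - L..b + L} x \<partial>lborel) \<le> ennreal (2 * (L powr (1 - g) / (1 - g)))"
proof -
  define I where "I = L powr (1 - g) / (1 - g)"
  have base: "(\<integral>\<^sup>+x. ennreal (x powr (-g)) * indicator {0..L} x \<partial>lborel) = ennreal I"
    using has_integral_powr_from_0[of "-g" L] g L
    by (intro nn_integral_has_integral_lebesgue') (auto simp: I_def algebra_simps)
  have half: "(\<integral>\<^sup>+x. ennreal ((s * (x - b)) powr (-g)) * indicator {0..L} (s * (x - b)) \<partial>lborel) = ennreal I"
    if s: "\<bar>s\<bar> = 1" for s :: real
  proof -
    from s have "s = 1 \<or> s = -1" by (auto simp: abs_if split: if_splits)
    then show ?thesis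
      using base by (elim disjE) (subst nn_integral_real_affine[where c=s and t=b]; simp)+
  qed
  have "(\<integral>\<^sup>+x. ennreal (\<bar>x - b\<bar> powr (-g)) * indicator {b - L..b + L} x \<partial>lborel)
     \<le> (\<integral>\<^sup>+x. ennreal ((1 * (x - b)) powr (-g)) * indicator {0..L} (1 * (x - b))
          + ennreal ((-1 * (x - b)) powr (-g)) * indicator {0..L} (-1 * (x - b)) \<partial>lborel)"
    by (intro nn_integral_mono) (auto simp: indicator_def abs_if)
  also have "\<dots> = ennreal I + ennreal I"
  proof -
    have "(\<lambda>x. ennreal ((s * (x - b)) powr (-g)) * indicator {0..L} (s * (x - b))) \<in> borel_measurable lborel" for s :: real
      by (intro borel_measurable_times_ennreal borel_measurable_indicator' measurable_compose[OF _ measurable_ennreal]) measurable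
    then show ?thesis by (subst nn_integral_add) (simp_all only: half[of 1] half[of "-1"] abs_one abs_minus_cancel)
  qed
  finally show ?thesis using g by (simp add: I_def flip: ennreal_plus)
qed

text \<open>
  Up to the factor \<open>3\<close>, the sine is bounded below by the distance to the nearest of its zeros \<open>a\<close>,
  \<open>a - pi\<close>, \<open>a + pi\<close>, once \<open>a\<close> is shifted into the interval from \<open>0\<close> to \<open>pi\<close>.
\<close>

lemma nn_integral_sin_powr:
  fixes g :: real
  assumes g: "0 < g" "g < 1"
  shows "\<exists>C\<ge>0. \<forall>a. (\<integral>\<^sup>+\<theta>. ennreal (\<bar>sin (\<theta> - a)\<bar> powr (-g)) * indicator {0..<pi} \<theta> \<partial>lborel) \<le> ennreal C"
proof (intro exI[of _ "3 * (3 powr g * (2 * ((2 * pi) powr (1 - g) / (1 - g))))"] conjI allI)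
  fix a0 :: real
  define K where "K = 2 * ((2 * pi) powr (1 - g) / (1 - g))"
  have K: "0 \<le> K" using g by (simp add: K_def)
  define a where "a = a0 - of_int \<lfloor>a0 / pi\<rfloor> * pi"
  have a: "0 \<le> a" "a < pi"
  proof -
    have "of_int \<lfloor>a0 / pi\<rfloor> \<le> a0 / pi" "a0 / pi < of_int \<lfloor>a0 / pi\<rfloor> + 1" by linarith+
    then show "0 \<le> a" "a < pi"
      using pi_gt_zero by (simp_all only: a_def pos_le_divide_eq pos_divide_less_eq) (simp_all add: algebra_simps)
  qed
  have per: "\<bar>sin (\<theta> - a0)\<bar> = \<bar>sin (\<theta> - a)\<bar>" for \<theta>
  proof -
    have e: "\<theta> - a0 = (\<theta> - a) - of_int \<lfloor>a0 / pi\<rfloor> * pi" by (simp add: a_def)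
    have "sin (of_int \<lfloor>a0 / pi\<rfloor> * pi) = 0" unfolding sin_zero_iff_int2 by blast
    moreover from this have "\<bar>cos (of_int \<lfloor>a0 / pi\<rfloor> * pi)\<bar> = 1"
      using sin_cos_squared_add[of "of_int \<lfloor>a0 / pi\<rfloor> * pi"] by (simp add: abs_square_eq_1)
    ultimately show ?thesis unfolding e sin_diff by (simp add: abs_mult)
  qed
  have bound: "ennreal (\<bar>sin (\<theta> - a0)\<bar> powr (-g)) * indicator {0..<pi} \<theta>
      \<le> (\<Sum>b\<in>{a, a - pi, a + pi}. ennreal (3 powr g) * (ennreal (\<bar>\<theta> - b\<bar> powr (-g)) * indicator {b - 2 * pi..b + 2 * pi} \<theta>))"
    (is "_ \<le> ?R") for \<theta>
  proof (cases "\<theta> \<in> {0..<pi} \<and> sin (\<theta> - a) \<noteq> 0")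
    case True
    define u where "u = \<theta> - a"
    have u: "\<bar>u\<bar> < pi" "sin u \<noteq> 0" using True a by (auto simp: u_def)
    have "\<exists>b\<in>{a, a - pi, a + pi}. \<bar>\<theta> - b\<bar> = min \<bar>u\<bar> (pi - \<bar>u\<bar>)"
      using u(1) by (auto simp: u_def min_def abs_if)
    then obtain b where b: "b \<in> {a, a - pi, a + pi}" "\<bar>\<theta> - b\<bar> = min \<bar>u\<bar> (pi - \<bar>u\<bar>)" by blast
    have pos: "0 < \<bar>\<theta> - b\<bar>" using u b(2) by (auto simp: min_def)
    have "\<bar>sin u\<bar> powr (-g) \<le> (\<bar>\<theta> - b\<bar> / 3) powr (-g)"
      using abs_sin_ge_third[OF u(1)] pos g unfolding b(2)[symmetric] by (intro powr_mono2') auto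
    also have "\<dots> = 3 powr g * \<bar>\<theta> - b\<bar> powr (-g)" by (simp add: powr_divide powr_minus field_simps)
    finally have 1: "\<bar>sin u\<bar> powr (-g) \<le> 3 powr g * \<bar>\<theta> - b\<bar> powr (-g)" .
    have "\<theta> \<in> {b - 2 * pi..b + 2 * pi}" using b(2) u(1) by auto
    then have "ennreal (\<bar>sin (\<theta> - a0)\<bar> powr (-g)) * indicator {0..<pi} \<theta>
      \<le> ennreal (3 powr g) * (ennreal (\<bar>\<theta> - b\<bar> powr (-g)) * indicator {b - 2 * pi..b + 2 * pi} \<theta>)"
      using 1 True by (simp add: per u_def ennreal_mult[symmetric])
    also have "\<dots> \<le> ?R" using b(1) by (intro member_le_sum) auto
    finally show ?thesis .
  qed (auto simp: per indicator_def)
  have "(\<integral>\<^sup>+\<theta>. ennreal (\<bar>sin (\<theta> - a0)\<bar> powr (-g)) * indicator {0..<pi} \<theta> \<partial>lborel)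
      \<le> (\<Sum>b\<in>{a, a - pi, a + pi}. \<integral>\<^sup>+\<theta>. ennreal (3 powr g) * (ennreal (\<bar>\<theta> - b\<bar> powr (-g)) * indicator {b - 2 * pi..b + 2 * pi} \<theta>) \<partial>lborel)"
    by (subst nn_integral_sum[symmetric]) (measurable, intro nn_integral_mono bound)
  also have "\<dots> \<le> (\<Sum>b\<in>{a, a - pi, a + pi}. ennreal (3 powr g) * ennreal K)"
    unfolding K_def using g
    by (intro sum_mono) (subst nn_integral_cmult, measurable, intro mult_left_mono nn_integral_abs_powr, auto)
  also have "\<dots> = ennreal (3 * (3 powr g * K))"
  proof -
    have "(\<Sum>b\<in>{a, a - pi, a + pi}. ennreal (3 powr g) * ennreal K) = ennreal (\<Sum>b\<in>{a, a - pi, a + pi}. 3 powr g * K)"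
      using K by (subst sum_ennreal[symmetric]) (simp_all add: ennreal_mult)
    then show ?thesis by simp
  qed
  finally show "(\<integral>\<^sup>+\<theta>. ennreal (\<bar>sin (\<theta> - a0)\<bar> powr (-g)) * indicator {0..<pi} \<theta> \<partial>lborel)
      \<le> ennreal (3 * (3 powr g * (2 * ((2 * pi) powr (1 - g) / (1 - g)))))" by (simp only: K_def)
qed (use g in simp)

text \<open>
  For a level \<open>k = |w| sin y\<close> this is the identity \<open>sin y - sin x = 2 sin ((y - x) / 2) cos ((y + x) / 2)\<close>;
  levels beyond the amplitude are moved to the nearest attained value. The second
  bound says that where the derivative of the sinusoid is large, one of the two factors is large.
\<close>

lemma sine_level_factorization:
  fixes w :: complex and k :: real
  shows "\<exists>a b. \<forall>\<theta>. 2 * norm w * (\<bar>sin (\<theta> - a)\<bar> * \<bar>sin (\<theta> - b)\<bar>) \<le> \<bar>k - Im (w * cis (-2 * \<theta>))\<bar> \<and>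
      \<bar>Re (w * cis (-2 * \<theta>))\<bar> \<le> norm w * (\<bar>sin (\<theta> - a)\<bar> + \<bar>sin (\<theta> - b)\<bar>)"
proof -
  define \<psi> where "\<psi> = Arg w"
  define B where "B = norm w"
  have w: "w = of_real B * cis \<psi>" unfolding B_def \<psi>_def by (metis rcis_cmod_Arg rcis_def)
  have B: "0 \<le> B" by (simp add: B_def)
  define y where "y = (if B = 0 then 0 else arcsin (max (-1) (min 1 (k / B))))"
  have y: "B * sin y = max (-B) (min B k)"
    using B by (auto simp: y_def min_def max_def field_simps)
  define a where "a = (\<psi> - y) / 2"
  define b where "b = (\<psi> + y) / 2 - pi / 2"
  have "2 * norm w * (\<bar>sin (\<theta> - a)\<bar> * \<bar>sin (\<theta> - b)\<bar>) \<le> \<bar>k - Im (w * cis (-2 * \<theta>))\<bar> \<and>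
      \<bar>Re (w * cis (-2 * \<theta>))\<bar> \<le> norm w * (\<bar>sin (\<theta> - a)\<bar> + \<bar>sin (\<theta> - b)\<bar>)" for \<theta>
  proof -
    define x where "x = \<psi> - 2 * \<theta>"
    have wx: "w * cis (-2 * \<theta>) = of_real B * cis x"
      by (simp add: w x_def cis_mult mult.assoc)
    have sa: "sin (\<theta> - a) = sin ((y - x) / 2)" by (simp add: a_def x_def algebra_simps diff_divide_distrib add_divide_distrib)
    have "\<theta> - b = pi / 2 - (y + x) / 2" by (simp add: b_def x_def field_simps)
    then have sb: "sin (\<theta> - b) = cos ((y + x) / 2)" by (simp add: sin_cos_eq)
    have "\<bar>B * sin y - B * sin x\<bar> \<le> \<bar>k - B * sin x\<bar>"
    proof -
      have "\<bar>B * sin x\<bar> \<le> B" using B abs_sin_le_one[of x] by (simp add: abs_mult mult_left_le)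
      then show ?thesis unfolding y by (auto simp: min_def max_def abs_if split: if_splits)
    qed
    moreover have "sin y - sin x = 2 * sin ((y - x) / 2) * cos ((y + x) / 2)" by (rule sin_diff_sin)
    then have "\<bar>B * sin y - B * sin x\<bar> = 2 * B * (\<bar>sin (\<theta> - a)\<bar> * \<bar>sin (\<theta> - b)\<bar>)"
      using B unfolding sa sb right_diff_distrib[symmetric] by (simp add: abs_mult mult_ac)
    moreover have "cos x = cos ((y + x) / 2) * cos ((y - x) / 2) + sin ((y + x) / 2) * sin ((y - x) / 2)"
      unfolding cos_diff[symmetric] by (simp add: diff_divide_distrib[symmetric])
    then have "\<bar>cos x\<bar> \<le> \<bar>cos ((y + x) / 2) * cos ((y - x) / 2)\<bar> + \<bar>sin ((y + x) / 2) * sin ((y - x) / 2)\<bar>"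
      using abs_triangle_ineq by metis
    then have "\<bar>cos x\<bar> \<le> \<bar>cos ((y + x) / 2)\<bar> * 1 + 1 * \<bar>sin ((y - x) / 2)\<bar>"
      unfolding abs_mult
      by (rule order_trans) (intro add_mono mult_mono abs_cos_le_one abs_sin_le_one; simp)
    then have "B * \<bar>cos x\<bar> \<le> B * (\<bar>sin (\<theta> - a)\<bar> + \<bar>sin (\<theta> - b)\<bar>)"
      unfolding sa sb using B by (intro mult_left_mono) simp_all
    ultimately show ?thesis unfolding wx using B by (simp add: B_def[symmetric] abs_mult)
  qed
  then show ?thesis by blast
qed

text \<open>
  Vertical planes are isotropic for the form \<open>symp\<close>, so on them the group distance is the distance of the
  coordinates, and the vertical coordinate of the projection of \<open>(z,t)\<close> is \<open>t - Im (z\<^sup>2 e\<^sup>-\<^sup>2\<^sup>i\<^sup>\<theta>)\<close>.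
\<close>

lemma vertical_proj_dist_power4:
  "koranyi_dist (vertical_proj \<theta> p) (vertical_proj \<theta> q) ^ 4 =
     Im ((fst p - fst q) * cis (-\<theta>)) ^ 4 +
     (snd p - snd q - Im ((fst p - fst q) * (fst p + fst q) * cis (-2 * \<theta>)))\<^sup>2"
proof -
  define c s where "c = cos \<theta>" and "s = sin \<theta>"
  have cs: "c * c + s * s = 1" by (simp add: c_def s_def sin_cos_squared_add3[unfolded power2_eq_square])
  have dbl: "cis (-2 * \<theta>) = Complex (c * c - s * s) (- 2 * s * c)"
    by (simp add: complex_eq_iff cos_double sin_double power2_eq_square c_def s_def)
  have third: "snd (vertical_proj \<theta> p) = snd p - Im (fst p * fst p * cis (-2 * \<theta>))" for p
    unfolding vertical_proj_eq dbl
    by (simp add: symp_def inner_complex_def flip: c_def s_def) (simp add: algebra_simps)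
  have "norm (fst (vertical_proj \<theta> p) - fst (vertical_proj \<theta> q)) = \<bar>Im ((fst p - fst q) * cis (-\<theta>))\<bar>"
  proof -
    have "fst (vertical_proj \<theta> p) - fst (vertical_proj \<theta> q) = of_real (Im ((fst p - fst q) * cis (-\<theta>))) * (\<i> * cis \<theta>)"
      unfolding vertical_proj_eq by (simp add: inner_complex_def complex_eq_iff algebra_simps)
    then show ?thesis by (simp only: norm_mult norm_of_real norm_ii norm_cis mult_1_right)
  qed
  moreover have "symp (fst (vertical_proj \<theta> p)) (fst (vertical_proj \<theta> q)) = 0"
    unfolding vertical_proj_eq by (simp add: symp_def algebra_simps)
  ultimately show ?thesis
    unfolding koranyi_dist_power4 third by (simp add: algebra_simps)
qed

lemma half_power_eq_powr: "(1/2::real) ^ n = 2 powr (- real n)"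
  by (simp add: powr_minus powr_realpow power_one_over inverse_eq_divide)

lemma powr_neg_le: "0 < x \<Longrightarrow> x \<le> y \<Longrightarrow> 0 \<le> a \<Longrightarrow> y powr (-a) \<le> x powr (-a :: real)"
  by (rule powr_mono2') auto

text \<open>
  Let \<open>\<rho> = |u|\<close>, \<open>B = |u v|\<close> and \<open>k = t - \<tau>\<close>. If \<open>|k| \<ge> 2 B\<close>, the height difference dominates and
  the projection does not shrink the distance \<open>d\<close> by more than a constant. Otherwise \<open>\<rho>\<close> is at least a multiple
  of \<open>d\<^sup>2\<close>. If \<open>|G| \<le> \<epsilon> \<rho>\<close>, transversality keeps one sine away from zero and the
  projected distance is at least a multiple of the square root of \<open>\<rho> \<nu>\<close>, with \<open>\<nu>\<close> the smaller sine. If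
  \<open>|G| > \<epsilon> \<rho>\<close>, only \<open>\<nu>\<^sup>2\<close> is available; using the height for
  the power \<open>\<beta> < 1\<close> keeps \<open>\<nu> powr (-\<beta>)\<close> integrable, and \<open>|G|\<close> takes the remaining power \<open>\<sigma> - \<beta>\<close>. This costs
  \<open>\<rho> powr (-(\<sigma> - \<beta> / 2))\<close>, which is at most a multiple of \<open>d powr (-(2 * \<sigma> - \<beta>))\<close>. The zeros of the sines are excluded because
  of the convention \<open>0 powr a = 0\<close>.
\<close>

lemma vertical_proj_kernel_pointwise:
  fixes c V \<sigma> \<beta> :: real
  assumes c: "0 < c" "c \<le> V" and sb: "1 \<le> \<sigma>" "\<sigma> < 2" "0 < \<beta>" "\<beta> < 1"
  defines "g \<equiv> max (\<sigma> / 2) \<beta>" and "s \<equiv> 2 * \<sigma> - \<beta>"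
  shows "\<exists>C>0. \<forall>p q. p \<noteq> q \<longrightarrow> koranyi_dist p q \<le> 1 \<longrightarrow> norm (fst p + fst q) \<le> V \<longrightarrow>
    (\<exists>a b. \<forall>\<theta>. c \<le> \<bar>Re ((fst p + fst q) * cis (-\<theta>))\<bar> \<longrightarrow> sin (\<theta> - a) \<noteq> 0 \<longrightarrow> sin (\<theta> - b) \<noteq> 0 \<longrightarrow>
       0 < koranyi_dist (vertical_proj \<theta> p) (vertical_proj \<theta> q) \<and>
       koranyi_dist (vertical_proj \<theta> p) (vertical_proj \<theta> q) powr (-\<sigma>) \<le>
         C * koranyi_dist p q powr (-s) * (1 + \<bar>sin (\<theta> - a)\<bar> powr (-g) + \<bar>sin (\<theta> - b)\<bar> powr (-g)))"
proof -
  have V: "0 < V" using c by simp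
  \<comment> \<open>Small enough that the error \<open>\<epsilon> V\<close> and the loss \<open>\<epsilon> c\<close> together leave half of \<open>c\<close>.\<close>
  define \<epsilon> where "\<epsilon> = c / (2 * (c + V))"
  have \<epsilon>: "0 < \<epsilon>" "\<epsilon> < 1" "\<epsilon> * (c + V) \<le> c / 2" using c V by (simp_all add: \<epsilon>_def field_simps)
  define m where "m = c / (2 * V)"
  have m: "0 < m" using c V by (simp add: m_def)
  define \<kappa> where "\<kappa> = sqrt (min (1/3) c / 4)"
  have \<kappa>: "0 < \<kappa>" "\<kappa>\<^sup>2 = min (1/3) c / 4" using c by (simp_all add: \<kappa>_def)
  define \<mu> where "\<mu> = 1 / (4 * max 1 (3 * V))"
  have \<mu>: "0 < \<mu>" by (simp add: \<mu>_def)
  define C1 where "C1 = \<kappa> powr (-\<sigma>)"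
  define C2 where "C2 = (c * m) powr (-(\<sigma> / 2)) * \<mu> powr (-(\<sigma> / 2))"
  define C3 where "C3 = \<epsilon> powr (-(\<sigma> - \<beta>)) * (2 * c) powr (-(\<beta> / 2)) * \<mu> powr (-(\<sigma> - \<beta> / 2))"
  have C: "0 < C1" "0 < C2" "0 < C3" using \<kappa> \<mu> m c \<epsilon> by (simp_all add: C1_def C2_def C3_def)
  have gs: "0 < g" "\<sigma> \<le> s" using sb by (simp_all add: g_def s_def)
  show ?thesis
  proof (rule exI[of _ "C1 + C2 + C3"], intro conjI allI impI)
    fix p q :: heis
    assume pq: "p \<noteq> q" "koranyi_dist p q \<le> 1" "norm (fst p + fst q) \<le> V"
    define d where "d = koranyi_dist p q"
    have d: "0 < d" "d \<le> 1" using pq koranyi.mdist_pos_less[of p q] by (auto simp: d_def)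
    define u v where "u = fst p - fst q" and "v = fst p + fst q"
    define k where "k = snd p - snd q"
    define \<rho> where "\<rho> = norm u"
    have \<rho>: "0 \<le> \<rho>" "\<rho> \<le> 1" using norm_fst_diff_le_koranyi[of p q] d by (auto simp: \<rho>_def u_def d_def)
    define B where "B = norm (u * v)"
    have B: "B = \<rho> * norm v" "B \<le> \<rho> * V" "0 \<le> B"
      using pq(3) \<rho>(1) by (auto simp: B_def \<rho>_def v_def norm_mult intro: mult_left_mono)
    define T where "T = k + 2 * symp (fst p) (fst q)"
    have "2 * symp (fst p) (fst q) = Im (u * cnj v)"
      by (simp add: symp_def u_def v_def algebra_simps)
    then have Tk: "\<bar>T - k\<bar> \<le> B"
      using abs_Im_le_cmod[of "u * cnj v"] by (simp add: T_def B_def norm_mult)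
    have d_le: "d\<^sup>2 \<le> 4 * max (\<rho>\<^sup>2) \<bar>T\<bar>"
    proof -
      define r where "r = sqrt (max (\<rho>\<^sup>2) \<bar>T\<bar>)"
      have r: "0 \<le> r" "r\<^sup>2 = max (\<rho>\<^sup>2) \<bar>T\<bar>" by (simp_all add: r_def le_max_iff_disj)
      have "d \<le> 2 * r" unfolding d_def
      proof (rule koranyi_dist_le[OF r(1)])
        have "\<rho>\<^sup>2 \<le> r\<^sup>2" unfolding r(2) by simp
        then have "\<rho> \<le> r" using r(1) by (rule power2_le_imp_le)
        then show "norm (fst p - fst q) \<le> r" by (simp only: \<rho>_def u_def)
        show "\<bar>snd p - snd q + 2 * symp (fst p) (fst q)\<bar> \<le> r\<^sup>2" using r by (simp add: T_def k_def)
      qed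
      then have "d\<^sup>2 \<le> (2 * r)\<^sup>2" using d by (intro power_mono) auto
      then show ?thesis using r by (simp add: power_mult_distrib)
    qed
    obtain a b where ab: "\<And>\<theta>. 2 * B * (\<bar>sin (\<theta> - a)\<bar> * \<bar>sin (\<theta> - b)\<bar>) \<le> \<bar>k - Im (u * v * cis (-2 * \<theta>))\<bar>"
        "\<And>\<theta>. \<bar>Re (u * v * cis (-2 * \<theta>))\<bar> \<le> B * (\<bar>sin (\<theta> - a)\<bar> + \<bar>sin (\<theta> - b)\<bar>)"
      using sine_level_factorization[of "u * v" k] unfolding B_def by blast
    show "\<exists>a b. \<forall>\<theta>. c \<le> \<bar>Re ((fst p + fst q) * cis (-\<theta>))\<bar> \<longrightarrow> sin (\<theta> - a) \<noteq> 0 \<longrightarrow> sin (\<theta> - b) \<noteq> 0 \<longrightarrow>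
       0 < koranyi_dist (vertical_proj \<theta> p) (vertical_proj \<theta> q) \<and>
       koranyi_dist (vertical_proj \<theta> p) (vertical_proj \<theta> q) powr (-\<sigma>) \<le>
         (C1 + C2 + C3) * koranyi_dist p q powr (-s) * (1 + \<bar>sin (\<theta> - a)\<bar> powr (-g) + \<bar>sin (\<theta> - b)\<bar> powr (-g))"
    proof (rule exI[of _ a], rule exI[of _ b], intro allI impI)
      fix \<theta> assume th: "c \<le> \<bar>Re ((fst p + fst q) * cis (-\<theta>))\<bar>" "sin (\<theta> - a) \<noteq> 0" "sin (\<theta> - b) \<noteq> 0"
      define S1 S2 where "S1 = \<bar>sin (\<theta> - a)\<bar>" and "S2 = \<bar>sin (\<theta> - b)\<bar>"
      define \<nu> where "\<nu> = min S1 S2"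
      have \<nu>: "0 < \<nu>" "\<nu> \<le> 1" "\<nu> \<le> S1" "\<nu> \<le> S2"
        using th abs_sin_le_one[of "\<theta> - a"] by (auto simp: \<nu>_def S1_def S2_def min_def)
      define W where "W = 1 + S1 powr (-g) + S2 powr (-g)"
      have W: "1 \<le> W" "\<nu> powr (-g) \<le> W" by (auto simp: W_def \<nu>_def min_def)
      define D where "D = koranyi_dist (vertical_proj \<theta> p) (vertical_proj \<theta> q)"
      define G F where "G = Im (u * cis (-\<theta>))" and "F = k - Im (u * v * cis (-2 * \<theta>))"
      have D4: "D ^ 4 = G ^ 4 + F\<^sup>2"
        unfolding D_def vertical_proj_dist_power4 G_def F_def u_def v_def k_def ..
      have D0: "0 \<le> D" by (simp add: D_def koranyi_dist_nonneg)
      have DG: "\<bar>G\<bar> \<le> D"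
      proof (rule power_le_imp_le_base[of _ 3])
        have "\<bar>G\<bar> ^ 4 \<le> D ^ 4" unfolding D4 by simp
        then show "\<bar>G\<bar> ^ Suc 3 \<le> D ^ Suc 3" by simp
      qed (rule D0)
      have DF: "\<bar>F\<bar> \<le> D\<^sup>2"
      proof (rule power2_le_imp_le)
        show "\<bar>F\<bar>\<^sup>2 \<le> (D\<^sup>2)\<^sup>2" using D4 by (simp flip: power_mult)
      qed simp
      have cv: "c \<le> norm v" using th(1) abs_Re_le_cmod[of "v * cis (-\<theta>)"] by (simp add: v_def norm_mult)
      have cB: "c * \<rho> \<le> B" using cv \<rho>(1) B(1) by (simp add: mult.commute mult_left_mono)
      have DS: "2 * B * (S1 * S2) \<le> D\<^sup>2" using ab(1)[of \<theta>] DF by (simp add: F_def S1_def S2_def)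
      have S12: "\<nu>\<^sup>2 \<le> S1 * S2" using \<nu> by (simp add: power2_eq_square mult_mono)
      have dpow: "d powr (-t) \<le> d powr (-s)" if "t \<le> s" for t
        using d that by (intro powr_mono') auto
      have \<nu>pow: "\<nu> powr (-t) \<le> W" if "t \<le> g" for t
        using \<nu> that by (intro order_trans[OF powr_mono' W(2)]) auto
      have "\<exists>C'. 0 < D \<and> 0 \<le> C' \<and> C' \<le> C1 + C2 + C3 \<and> D powr (-\<sigma>) \<le> C' * d powr (-s) * W"
      proof (cases "2 * B \<le> \<bar>k\<bar>")
        case True
        have "\<bar>Im (u * v * cis (-2 * \<theta>))\<bar> \<le> B"
          using abs_Im_le_cmod[of "u * v * cis (-2 * \<theta>)"] by (simp add: B_def norm_mult)
        then have F: "\<bar>k\<bar> / 2 \<le> \<bar>F\<bar>" "B \<le> \<bar>F\<bar>" using True unfolding F_def by linarith+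
        have "c * \<rho>\<^sup>2 \<le> c * \<rho>" using c \<rho> by (simp add: power2_eq_square mult_left_le)
        then have "c * \<rho>\<^sup>2 \<le> \<bar>F\<bar>" using cB F(2) by linarith
        have "\<bar>T\<bar> / 3 \<le> \<bar>F\<bar>" using Tk True F(1) by linarith
        have "min (1/3) c * max (\<rho>\<^sup>2) \<bar>T\<bar> \<le> \<bar>F\<bar>"
        proof -
          have "min (1/3) c * \<bar>T\<bar> \<le> 1/3 * \<bar>T\<bar>" "min (1/3) c * \<rho>\<^sup>2 \<le> c * \<rho>\<^sup>2"
            by (intro mult_right_mono; simp)+
          moreover have "max (\<rho>\<^sup>2) \<bar>T\<bar> = \<rho>\<^sup>2 \<or> max (\<rho>\<^sup>2) \<bar>T\<bar> = \<bar>T\<bar>" by (simp add: max_def)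
          ultimately show ?thesis
            using \<open>c * \<rho>\<^sup>2 \<le> \<bar>F\<bar>\<close> \<open>\<bar>T\<bar> / 3 \<le> \<bar>F\<bar>\<close> by (elim disjE ssubst; linarith)
        qed
        moreover have "(\<kappa> * d)\<^sup>2 \<le> min (1/3) c * max (\<rho>\<^sup>2) \<bar>T\<bar>"
          using mult_left_mono[OF d_le, of "\<kappa>\<^sup>2"] c by (simp add: power_mult_distrib \<kappa>(2))
        ultimately have "(\<kappa> * d)\<^sup>2 \<le> D\<^sup>2" using DF by linarith
        then have kd: "\<kappa> * d \<le> D" using D0 by (rule power2_le_imp_le)
        have "0 < \<kappa> * d" using \<kappa> d by simp
        then have "D powr (-\<sigma>) \<le> (\<kappa> * d) powr (-\<sigma>)" using kd sb by (intro powr_neg_le) auto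
        also have "\<dots> = C1 * d powr (-\<sigma>)" by (simp add: C1_def powr_mult)
        also have "\<dots> \<le> C1 * d powr (-s)" using C dpow gs by (intro mult_left_mono) auto
        also have "\<dots> \<le> C1 * d powr (-s) * W" using mult_left_mono[OF W(1), of "C1 * d powr (-s)"] C by simp
        finally show ?thesis using kd \<open>0 < \<kappa> * d\<close> C by (intro exI[of _ C1]) auto
      next
        case False
        have "\<bar>T\<bar> \<le> 3 * V * \<rho>" using False Tk B(2) by (simp add: mult_ac)
        also have "\<dots> \<le> max 1 (3 * V) * \<rho>" using \<rho> by (intro mult_right_mono) auto
        finally have T: "\<bar>T\<bar> \<le> max 1 (3 * V) * \<rho>" .
        have "\<rho>\<^sup>2 \<le> 1 * \<rho>" using \<rho> by (simp add: power2_eq_square mult_left_le)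
        also have "\<dots> \<le> max 1 (3 * V) * \<rho>" using \<rho> by (intro mult_right_mono) auto
        finally have "d\<^sup>2 \<le> 4 * max 1 (3 * V) * \<rho>" using T d_le by (simp add: max_def split: if_splits)
        then have \<rho>d: "\<mu> * d\<^sup>2 \<le> \<rho>" by (simp add: \<mu>_def divide_le_eq mult.commute)
        have \<mu>d: "0 < \<mu> * d\<^sup>2" using \<mu> d by simp
        then have \<rho>0: "0 < \<rho>" using \<rho>d by linarith
        have \<rho>pow: "\<rho> powr (-t) \<le> \<mu> powr (-t) * d powr (-(2 * t))" if "0 \<le> t" for t
        proof -
          have "\<rho> powr (-t) \<le> (\<mu> * d\<^sup>2) powr (-t)" using \<rho>d \<mu>d that by (intro powr_neg_le)
          also have "\<dots> = \<mu> powr (-t) * (d powr 2) powr (-t)" using d by (simp add: powr_mult powr_numeral)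
          finally show ?thesis by (simp add: powr_powr)
        qed
        show ?thesis
        proof (cases "\<bar>G\<bar> \<le> \<epsilon> * \<rho>")
          case True
          define e where "e = cis (-\<theta>)"
          have e2: "cis (-2 * \<theta>) = e * e" by (simp add: e_def cis_mult)
          have "\<rho> = norm (u * e)" by (simp add: \<rho>_def e_def norm_mult)
          then have Re_ue: "\<rho> * (1 - \<epsilon>) \<le> \<bar>Re (u * e)\<bar>"
            using cmod_le[of "u * e"] True by (simp add: G_def e_def[symmetric] algebra_simps)
          have Im_ve: "\<bar>Im (v * e)\<bar> \<le> V"
            using abs_Im_le_cmod[of "v * e"] pq(3) by (simp add: e_def v_def norm_mult)
          have "\<rho> * (1 - \<epsilon>) * c \<le> \<bar>Re (u * e)\<bar> * \<bar>Re (v * e)\<bar>"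
            using Re_ue th(1) c \<epsilon> \<rho> by (intro mult_mono) (auto simp: v_def e_def)
          moreover have "\<bar>Im (u * e)\<bar> * \<bar>Im (v * e)\<bar> \<le> \<epsilon> * \<rho> * V"
            using True Im_ve V \<epsilon> \<rho> by (intro mult_mono) (auto simp: G_def e_def)
          moreover have "Re (u * v * (e * e)) = Re (u * e) * Re (v * e) - Im (u * e) * Im (v * e)"
            by (simp add: algebra_simps)
          ultimately have "\<rho> * (1 - \<epsilon>) * c - \<epsilon> * \<rho> * V \<le> \<bar>Re (u * v * cis (-2 * \<theta>))\<bar>"
            unfolding e2 abs_mult[symmetric] by linarith
          moreover have "\<rho> * (\<epsilon> * (c + V)) \<le> \<rho> * (c / 2)" using \<epsilon>(3) \<rho> by (intro mult_left_mono)
          ultimately have "\<rho> * (c / 2) \<le> \<bar>Re (u * v * cis (-2 * \<theta>))\<bar>" by (simp add: algebra_simps)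
          also have "\<dots> \<le> B * (S1 + S2)" using ab(2)[of \<theta>] by (simp add: S1_def S2_def)
          also have "\<dots> \<le> \<rho> * V * (S1 + S2)" using B(2) by (intro mult_right_mono) (auto simp: S1_def S2_def)
          finally have "c / 2 \<le> V * (S1 + S2)" using \<rho>0 by (simp add: mult.assoc)
          then have "m \<le> S1 + S2" using V by (simp add: m_def field_simps)
          then have "\<nu> * (m / 2) \<le> S1 * S2"
            using \<nu>(1) mult_left_mono[of "m/2" "max S1 S2" \<nu>] by (auto simp: \<nu>_def min_def max_def mult.commute split: if_splits)
          then have "2 * (c * \<rho>) * (\<nu> * (m / 2)) \<le> 2 * B * (S1 * S2)"
            by (rule mult_mono[rotated]) (use cB B(3) \<nu> m in simp_all)
          then have D2: "c * m * \<rho> * \<nu> \<le> D\<^sup>2" using DS by (simp add: mult_ac)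
          have pos: "0 < c * m * \<rho> * \<nu>" using c m \<rho>0 \<nu> by simp
          then have D: "0 < D" using D2 D0 by (cases "D = 0") auto
          have "D powr (-\<sigma>) = (D\<^sup>2) powr (-(\<sigma> / 2))" using D by (simp add: powr_powr flip: powr_numeral)
          also have "\<dots> \<le> (c * m * \<rho> * \<nu>) powr (-(\<sigma> / 2))" using D2 pos sb by (intro powr_neg_le) auto
          also have "\<dots> = (c * m) powr (-(\<sigma> / 2)) * \<rho> powr (-(\<sigma> / 2)) * \<nu> powr (-(\<sigma> / 2))"
            by (simp add: powr_mult)
          also have "\<dots> \<le> (c * m) powr (-(\<sigma> / 2)) * (\<mu> powr (-(\<sigma> / 2)) * d powr (-(2 * (\<sigma> / 2)))) * W"
            using \<rho>pow[of "\<sigma> / 2"] \<nu>pow[of "\<sigma> / 2"] sb by (intro mult_mono) (auto simp: g_def)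
          also have "\<dots> = C2 * d powr (-\<sigma>) * W" by (simp add: C2_def mult_ac)
          also have "\<dots> \<le> C2 * d powr (-s) * W"
            using C dpow gs W by (intro mult_left_mono mult_right_mono) auto
          finally show ?thesis using D C by (intro exI[of _ C2]) auto
        next
          case False
          have er: "0 < \<epsilon> * \<rho>" using \<epsilon> \<rho>0 by simp
          have D\<epsilon>: "\<epsilon> * \<rho> \<le> D" using False DG by linarith
          then have D: "0 < D" using er by linarith
          have "2 * (c * \<rho>) * \<nu>\<^sup>2 \<le> 2 * B * (S1 * S2)"
            by (rule mult_mono) (use cB S12 B(3) in simp_all)
          then have D2: "2 * c * \<rho> * \<nu>\<^sup>2 \<le> D\<^sup>2" using DS by (simp add: mult_ac)
          have pos: "0 < 2 * c * \<rho> * \<nu>\<^sup>2" using c \<rho>0 \<nu> by simp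
          have "D powr (-\<sigma>) = D powr (-(\<sigma> - \<beta>)) * D powr (-\<beta>)" by (simp flip: powr_add)
          also have "D powr (-\<beta>) = (D\<^sup>2) powr (-(\<beta> / 2))" using D by (simp add: powr_powr flip: powr_numeral)
          also have "D powr (-(\<sigma> - \<beta>)) * (D\<^sup>2) powr (-(\<beta> / 2)) \<le>
              (\<epsilon> * \<rho>) powr (-(\<sigma> - \<beta>)) * (2 * c * \<rho> * \<nu>\<^sup>2) powr (-(\<beta> / 2))"
            using D\<epsilon> er D2 pos sb by (intro mult_mono powr_neg_le) auto
          also have "\<dots> = \<epsilon> powr (-(\<sigma> - \<beta>)) * (2 * c) powr (-(\<beta> / 2)) * \<rho> powr (-(\<sigma> - \<beta> / 2)) * \<nu> powr (-\<beta>)"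
          proof -
            have "(\<nu>\<^sup>2) powr (-(\<beta> / 2)) = \<nu> powr (-\<beta>)" using \<nu> by (simp add: powr_powr flip: powr_numeral)
            moreover have "\<rho> powr (-(\<sigma> - \<beta> / 2)) = \<rho> powr (-(\<sigma> - \<beta>)) * \<rho> powr (-(\<beta> / 2))"
              by (simp flip: powr_add)
            ultimately show ?thesis by (simp add: powr_mult mult_ac)
          qed
          also have "\<dots> \<le> \<epsilon> powr (-(\<sigma> - \<beta>)) * (2 * c) powr (-(\<beta> / 2)) *
              (\<mu> powr (-(\<sigma> - \<beta> / 2)) * d powr (-(2 * (\<sigma> - \<beta> / 2)))) * W"
            using \<rho>pow[of "\<sigma> - \<beta> / 2"] \<nu>pow[of \<beta>] sb by (intro mult_mono) (auto simp: g_def)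
          also have "\<dots> = C3 * d powr (-s) * W" by (simp add: C3_def s_def mult_ac right_diff_distrib)
          finally show ?thesis using D C by (intro exI[of _ C3]) auto
        qed
      qed
      then obtain C' where C': "0 < D" "0 \<le> C'" "C' \<le> C1 + C2 + C3" "D powr (-\<sigma>) \<le> C' * d powr (-s) * W" by blast
      note C'(4)
      also have "C' * d powr (-s) * W \<le> (C1 + C2 + C3) * d powr (-s) * W"
        using C'(3) W by (intro mult_right_mono) auto
      finally show "0 < koranyi_dist (vertical_proj \<theta> p) (vertical_proj \<theta> q) \<and>
        koranyi_dist (vertical_proj \<theta> p) (vertical_proj \<theta> q) powr (-\<sigma>) \<le>
         (C1 + C2 + C3) * koranyi_dist p q powr (-s) * (1 + \<bar>sin (\<theta> - a)\<bar> powr (-g) + \<bar>sin (\<theta> - b)\<bar> powr (-g))"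
        using C'(1) by (simp add: D_def d_def W_def S1_def S2_def)
    qed
  qed (use C in simp)
qed

lemma continuous_vertical_proj_dist:
  "continuous_on UNIV (\<lambda>\<theta>. koranyi_dist (vertical_proj \<theta> p) (vertical_proj \<theta> q))"
proof -
  have "koranyi_dist a b = root 4 (koranyi_dist a b ^ 4)" for a b
    using koranyi_dist_nonneg[of a b] by (simp add: real_root_power_cancel)
  then have "(\<lambda>\<theta>. koranyi_dist (vertical_proj \<theta> p) (vertical_proj \<theta> q)) =
    (\<lambda>\<theta>. root 4 (koranyi_dist (vertical_proj \<theta> p) (vertical_proj \<theta> q) ^ 4))" by blast
  then have "continuous_on UNIV (\<lambda>\<theta>. koranyi_dist (vertical_proj \<theta> p) (vertical_proj \<theta> q)) \<longleftrightarrow>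
    continuous_on UNIV (\<lambda>\<theta>. root 4 (koranyi_dist (vertical_proj \<theta> p) (vertical_proj \<theta> q) ^ 4))"
    by (rule arg_cong)
  also have "\<dots>"
    unfolding vertical_proj_dist_power4 by (intro continuous_intros)
  finally show ?thesis .
qed

text \<open>
  Where the projections of \<open>p\<close> and \<open>q\<close> coincide, the kernel ought to be infinite, while
  \<open>0 powr (-\<sigma>) = 0\<close>; the truncation at \<open>\<eta>\<close> keeps it large there, and the bound does not depend on \<open>\<eta>\<close>.
\<close>

lemma vertical_proj_kernel_integral:
  fixes c V \<sigma> \<beta> :: real
  assumes c: "0 < c" "c \<le> V" and sb: "1 \<le> \<sigma>" "\<sigma> < 2" "0 < \<beta>" "\<beta> < 1"
  shows "\<exists>C\<ge>0. \<forall>p q \<Theta>. p \<noteq> q \<longrightarrow> koranyi_dist p q \<le> 1 \<longrightarrow> norm (fst p + fst q) \<le> V \<longrightarrow>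
    \<Theta> \<subseteq> {0..<pi} \<longrightarrow> (\<forall>\<theta>\<in>\<Theta>. c \<le> \<bar>Re ((fst p + fst q) * cis (-\<theta>))\<bar>) \<longrightarrow>
    (\<forall>\<eta>>0. (\<integral>\<^sup>+\<theta>. ennreal (max (koranyi_dist (vertical_proj \<theta> p) (vertical_proj \<theta> q)) \<eta> powr (-\<sigma>)) * indicator \<Theta> \<theta> \<partial>lborel)
      \<le> ennreal (C * koranyi_dist p q powr (-(2 * \<sigma> - \<beta>))))"
proof -
  define g where "g = max (\<sigma> / 2) \<beta>"
  have g: "0 < g" "g < 1" using sb by (auto simp: g_def)
  obtain C1 where C1: "0 < C1" "\<And>p q. p \<noteq> q \<Longrightarrow> koranyi_dist p q \<le> 1 \<Longrightarrow> norm (fst p + fst q) \<le> V \<Longrightarrow>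
    \<exists>a b. \<forall>\<theta>. c \<le> \<bar>Re ((fst p + fst q) * cis (-\<theta>))\<bar> \<longrightarrow> sin (\<theta> - a) \<noteq> 0 \<longrightarrow> sin (\<theta> - b) \<noteq> 0 \<longrightarrow>
       0 < koranyi_dist (vertical_proj \<theta> p) (vertical_proj \<theta> q) \<and>
       koranyi_dist (vertical_proj \<theta> p) (vertical_proj \<theta> q) powr (-\<sigma>) \<le>
         C1 * koranyi_dist p q powr (-(2 * \<sigma> - \<beta>)) * (1 + \<bar>sin (\<theta> - a)\<bar> powr (-g) + \<bar>sin (\<theta> - b)\<bar> powr (-g))"
    using vertical_proj_kernel_pointwise[OF c sb] unfolding g_def by blast
  obtain C2 where C2: "0 \<le> C2" "\<And>a. (\<integral>\<^sup>+\<theta>. ennreal (\<bar>sin (\<theta> - a)\<bar> powr (-g)) * indicator {0..<pi} \<theta> \<partial>lborel) \<le> ennreal C2"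
    using nn_integral_sin_powr[OF g] by blast
  have AE_sin: "AE \<theta> in lborel. sin (\<theta> - a) \<noteq> 0" for a :: real
  proof (rule AE_I')
    have "{\<theta>. sin (\<theta> - a) = 0} = range (\<lambda>i::int. a + of_int i * pi)"
      by (auto simp: sin_zero_iff_int2 algebra_simps)
    then have "countable {\<theta>. sin (\<theta> - a) = 0}" by simp
    then show "{\<theta>. sin (\<theta> - a) = 0} \<in> null_sets lborel" by (rule countable_imp_null_set_lborel)
  qed auto
  show ?thesis
  proof (intro exI[of _ "C1 * (pi + 2 * C2)"] conjI allI impI)
    fix p q :: heis and \<Theta> and \<eta> :: real
    assume pq: "p \<noteq> q" "koranyi_dist p q \<le> 1" "norm (fst p + fst q) \<le> V"
      and \<Theta>: "\<Theta> \<subseteq> {0..<pi}" "\<forall>\<theta>\<in>\<Theta>. c \<le> \<bar>Re ((fst p + fst q) * cis (-\<theta>))\<bar>" and \<eta>: "0 < \<eta>"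
    define A where "A = C1 * koranyi_dist p q powr (-(2 * \<sigma> - \<beta>))"
    have A: "0 \<le> A" using C1 by (simp add: A_def)
    obtain a b where ab: "\<And>\<theta>. c \<le> \<bar>Re ((fst p + fst q) * cis (-\<theta>))\<bar> \<Longrightarrow> sin (\<theta> - a) \<noteq> 0 \<Longrightarrow> sin (\<theta> - b) \<noteq> 0 \<Longrightarrow>
       0 < koranyi_dist (vertical_proj \<theta> p) (vertical_proj \<theta> q) \<and>
       koranyi_dist (vertical_proj \<theta> p) (vertical_proj \<theta> q) powr (-\<sigma>) \<le>
         A * (1 + \<bar>sin (\<theta> - a)\<bar> powr (-g) + \<bar>sin (\<theta> - b)\<bar> powr (-g))"
      using C1(2)[OF pq] unfolding A_def by blast
    let ?f = "\<lambda>\<theta> a. ennreal (\<bar>sin (\<theta> - a)\<bar> powr (-g)) * indicator {0..<pi} \<theta>"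
    have "(\<integral>\<^sup>+\<theta>. ennreal (max (koranyi_dist (vertical_proj \<theta> p) (vertical_proj \<theta> q)) \<eta> powr (-\<sigma>)) * indicator \<Theta> \<theta> \<partial>lborel)
      \<le> (\<integral>\<^sup>+\<theta>. ennreal A * (indicator {0..<pi} \<theta> + ?f \<theta> a + ?f \<theta> b) \<partial>lborel)"
    proof (rule nn_integral_mono_AE, use AE_sin[of a] AE_sin[of b] in eventually_elim)
      case (elim \<theta>)
      show ?case
      proof (cases "\<theta> \<in> \<Theta>")
        case True
        let ?D = "koranyi_dist (vertical_proj \<theta> p) (vertical_proj \<theta> q)"
        have D: "0 < ?D" "?D powr (-\<sigma>) \<le> A * (1 + \<bar>sin (\<theta> - a)\<bar> powr (-g) + \<bar>sin (\<theta> - b)\<bar> powr (-g))"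
          using ab True elim \<Theta>(2) by blast+
        have "max ?D \<eta> powr (-\<sigma>) \<le> ?D powr (-\<sigma>)" using D(1) sb by (intro powr_neg_le) auto
        with D(2) have "ennreal (max ?D \<eta> powr (-\<sigma>)) \<le> ennreal (A * (1 + \<bar>sin (\<theta> - a)\<bar> powr (-g) + \<bar>sin (\<theta> - b)\<bar> powr (-g)))"
          by (intro ennreal_leI) linarith
        moreover have "\<theta> \<in> {0..<pi}" using True \<Theta>(1) by blast
        ultimately show ?thesis using True A by (simp add: ennreal_mult)
      qed simp
    qed
    also have "\<dots> = ennreal A * ((\<integral>\<^sup>+\<theta>. indicator {0..<pi} \<theta> \<partial>lborel) + (\<integral>\<^sup>+\<theta>. ?f \<theta> a \<partial>lborel) + (\<integral>\<^sup>+\<theta>. ?f \<theta> b \<partial>lborel))"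
      by (subst nn_integral_cmult, measurable) (subst nn_integral_add, measurable)+
    also have "\<dots> \<le> ennreal A * (ennreal pi + ennreal C2 + ennreal C2)"
      by (intro mult_left_mono add_mono C2(2)) auto
    also have "\<dots> = ennreal (C1 * (pi + 2 * C2) * koranyi_dist p q powr (-(2 * \<sigma> - \<beta>)))"
      using A C1 C2 by (simp add: A_def ennreal_mult[symmetric] ennreal_plus[symmetric] algebra_simps del: ennreal_plus)
    finally show "(\<integral>\<^sup>+\<theta>. ennreal (max (koranyi_dist (vertical_proj \<theta> p) (vertical_proj \<theta> q)) \<eta> powr (-\<sigma>)) * indicator \<Theta> \<theta> \<partial>lborel)
      \<le> ennreal (C1 * (pi + 2 * C2) * koranyi_dist p q powr (-(2 * \<sigma> - \<beta>)))" .
  qed (use C1 C2 in simp)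
qed

section \<open>From bounded energies to positive Hausdorff measure\<close>

lemma le_ediam:
  assumes "x \<in> U" "y \<in> U" "ediam d U \<le> ennreal \<delta>" "\<And>x y. 0 \<le> d x y"
  shows "d x y \<le> enn2real (ediam d U)"
proof -
  have "ennreal (d x y) \<le> ediam d U"
    unfolding ediam_def using assms(1,2) by (intro SUP_upper2[of x] SUP_upper2[of y]) auto
  moreover have "ediam d U < top" using assms(3) by (rule le_less_trans) simp
  ultimately show ?thesis using enn2real_mono[of "ennreal (d x y)" "ediam d U"] assms(4)[of x y] by simp
qed

text \<open>
  The mass distribution principle for weights that live only on finite sets. A cover of \<open>L\<close> may be assumed
  open and, by compactness, finite, so at a fine enough level the truncation of the
  energy lies below all radii \<open>\<rho> i\<close>. Distribute the points among the balls, with masses \<open>a i\<close>. Pairs in the same ball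
  contribute at least \<open>(a i)\<^sup>2 (2 \<rho> i) powr (-\<sigma>)\<close> to the energy, so by the Cauchy-Schwarz inequality \<open>m\<^sup>2\<close> is at most the energy
  times the sum of the \<open>(2 \<rho> i) powr \<sigma>\<close>.
\<close>

lemma hausdorff_measure_pos_if_energy_bounded:
  fixes X :: "nat \<Rightarrow> 'a set" and f :: "'a \<Rightarrow> heis" and w :: "nat \<Rightarrow> 'a \<Rightarrow> real"
  assumes L: "compact L" and X: "\<And>n. finite (X n)" "\<And>n. f ` X n \<subseteq> L"
    and w: "\<And>n x. 0 \<le> w n x" "\<And>n. (\<Sum>x\<in>X n. w n x) = m" and m: "0 < m"
    and bounded: "\<exists>\<^sub>F n in sequentially.
      (\<Sum>x\<in>X n. \<Sum>y\<in>X n. w n x * w n y * max (koranyi_dist (f x) (f y)) ((1/2) ^ n) powr (-\<sigma>)) \<le> M"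
    and r: "0 < r" "r \<le> \<sigma>"
  shows "hausdorff_measure koranyi_dist r L \<noteq> 0"
proof
  assume zero: "hausdorff_measure koranyi_dist r L = 0"
  define M' where "M' = max M 1"
  have M': "M \<le> M'" "0 < M'" by (auto simp: M'_def)
  define \<epsilon> where "\<epsilon> = m\<^sup>2 / (4 * 2 powr r * M')"
  have \<epsilon>: "0 < \<epsilon>" using m M' by (simp add: \<epsilon>_def)
  have "hausdorff_content koranyi_dist r (1/4) L \<le> hausdorff_measure koranyi_dist r L"
    unfolding hausdorff_measure_def by (rule SUP_upper) simp
  then have "hausdorff_content koranyi_dist r (1/4) L < ennreal \<epsilon>" using zero \<epsilon> by simp
  then obtain U :: "nat \<Rightarrow> heis set" where U: "L \<subseteq> (\<Union>i. U i)" "\<And>i. ediam koranyi_dist (U i) \<le> ennreal (1/4)"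
      "(\<Sum>i. ennreal (enn2real (ediam koranyi_dist (U i)) powr r)) < ennreal \<epsilon>"
    unfolding hausdorff_content_def Inf_less_iff by blast
  define \<delta> where "\<delta> i = enn2real (ediam koranyi_dist (U i))" for i
  have \<delta>: "0 \<le> \<delta> i" "\<delta> i \<le> 1/4" for i
    using enn2real_mono[OF U(2)[of i]] by (simp_all add: \<delta>_def)
  \<comment> \<open>Open balls, barely more expensive than the covering sets, so that compactness applies.\<close>
  have "\<exists>\<rho>. \<delta> i < \<rho> \<and> \<rho> < 1/2 \<and> \<rho> powr r < \<delta> i powr r + \<epsilon> * (1/2) ^ Suc i" for i
  proof -
    have "((\<lambda>x. x powr r) \<longlongrightarrow> \<delta> i powr r) (at_right (\<delta> i))"
      using r \<delta>(1)[of i] by (intro tendsto_powr'[OF tendsto_ident_at tendsto_const]) (auto simp: eventually_at_right_less eventually_at_filter)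
    moreover have "\<delta> i powr r < \<delta> i powr r + \<epsilon> * (1/2) ^ Suc i" using \<epsilon> by simp
    ultimately have "\<forall>\<^sub>F x in at_right (\<delta> i). x powr r < \<delta> i powr r + \<epsilon> * (1/2) ^ Suc i" by (rule order_tendstoD)
    moreover have "\<forall>\<^sub>F x in at_right (\<delta> i). x < 1/2" using \<delta>(2)[of i] by (intro order_tendstoD(2)[OF tendsto_ident_at]) auto
    moreover have "\<forall>\<^sub>F x in at_right (\<delta> i). \<delta> i < x" by (rule eventually_at_right_less)
    ultimately have "\<forall>\<^sub>F x in at_right (\<delta> i). \<delta> i < x \<and> x < 1/2 \<and> x powr r < \<delta> i powr r + \<epsilon> * (1/2) ^ Suc i"
      by eventually_elim auto
    from eventually_happens'[OF trivial_limit_at_right_real this] show ?thesis by blast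
  qed
  then obtain \<rho> where \<rho>: "\<And>i. \<delta> i < \<rho> i" "\<And>i. \<rho> i < 1/2" "\<And>i. \<rho> i powr r < \<delta> i powr r + \<epsilon> * (1/2) ^ Suc i"
    by metis
  have \<rho>0: "0 < \<rho> i" for i using \<delta>(1)[of i] \<rho>(1)[of i] by linarith
  define c where "c i = (SOME u. u \<in> U i)" for i
  define ball where "ball i = {x. koranyi_dist x (c i) < \<rho> i}" for i
  have U_ball: "U i \<subseteq> ball i" for i
  proof
    fix x assume x: "x \<in> U i"
    then have "c i \<in> U i" unfolding c_def by (rule someI)
    from le_ediam[OF x this U(2)[of i] koranyi_dist_nonneg]
    have "koranyi_dist x (c i) \<le> \<delta> i" by (simp only: \<delta>_def)
    then show "x \<in> ball i" using \<rho>(1)[of i] by (simp add: ball_def)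
  qed
  have "L \<subseteq> (\<Union>i. ball i)"
    by (rule order_trans[OF U(1)], rule UN_mono[OF subset_refl U_ball])
  moreover have "open (ball i)" for i unfolding ball_def by (rule open_koranyi_ball)
  ultimately obtain I where I: "finite I" "L \<subseteq> (\<Union>i\<in>I. ball i)"
    using compactE_image[OF L, of UNIV ball] by metis
  have sum_\<rho>: "(\<Sum>i\<in>I. \<rho> i powr r) \<le> 2 * \<epsilon>"
  proof -
    have "ennreal (\<Sum>i\<in>I. \<rho> i powr r) = (\<Sum>i\<in>I. ennreal (\<rho> i powr r))" by (simp add: sum_ennreal)
    also have "\<dots> \<le> (\<Sum>i. ennreal (\<rho> i powr r))" using I(1) by (intro sum_le_suminf) auto
    also have "\<dots> \<le> (\<Sum>i. ennreal (\<delta> i powr r) + ennreal (\<epsilon> * (1/2) ^ Suc i))"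
      using \<rho>(3) \<epsilon> by (intro suminf_le) (auto simp: ennreal_plus[symmetric] less_imp_le simp del: ennreal_plus intro!: ennreal_leI)
    also have "\<dots> = (\<Sum>i. ennreal (\<delta> i powr r)) + (\<Sum>i. ennreal (\<epsilon> * (1/2) ^ Suc i))"
      by (rule suminf_add[symmetric]) auto
    also have "(\<Sum>i. ennreal (\<epsilon> * (1/2) ^ Suc i)) = ennreal (\<epsilon> * 1)"
      using sums_mult[OF power_half_series, of \<epsilon>] \<epsilon> by (intro suminf_ennreal_eq) auto
    also have "(\<Sum>i. ennreal (\<delta> i powr r)) + ennreal (\<epsilon> * 1) \<le> ennreal \<epsilon> + ennreal \<epsilon>"
      using U(3) by (intro add_mono) (auto simp: \<delta>_def)
    finally show ?thesis using \<epsilon> by (simp add: ennreal_plus[symmetric] sum_nonneg del: ennreal_plus)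
  qed
  have "\<forall>\<^sub>F n in sequentially. \<forall>i\<in>I. (1/2) ^ n < \<rho> i"
    using I(1) \<rho>0 by (intro eventually_ball_finite ballI order_tendstoD(2)[OF LIMSEQ_power_zero]) auto
  from frequently_eventually_frequently[OF bounded this]
  obtain n where n: "(\<Sum>x\<in>X n. \<Sum>y\<in>X n. w n x * w n y * max (koranyi_dist (f x) (f y)) ((1/2) ^ n) powr (-\<sigma>)) \<le> M"
      "\<And>i. i \<in> I \<Longrightarrow> (1/2) ^ n < \<rho> i"
    by (auto dest: frequently_ex)
  define Y where "Y = X n"
  define v where "v = w n"
  have "\<exists>i. i \<in> I \<and> koranyi_dist (f x) (c i) < \<rho> i" if "x \<in> Y" for x
    using that X(2)[of n] I(2) by (auto simp: Y_def ball_def)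
  then obtain ix where ix: "\<And>x. x \<in> Y \<Longrightarrow> ix x \<in> I" "\<And>x. x \<in> Y \<Longrightarrow> koranyi_dist (f x) (c (ix x)) < \<rho> (ix x)"
    by metis
  define Z where "Z i = {x \<in> Y. ix x = i}" for i
  define a where "a i = (\<Sum>x\<in>Z i. v x)" for i
  have Y: "finite Y" by (simp add: Y_def X)
  have m_eq: "m = (\<Sum>i\<in>I. a i)"
    unfolding a_def Z_def v_def w(2)[of n, symmetric] Y_def[symmetric]
    using I(1) Y ix(1) by (intro sum.group[symmetric]) auto
  have "(\<Sum>i\<in>I. (a i)\<^sup>2 * (2 * \<rho> i) powr (-\<sigma>)) = (\<Sum>i\<in>I. \<Sum>x\<in>Z i. \<Sum>y\<in>Z i. v x * v y * (2 * \<rho> i) powr (-\<sigma>))"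
    unfolding a_def power2_eq_square sum_product by (simp add: sum_distrib_right)
  also have "\<dots> \<le> (\<Sum>i\<in>I. \<Sum>x\<in>Z i. \<Sum>y\<in>Y. v x * v y * max (koranyi_dist (f x) (f y)) ((1/2) ^ n) powr (-\<sigma>))"
  proof (intro sum_mono)
    fix i x assume i: "i \<in> I" and x: "x \<in> Z i"
    have "(\<Sum>y\<in>Z i. v x * v y * (2 * \<rho> i) powr (-\<sigma>))
        \<le> (\<Sum>y\<in>Z i. v x * v y * max (koranyi_dist (f x) (f y)) ((1/2) ^ n) powr (-\<sigma>))"
    proof (intro sum_mono mult_left_mono powr_neg_le)
      fix y assume y: "y \<in> Z i"
      have "koranyi_dist (f x) (f y) \<le> koranyi_dist (f x) (c i) + koranyi_dist (c i) (f y)" by (rule koranyi.triangle) auto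
      also have "koranyi_dist (c i) (f y) = koranyi_dist (f y) (c i)" by (rule koranyi.commute)
      finally have "koranyi_dist (f x) (f y) \<le> 2 * \<rho> i" using ix(2)[of x] ix(2)[of y] x y by (auto simp: Z_def)
      then show "max (koranyi_dist (f x) (f y)) ((1/2) ^ n) \<le> 2 * \<rho> i" using n(2)[OF i] \<rho>0[of i] by simp
    qed (use r w in \<open>auto simp: v_def less_max_iff_disj\<close>)
    also have "\<dots> \<le> (\<Sum>y\<in>Y. v x * v y * max (koranyi_dist (f x) (f y)) ((1/2) ^ n) powr (-\<sigma>))"
      using Y w by (intro sum_mono2) (auto simp: Z_def v_def)
    finally show "(\<Sum>y\<in>Z i. v x * v y * (2 * \<rho> i) powr (-\<sigma>))
        \<le> (\<Sum>y\<in>Y. v x * v y * max (koranyi_dist (f x) (f y)) ((1/2) ^ n) powr (-\<sigma>))" .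
  qed
  also have "\<dots> = (\<Sum>x\<in>Y. \<Sum>y\<in>Y. v x * v y * max (koranyi_dist (f x) (f y)) ((1/2) ^ n) powr (-\<sigma>))"
    unfolding Z_def using I(1) Y ix(1) by (intro sum.group) auto
  also have "\<dots> \<le> M'" using n(1) M' by (simp add: Y_def v_def)
  finally have E: "(\<Sum>i\<in>I. (a i)\<^sup>2 * (2 * \<rho> i) powr (-\<sigma>)) \<le> M'" .
  have "m\<^sup>2 = (\<Sum>i\<in>I. (a i * (2 * \<rho> i) powr (-\<sigma> / 2)) * (2 * \<rho> i) powr (\<sigma> / 2))\<^sup>2"
  proof -
    have "(2 * \<rho> i) powr (-\<sigma> / 2) * (2 * \<rho> i) powr (\<sigma> / 2) = 1" for i
      using \<rho>0[of i] by (simp flip: powr_add)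
    then show ?thesis by (simp add: m_eq mult.assoc)
  qed
  also have "\<dots> \<le> (\<Sum>i\<in>I. (a i * (2 * \<rho> i) powr (-\<sigma> / 2))\<^sup>2) * (\<Sum>i\<in>I. ((2 * \<rho> i) powr (\<sigma> / 2))\<^sup>2)"
    by (rule Cauchy_Schwarz_ineq_sum)
  also have "\<dots> = (\<Sum>i\<in>I. (a i)\<^sup>2 * (2 * \<rho> i) powr (-\<sigma>)) * (\<Sum>i\<in>I. (2 * \<rho> i) powr \<sigma>)"
  proof -
    have "((2 * \<rho> i) powr x)\<^sup>2 = (2 * \<rho> i) powr (2 * x)" for i x by (simp add: power2_eq_square flip: powr_add)
    then show ?thesis by (simp add: power_mult_distrib)
  qed
  also have "\<dots> \<le> M' * (\<Sum>i\<in>I. 2 powr r * \<rho> i powr r)"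
  proof (intro mult_mono E sum_mono)
    fix i
    have "(2 * \<rho> i) powr \<sigma> \<le> (2 * \<rho> i) powr r" using \<rho>(2)[of i] \<rho>0[of i] r by (intro powr_mono') auto
    then show "(2 * \<rho> i) powr \<sigma> \<le> 2 powr r * \<rho> i powr r" using \<rho>0[of i] by (simp add: powr_mult)
  qed (use M' in \<open>auto intro: sum_nonneg\<close>)
  also have "\<dots> = M' * 2 powr r * (\<Sum>i\<in>I. \<rho> i powr r)" by (simp add: sum_distrib_left mult.assoc)
  also have "\<dots> \<le> M' * 2 powr r * (2 * \<epsilon>)" using sum_\<rho> M' by (intro mult_left_mono) auto
  also have "\<dots> = m\<^sup>2 / 2" using M' by (simp add: \<epsilon>_def)
  finally show False using m by simp
qed

lemma max_powr_le_dyadic_sum: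
  fixes d s :: real
  assumes "d \<le> 1" "0 \<le> s"
  shows "max d ((1/2) ^ n) powr (-s) \<le> (\<Sum>k\<le>n. 2 powr (s * (real k + 1)) * (if d \<le> (1/2) ^ k then 1 else 0))"
proof -
  have two: "((1/2) ^ j) powr (-s) = 2 powr (s * real j)" for j
  proof -
    show ?thesis unfolding half_power_eq_powr by (simp add: powr_powr mult.commute)
  qed
  obtain k where k: "k \<le> n" "d \<le> (1/2) ^ k" "(1/2) ^ Suc k \<le> max d ((1/2) ^ n)"
  proof (cases "d \<le> (1/2) ^ n")
    case True
    show ?thesis by (rule that[of n]) (use True in \<open>auto simp: le_max_iff_disj\<close>)
  next
    case False
    define k where "k = (GREATEST k. k \<le> n \<and> d \<le> (1/2) ^ k)"
    have "k \<le> n \<and> d \<le> (1/2) ^ k"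
      unfolding k_def by (rule GreatestI_nat[of _ 0 n]) (use assms in auto)
    moreover have "\<not> (Suc k \<le> n \<and> d \<le> (1/2) ^ Suc k)"
      using Greatest_le_nat[of "\<lambda>k. k \<le> n \<and> d \<le> (1/2) ^ k" "Suc k" n] unfolding k_def[symmetric] by auto
    moreover have "k \<noteq> n" using False calculation(1) by auto
    ultimately show ?thesis by (intro that[of k]) (auto simp: le_max_iff_disj)
  qed
  have "max d ((1/2) ^ n) powr (-s) \<le> ((1/2) ^ Suc k) powr (-s)"
    using k(3) assms by (intro powr_neg_le) auto
  also have "\<dots> = 2 powr (s * (real k + 1))" unfolding two by (simp add: add.commute)
  also have "\<dots> = 2 powr (s * (real k + 1)) * (if d \<le> (1/2) ^ k then 1 else 0)" using k(2) by simp
  also have "\<dots> \<le> (\<Sum>k\<le>n. 2 powr (s * (real k + 1)) * (if d \<le> (1/2) ^ k then 1 else 0))"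
    using k(1) by (intro member_le_sum) auto
  finally show ?thesis .
qed

text \<open>
  A ball of radius \<open>2\<^sup>-\<^sup>k\<close> has mass at most a multiple of \<open>2 powr (-(s * k))\<close> as long as \<open>k \<le> n\<close>, and because of the
  truncation no smaller ball matters. Summing over the dyadic shells gives a geometric series with ratio \<open>2 powr (t - s)\<close>.
\<close>

lemma discrete_potential_bounded:
  fixes s t :: real
  assumes st: "0 < t" "t < s"
  shows "\<exists>B\<ge>0. \<forall>n X w x. finite X \<longrightarrow> (\<forall>y. 0 \<le> w y) \<longrightarrow>
     (\<forall>k\<le>Suc n. \<forall>i. (\<Sum>y\<in>{y\<in>X. hcell k y = i}. w y) \<le> (2 powr (-s)) ^ k) \<longrightarrow>
     (\<forall>y\<in>X. koranyi_dist x y \<le> 1) \<longrightarrow>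
     (\<Sum>y\<in>X. w y * max (koranyi_dist x y) ((1/2) ^ n) powr (-t)) \<le> B"
proof -
  define a where "a = 2 powr (t - s)"
  have a: "0 < a" "a < 1" using st by (simp_all add: a_def powr_less_one)
  define N where "N = (2 * 2 + 3)\<^sup>2 * (2 * 2\<^sup>2 + 293 :: nat)"
  show ?thesis
  proof (rule exI[of _ "N * (1 / (1 - a))"], intro conjI allI impI)
    fix n :: nat and X :: "heis set" and w x
    assume X: "finite X" and w: "\<forall>y. 0 \<le> w y"
      and cells: "\<forall>k\<le>Suc n. \<forall>i. (\<Sum>y\<in>{y\<in>X. hcell k y = i}. w y) \<le> (2 powr (-s)) ^ k"
      and d1: "\<forall>y\<in>X. koranyi_dist x y \<le> 1"
    have ball: "(\<Sum>y\<in>{y\<in>X. koranyi_dist x y \<le> (1/2) ^ k}. w y) \<le> N * (2 powr (-s)) ^ Suc k" if "k \<le> n" for k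
    proof -
      define D where "D = {y\<in>X. koranyi_dist x y \<le> (1/2) ^ k}"
      have "koranyi_dist p q \<le> real 2 * (1/2) ^ k" if "p \<in> D" "q \<in> D" for p q
        using koranyi.triangle[of p x q] koranyi.commute[of p x] that by (simp add: D_def)
      from hcell_overlap[OF this]
      have fin: "finite (hcell (Suc k) ` D)" "card (hcell (Suc k) ` D) \<le> N" by (simp_all only: N_def)
      have "(\<Sum>y\<in>D. w y) = (\<Sum>i\<in>hcell (Suc k) ` D. \<Sum>y\<in>{y\<in>D. hcell (Suc k) y = i}. w y)"
        using X fin by (intro sum.group[symmetric]) (auto simp: D_def)
      also have "\<dots> \<le> (\<Sum>i\<in>hcell (Suc k) ` D. (2 powr (-s)) ^ Suc k)"
      proof (rule sum_mono)
        fix i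
        have "(\<Sum>y\<in>{y\<in>D. hcell (Suc k) y = i}. w y) \<le> (\<Sum>y\<in>{y\<in>X. hcell (Suc k) y = i}. w y)"
          using X w by (intro sum_mono2) (auto simp: D_def)
        also have "\<dots> \<le> (2 powr (-s)) ^ Suc k" using cells that by blast
        finally show "(\<Sum>y\<in>{y\<in>D. hcell (Suc k) y = i}. w y) \<le> (2 powr (-s)) ^ Suc k" .
      qed
      also have "\<dots> = card (hcell (Suc k) ` D) * (2 powr (-s)) ^ Suc k" by simp
      also have "\<dots> \<le> N * (2 powr (-s)) ^ Suc k" using fin(2) by (intro mult_right_mono) auto
      finally show ?thesis by (simp only: D_def)
    qed
    have "(\<Sum>y\<in>X. w y * max (koranyi_dist x y) ((1/2) ^ n) powr (-t))
       \<le> (\<Sum>y\<in>X. w y * (\<Sum>k\<le>n. 2 powr (t * (real k + 1)) * (if koranyi_dist x y \<le> (1/2) ^ k then 1 else 0)))"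
      using w st d1 by (intro sum_mono mult_left_mono max_powr_le_dyadic_sum) auto
    also have "\<dots> = (\<Sum>k\<le>n. 2 powr (t * (real k + 1)) * (\<Sum>y\<in>X. if koranyi_dist x y \<le> (1/2) ^ k then w y else 0))"
      unfolding sum_distrib_left by (subst sum.swap) (intro sum.cong refl, simp)
    also have "\<dots> = (\<Sum>k\<le>n. 2 powr (t * (real k + 1)) * (\<Sum>y\<in>{y\<in>X. koranyi_dist x y \<le> (1/2) ^ k}. w y))"
      using X by (simp add: sum.inter_filter)
    also have "\<dots> \<le> (\<Sum>k\<le>n. 2 powr (t * (real k + 1)) * (N * (2 powr (-s)) ^ Suc k))"
      using ball by (intro sum_mono mult_left_mono) auto
    also have "\<dots> = (\<Sum>k\<le>n. N * a ^ Suc k)"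
    proof (intro sum.cong refl)
      fix k
      have "(2 powr (-s)) ^ Suc k = 2 powr (-s * (real k + 1))" "a ^ Suc k = 2 powr ((t - s) * (real k + 1))"
        by (simp_all add: a_def powr_powr add.commute flip: powr_realpow del: power_Suc)
      then show "2 powr (t * (real k + 1)) * (N * (2 powr (-s)) ^ Suc k) = N * a ^ Suc k"
        by (simp add: algebra_simps flip: powr_add del: power_Suc)
    qed
    also have "\<dots> = N * (\<Sum>k\<in>Suc ` {..n}. a ^ k)" by (simp add: sum_distrib_left sum.reindex)
    also have "\<dots> \<le> N * (\<Sum>k. a ^ k)"
      using a by (intro mult_left_mono sum_le_suminf summable_geometric) auto
    also have "\<dots> = N * (1 / (1 - a))" using a by (simp add: suminf_geometric)
    finally show "(\<Sum>y\<in>X. w y * max (koranyi_dist x y) ((1/2) ^ n) powr (-t)) \<le> N * (1 / (1 - a))" .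
  qed (use a in simp)
qed

lemma continuous_on_vertical_proj: "continuous_on UNIV (vertical_proj \<theta>)"
  unfolding vertical_proj_eq symp_def by (intro continuous_intros)

lemma finite_hcell_image:
  assumes "\<And>p q. p \<in> E \<Longrightarrow> q \<in> E \<Longrightarrow> koranyi_dist p q \<le> 1"
  shows "finite (hcell n ` E)"
proof (cases n)
  case 0
  have "hcell 0 ` E \<subseteq> {(0, 0, 0)}" by auto
  then show ?thesis unfolding 0 by (rule finite_subset) simp
next
  case (Suc m)
  have "koranyi_dist p q \<le> real (2 ^ m) * (1/2) ^ m" if "p \<in> E" "q \<in> E" for p q
    using assms[OF that] by (simp add: power_divide)
  from hcell_overlap[OF this] show ?thesis unfolding Suc by blast
qed

text \<open>
  The energy argument. By the kernel bound the average over \<open>\<Theta>\<close> of the energy of the projected level-\<open>n\<close> weights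
  is bounded independently of \<open>n\<close>. By Fatou's lemma the limit inferior
  of these energies is finite for almost every angle, and that is all that
  \<open>hausdorff_measure_pos_if_energy_bounded\<close> asks for.
\<close>

lemma projections_positive_if_kernel_bound:
  fixes s t \<sigma> C :: real
  assumes par: "0 < \<sigma>" "\<sigma> \<le> t" "t < s" and C: "0 \<le> C"
    and K: "compact K" "E \<subseteq> K" and pos: "hcells.content (2 powr (-s)) E \<noteq> 0"
    and diam: "\<And>p q. p \<in> E \<Longrightarrow> q \<in> E \<Longrightarrow> koranyi_dist p q \<le> 1"
    and \<Theta>: "\<Theta> \<in> sets borel" "\<Theta> \<subseteq> {0..<pi}"
    and kernel: "\<And>p q \<eta>. p \<in> E \<Longrightarrow> q \<in> E \<Longrightarrow> p \<noteq> q \<Longrightarrow> 0 < \<eta> \<Longrightarrow>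
      (\<integral>\<^sup>+\<theta>. ennreal (max (koranyi_dist (vertical_proj \<theta> p) (vertical_proj \<theta> q)) \<eta> powr (-\<sigma>)) * indicator \<Theta> \<theta> \<partial>lborel)
        \<le> ennreal (C * koranyi_dist p q powr (-t))"
  shows "AE \<theta> in lborel. \<theta> \<in> \<Theta> \<longrightarrow> (\<forall>r. 0 < r \<longrightarrow> r \<le> \<sigma> \<longrightarrow> hausdorff_measure koranyi_dist r (vertical_proj \<theta> ` K) \<noteq> 0)"
proof -
  define q where "q = 2 powr (-s)"
  have q: "0 < q" "q < 1" using par by (simp_all add: q_def powr_less_one)
  define m where "m = enn2real (hcells.content q E)"
  have m: "0 < m"
    using pos hcells.content_finite[of q E] by (simp add: m_def q_def enn2real_positive_iff zero_less_iff_neq_zero top.not_eq_extremum[symmetric])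
  define Q where "Q n X w \<longleftrightarrow> finite X \<and> X \<subseteq> E \<and> (\<forall>x. 0 \<le> w x) \<and> (\<Sum>x\<in>X. w x) = m \<and>
      (\<forall>k\<le>Suc n. \<forall>i. (\<Sum>x\<in>{x\<in>X. hcell k x = i}. w x) \<le> q ^ k)" for n X w
  have "\<exists>X w. Q n X w" for n
    unfolding Q_def m_def by (rule hcells.discrete_frostman[OF q]) (rule finite_hcell_image, rule diam)
  then have "\<exists>X. \<forall>n. \<exists>w. Q n (X n) w" by (intro choice allI)
  then obtain X where "\<forall>n. \<exists>w. Q n (X n) w" ..
  then have "\<exists>w. \<forall>n. Q n (X n) (w n)" by (rule choice)
  then obtain w where Q: "\<And>n. Q n (X n) (w n)" by blast
  have X: "\<And>n. finite (X n)" "\<And>n. X n \<subseteq> E" and w: "\<And>n x. 0 \<le> w n x" "\<And>n. (\<Sum>x\<in>X n. w n x) = m"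
    and cells: "\<And>n k i. k \<le> Suc n \<Longrightarrow> (\<Sum>x\<in>{x\<in>X n. hcell k x = i}. w n x) \<le> q ^ k"
    using Q unfolding Q_def by blast+
  obtain B where B: "0 \<le> B" "\<And>n X w x. finite X \<Longrightarrow> (\<forall>y. 0 \<le> w y) \<Longrightarrow>
     (\<forall>k\<le>Suc n. \<forall>i. (\<Sum>y\<in>{y\<in>X. hcell k y = i}. w y) \<le> (2 powr (-s)) ^ k) \<Longrightarrow>
     (\<forall>y\<in>X. koranyi_dist x y \<le> 1) \<Longrightarrow>
     (\<Sum>y\<in>X. w y * max (koranyi_dist x y) ((1/2) ^ n) powr (-t)) \<le> B"
    using discrete_potential_bounded[of t s] par by auto
  define D where "D \<theta> x y = koranyi_dist (vertical_proj \<theta> x) (vertical_proj \<theta> y)" for \<theta> x y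
  define en where "en n \<theta> = (\<Sum>x\<in>X n. \<Sum>y\<in>X n. w n x * w n y * max (D \<theta> x y) ((1/2) ^ n) powr (-\<sigma>))" for n \<theta>
  have en0: "0 \<le> en n \<theta>" for n \<theta> unfolding en_def using w by (intro sum_nonneg mult_nonneg_nonneg) auto
  define C' where "C' = max C pi"
  have C': "0 \<le> C'" "C \<le> C'" "pi \<le> C'" using C by (auto simp: C'_def)
  have D_meas [measurable]: "(\<lambda>\<theta>. D \<theta> x y) \<in> borel_measurable borel" for x y
    unfolding D_def by (intro borel_measurable_continuous_onI continuous_vertical_proj_dist)
  note \<Theta>(1)[measurable]
  have kern: "(\<integral>\<^sup>+\<theta>. ennreal (max (D \<theta> x y) ((1/2) ^ n) powr (-\<sigma>)) * indicator \<Theta> \<theta> \<partial>lborel)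
      \<le> ennreal (C' * max (koranyi_dist x y) ((1/2) ^ n) powr (-t))"
    if xy: "x \<in> E" "y \<in> E" for x y n
  proof (cases "(1/2) ^ n \<le> koranyi_dist x y")
    case True
    have "(0::real) < (1/2) ^ n" by simp
    with True have "0 < koranyi_dist x y" by linarith
    then have "x \<noteq> y" by auto
    have "(\<integral>\<^sup>+\<theta>. ennreal (max (D \<theta> x y) ((1/2) ^ n) powr (-\<sigma>)) * indicator \<Theta> \<theta> \<partial>lborel)
       \<le> ennreal (C * koranyi_dist x y powr (-t))"
      unfolding D_def using kernel[OF xy \<open>x \<noteq> y\<close>, of "(1/2) ^ n"] by simp
    also have "\<dots> \<le> ennreal (C' * max (koranyi_dist x y) ((1/2) ^ n) powr (-t))"
      using C' True by (intro ennreal_leI mult_mono) (auto simp: max_def)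
    finally show ?thesis .
  next
    case False
    have "(\<integral>\<^sup>+\<theta>. ennreal (max (D \<theta> x y) ((1/2) ^ n) powr (-\<sigma>)) * indicator \<Theta> \<theta> \<partial>lborel)
       \<le> (\<integral>\<^sup>+\<theta>. ennreal (((1/2) ^ n) powr (-t)) * indicator {0..<pi} \<theta> \<partial>lborel)"
    proof (rule nn_integral_mono)
      fix \<theta>
      have "max (D \<theta> x y) ((1/2) ^ n) powr (-\<sigma>) \<le> ((1/2) ^ n) powr (-\<sigma>)" using par by (intro powr_neg_le) auto
      also have "\<dots> \<le> ((1/2) ^ n) powr (-t)" using par by (intro powr_mono') (auto simp: power_le_one)
      finally show "ennreal (max (D \<theta> x y) ((1/2) ^ n) powr (-\<sigma>)) * indicator \<Theta> \<theta>
          \<le> ennreal (((1/2) ^ n) powr (-t)) * indicator {0..<pi} \<theta>"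
        using \<Theta>(2) by (intro mult_mono ennreal_leI) (auto simp: indicator_def)
    qed
    also have "\<dots> = ennreal (((1/2) ^ n) powr (-t) * pi)"
      by (simp add: nn_integral_cmult ennreal_mult)
    also have "\<dots> \<le> ennreal (C' * max (koranyi_dist x y) ((1/2) ^ n) powr (-t))"
      using False C' by (intro ennreal_leI) (auto simp: max_def mult.commute intro!: mult_right_mono)
    finally show ?thesis .
  qed
  have en_int: "(\<integral>\<^sup>+\<theta>. ennreal (en n \<theta>) * indicator \<Theta> \<theta> \<partial>lborel) \<le> ennreal (C' * B * m)" for n
  proof -
    have "(\<integral>\<^sup>+\<theta>. ennreal (en n \<theta>) * indicator \<Theta> \<theta> \<partial>lborel) =
      (\<integral>\<^sup>+\<theta>. (\<Sum>x\<in>X n. \<Sum>y\<in>X n. ennreal (w n x * w n y) * (ennreal (max (D \<theta> x y) ((1/2) ^ n) powr (-\<sigma>)) * indicator \<Theta> \<theta>)) \<partial>lborel)"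
      unfolding en_def using w
      by (intro nn_integral_cong) (simp add: sum_ennreal[symmetric] sum_nonneg sum_distrib_right ennreal_mult mult.assoc)
    also have "\<dots> = (\<Sum>x\<in>X n. \<Sum>y\<in>X n. ennreal (w n x * w n y) *
        (\<integral>\<^sup>+\<theta>. ennreal (max (D \<theta> x y) ((1/2) ^ n) powr (-\<sigma>)) * indicator \<Theta> \<theta> \<partial>lborel))"
      by (simp add: nn_integral_sum nn_integral_cmult)
    also have "\<dots> \<le> (\<Sum>x\<in>X n. \<Sum>y\<in>X n. ennreal (w n x * w n y) * ennreal (C' * max (koranyi_dist x y) ((1/2) ^ n) powr (-t)))"
      using X(2) by (intro sum_mono mult_left_mono kern) auto
    also have "\<dots> = ennreal (\<Sum>x\<in>X n. \<Sum>y\<in>X n. w n x * w n y * (C' * max (koranyi_dist x y) ((1/2) ^ n) powr (-t)))"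
      using w C' by (simp add: sum_ennreal sum_nonneg flip: ennreal_mult)
    also have "(\<Sum>x\<in>X n. \<Sum>y\<in>X n. w n x * w n y * (C' * max (koranyi_dist x y) ((1/2) ^ n) powr (-t)))
        = C' * (\<Sum>x\<in>X n. w n x * (\<Sum>y\<in>X n. w n y * max (koranyi_dist x y) ((1/2) ^ n) powr (-t)))"
      by (simp add: sum_distrib_left mult_ac)
    also have "ennreal \<dots> \<le> ennreal (C' * (\<Sum>x\<in>X n. w n x * B))"
    proof (intro ennreal_leI mult_left_mono sum_mono)
      fix x assume "x \<in> X n"
      then show "(\<Sum>y\<in>X n. w n y * max (koranyi_dist x y) ((1/2) ^ n) powr (-t)) \<le> B"
        using X(2)[of n] diam w(1) cells[of _ n, unfolded q_def]
        by (intro B(2)[OF X(1)] ballI allI impI) blast+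
    qed (use w C' in auto)
    also have "C' * (\<Sum>x\<in>X n. w n x * B) = C' * B * m" by (simp add: w(2) flip: sum_distrib_right)
    finally show ?thesis .
  qed
  have [measurable]: "en n \<in> borel_measurable borel" for n unfolding en_def by measurable
  have "(\<integral>\<^sup>+\<theta>. liminf (\<lambda>n. ennreal (en n \<theta>) * indicator \<Theta> \<theta>) \<partial>lborel)
      \<le> liminf (\<lambda>n. \<integral>\<^sup>+\<theta>. ennreal (en n \<theta>) * indicator \<Theta> \<theta> \<partial>lborel)"
    by (rule nn_integral_liminf) measurable
  also have "\<dots> \<le> liminf (\<lambda>n. ennreal (C' * B * m))" using en_int by (intro Liminf_mono) auto
  also have "\<dots> = ennreal (C' * B * m)" by (simp add: Liminf_const)
  finally have "(\<integral>\<^sup>+\<theta>. liminf (\<lambda>n. ennreal (en n \<theta>) * indicator \<Theta> \<theta>) \<partial>lborel) \<noteq> \<infinity>"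
    by (auto simp: top_unique)
  then have "AE \<theta> in lborel. liminf (\<lambda>n. ennreal (en n \<theta>) * indicator \<Theta> \<theta>) \<noteq> \<infinity>"
    by (intro nn_integral_PInf_AE) measurable
  then show ?thesis
  proof eventually_elim
    case (elim \<theta>)
    show ?case
    proof (intro impI allI)
      fix r :: real assume "\<theta> \<in> \<Theta>" and r: "0 < r" "r \<le> \<sigma>"
      then have fin: "liminf (\<lambda>n. ennreal (en n \<theta>)) \<noteq> top" using elim by simp
      then obtain M0 where M0: "liminf (\<lambda>n. ennreal (en n \<theta>)) = ennreal M0" "0 \<le> M0"
        by (cases "liminf (\<lambda>n. ennreal (en n \<theta>))") auto
      have "\<exists>\<^sub>F n in sequentially. en n \<theta> \<le> M0 + 1"
      proof (rule ccontr)
        assume "\<not> ?thesis"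
        then have "\<forall>\<^sub>F n in sequentially. ennreal (M0 + 1) \<le> ennreal (en n \<theta>)"
          unfolding not_frequently by eventually_elim (auto intro!: ennreal_leI)
        then have "ennreal (M0 + 1) \<le> liminf (\<lambda>n. ennreal (en n \<theta>))" by (rule Liminf_bounded)
        then show False unfolding M0(1) using M0(2) by simp
      qed
      then show "hausdorff_measure koranyi_dist r (vertical_proj \<theta> ` K) \<noteq> 0"
        unfolding en_def D_def
        by (rule hausdorff_measure_pos_if_energy_bounded[OF
              compact_continuous_image[OF continuous_on_subset[OF continuous_on_vertical_proj subset_UNIV] K(1)]
              X(1) image_mono[OF order_trans[OF X(2) K(2)]] w(1) w(2) m _ r])
    qed
  qed
qed

section \<open>The dimension of almost every projection\<close>

lemma AE_Re_rotation_nonzero: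
  assumes "z \<noteq> 0" shows "AE \<theta> in lborel. Re (z * cis (-\<theta>)) \<noteq> 0"
proof (rule AE_I')
  have "Re (z * cis (-\<theta>)) = norm z * sin (\<theta> - (Arg z - pi / 2))" for \<theta>
  proof -
    have "z * cis (-\<theta>) = of_real (norm z) * cis (Arg z - \<theta>)"
      by (metis cis_mult diff_conv_add_uminus mult.assoc rcis_cmod_Arg rcis_def)
    moreover have "sin (\<theta> - (Arg z - pi / 2)) = cos (Arg z - \<theta>)"
      by (simp add: sin_cos_eq)
    ultimately show ?thesis by simp
  qed
  then have "{\<theta>. \<not> Re (z * cis (-\<theta>)) \<noteq> 0} = range (\<lambda>i::int. (Arg z - pi / 2) + of_int i * pi)"
    using assms by (auto simp: sin_zero_iff_int2 algebra_simps)
  then have "countable {\<theta>. \<not> Re (z * cis (-\<theta>)) \<noteq> 0}" by simp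
  then show "{\<theta>. \<not> Re (z * cis (-\<theta>)) \<noteq> 0} \<in> null_sets lborel" by (rule countable_imp_null_set_lborel)
qed auto

text \<open>
  A cover by cells of small total cost uses only cells of high level, which have small diameter. The factor
  \<open>52\<close> is the diameter \<open>26 * 2\<^sup>-\<^sup>m\<close> of a cell of level \<open>m + 1\<close>, written in terms of the level.
\<close>

lemma content_null_imp_hausdorff_null:
  assumes s: "0 < s" and null: "hcells.content (2 powr (-s)) E = 0"
  shows "hausdorff_measure koranyi_dist s E = 0"
proof -
  have bound: "hausdorff_content koranyi_dist s \<delta> E \<le> 0 + ennreal e" if \<delta>: "0 < \<delta>" and e: "0 < e" for \<delta> e
  proof -
    define q where "q = 2 powr (-s)"
    have q: "0 < q" by (simp add: q_def)
    define e' where "e' = min (min 1 ((\<delta> / 52) powr s)) (e / 52 powr s)"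
    have e': "0 < e'" "e' \<le> 1" "e' \<le> (\<delta> / 52) powr s" and "e' \<le> e / 52 powr s"
      using \<delta> e by (simp_all add: e'_def)
    then have e'_le: "52 powr s * e' \<le> e" by (simp add: pos_le_divide_eq mult.commute)
    have "hcells.content q E < ennreal e'" using null e' by (simp add: q_def)
    then obtain C where C: "hcells.covers C E" "emeasure (hcells.weight q) C < ennreal e'"
      by (rule hcells.content_lessE)
    have small: "0 < n" "52 * (1/2) ^ n \<le> \<delta>" if "(n, i) \<in> C" for n i
    proof -
      have "ennreal (q ^ n) < ennreal e'" by (rule order.strict_trans1[OF hcells.weight_member[OF that] C(2)])
      then have qe: "q ^ n < e'" using q by (simp add: ennreal_less_iff)
      show "0 < n" using qe e' by (cases n) auto
      have "q ^ n = ((1/2) ^ n) powr s"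
      proof -
        show ?thesis unfolding half_power_eq_powr by (simp add: q_def powr_powr mult.commute flip: powr_realpow)
      qed
      then have "((1/2) ^ n) powr s \<le> (\<delta> / 52) powr s" using qe e' by linarith
      then have "(1/2) ^ n \<le> \<delta> / 52"
        using powr_less_mono2[of s "\<delta> / 52" "(1/2) ^ n"] s \<delta> by linarith
      then show "52 * (1/2) ^ n \<le> \<delta>" by simp
    qed
    define S where "S v = {x. hcell (fst v) x = snd v}" for v
    have ed: "ediam koranyi_dist (S v) \<le> ennreal (52 * (1/2) ^ fst v)" if v: "v \<in> C" for v
      unfolding ediam_def
    proof (intro SUP_least ennreal_leI)
      fix x y assume xy: "x \<in> S v" "y \<in> S v"
      have "0 < fst v" using v by (intro small(1)[of _ "snd v"]) simp
      then obtain m where m: "fst v = Suc m" by (cases "fst v") auto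
      have "koranyi_dist x y \<le> 26 * (1/2) ^ m" using xy m by (intro hcell_diam) (simp add: S_def del: hcell.simps)
      then show "koranyi_dist x y \<le> 52 * (1/2) ^ fst v" by (simp add: m)
    qed
    define U where "U k = (if k \<in> to_nat ` C then S (from_nat k) else {})" for k
    have "hausdorff_content koranyi_dist s \<delta> E \<le> (\<Sum>k. ennreal (enn2real (ediam koranyi_dist (U k)) powr s))"
      unfolding hausdorff_content_def
    proof (rule Inf_lower, rule CollectI, intro exI[of _ U] conjI allI)
      show "E \<subseteq> (\<Union>i. U i)"
      proof
        fix x assume "x \<in> E"
        then obtain n where n: "(n, hcell n x) \<in> C" using C(1) by (auto simp: hcells.covers_def)
        then have "x \<in> U (to_nat (n, hcell n x))" by (simp add: U_def S_def)
        then show "x \<in> (\<Union>i. U i)" by blast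
      qed
      fix k
      show "ediam koranyi_dist (U k) \<le> ennreal \<delta>"
      proof (cases "k \<in> to_nat ` C")
        case True
        then obtain v where v: "v \<in> C" "k = to_nat v" by blast
        have "ediam koranyi_dist (S v) \<le> ennreal \<delta>"
          using ed[OF v(1)] small(2)[of "fst v" "snd v"] v(1) by (auto intro: order_trans ennreal_leI)
        then show ?thesis using v by (simp add: U_def)
      qed (simp add: U_def ediam_def)
    qed simp
    also have "\<dots> = (\<integral>\<^sup>+k. ennreal (enn2real (ediam koranyi_dist (U k)) powr s) \<partial>count_space UNIV)"
      by (simp add: nn_integral_count_space_nat)
    also have "\<dots> = (\<integral>\<^sup>+k. ennreal (enn2real (ediam koranyi_dist (U k)) powr s) * indicator (to_nat ` C) k \<partial>count_space UNIV)"
      by (intro nn_integral_cong) (simp add: U_def ediam_def indicator_def bot_ennreal)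
    also have "\<dots> = (\<integral>\<^sup>+k. ennreal (enn2real (ediam koranyi_dist (U k)) powr s) \<partial>count_space (to_nat ` C))"
      by (rule nn_integral_count_space_indicator[symmetric]) (simp add: NO_MATCH_def)
    also have "\<dots> = (\<integral>\<^sup>+v. ennreal (enn2real (ediam koranyi_dist (U (to_nat v))) powr s) \<partial>count_space C)"
      by (rule nn_integral_bij_count_space[symmetric]) (simp add: bij_betw_def inj_on_def)
    also have "\<dots> \<le> (\<integral>\<^sup>+v. ennreal (52 powr s) * ennreal (q ^ fst v) \<partial>count_space C)"
    proof (rule nn_integral_mono)
      fix v assume "v \<in> space (count_space C)"
      then have v: "v \<in> C" by simp
      have "enn2real (ediam koranyi_dist (S v)) \<le> 52 * (1/2) ^ fst v"
        using ed[OF v] by (simp add: enn2real_leI)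
      then have "enn2real (ediam koranyi_dist (S v)) powr s \<le> (52 * (1/2) ^ fst v) powr s"
        using s by (intro powr_mono2) auto
      also have "\<dots> = 52 powr s * q ^ fst v"
      proof -
        show ?thesis unfolding half_power_eq_powr by (simp add: q_def powr_mult powr_powr mult.commute flip: powr_realpow)
      qed
      finally show "ennreal (enn2real (ediam koranyi_dist (U (to_nat v))) powr s) \<le> ennreal (52 powr s) * ennreal (q ^ fst v)"
        using v q by (simp add: U_def ennreal_mult[symmetric])
    qed
    also have "\<dots> = ennreal (52 powr s) * emeasure (hcells.weight q) C"
      by (simp add: nn_integral_cmult nn_integral_count_space_indicator hcells.weight_def emeasure_density)
    also have "\<dots> \<le> ennreal (52 powr s) * ennreal e'" using C(2) by (intro mult_left_mono less_imp_le) auto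
    also have "\<dots> \<le> ennreal e" using e' e'_le by (simp add: ennreal_mult[symmetric] ennreal_leI)
    finally show ?thesis by simp
  qed
  have "hausdorff_content koranyi_dist s \<delta> E \<le> 0" if "0 < \<delta>" for \<delta>
    by (rule ennreal_le_epsilon) (rule bound[OF that])
  then have "hausdorff_measure koranyi_dist s E \<le> 0"
    unfolding hausdorff_measure_def by (intro SUP_least) simp
  then show ?thesis by simp
qed

lemma hausdorff_measure_mono: "E \<subseteq> F \<Longrightarrow> hausdorff_measure d s E \<le> hausdorff_measure d s F"
  unfolding hausdorff_measure_def hausdorff_content_def
  by (intro SUP_mono') (rule Inf_superset_mono, blast)

lemma hausdorff_dim_ge:
  assumes "K \<subseteq> A" "\<And>r. 0 < r \<Longrightarrow> r \<le> \<sigma> \<Longrightarrow> hausdorff_measure d r K \<noteq> 0"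
  shows "ennreal \<sigma> \<le> hausdorff_dim d A"
  unfolding hausdorff_dim_def
proof (rule Inf_greatest, clarify)
  fix r assume r: "0 < r" "hausdorff_measure d r A = 0"
  then have "hausdorff_measure d r K = 0" using hausdorff_measure_mono[OF assms(1), of d r] by simp
  then have "\<sigma> < r" using assms(2)[of r] r(1) by force
  then show "ennreal \<sigma> \<le> ennreal r" by (intro ennreal_leI) simp
qed

lemma content_density_point:
  assumes K: "compact K" and pos: "hcells.content q K \<noteq> 0"
  shows "\<exists>p0\<in>K. \<forall>r>0. hcells.content q {p\<in>K. koranyi_dist p p0 < r} \<noteq> 0"
proof (rule ccontr)
  assume "\<not> ?thesis"
  then have "\<forall>p0\<in>K. \<exists>r>0. hcells.content q {p\<in>K. koranyi_dist p p0 < r} = 0" by blast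
  then obtain r where r: "\<And>p. p \<in> K \<Longrightarrow> 0 < r p" "\<And>p0. p0 \<in> K \<Longrightarrow> hcells.content q {p\<in>K. koranyi_dist p p0 < r p0} = 0"
    by metis
  have "K \<subseteq> (\<Union>p0\<in>K. {p. koranyi_dist p p0 < r p0})"
  proof
    fix p assume p: "p \<in> K"
    then have "koranyi_dist p p < r p" using r(1) by simp
    with p show "p \<in> (\<Union>p0\<in>K. {p. koranyi_dist p p0 < r p0})" by blast
  qed
  then obtain I where I: "I \<subseteq> K" "finite I" "K \<subseteq> (\<Union>p0\<in>I. {p. koranyi_dist p p0 < r p0})"
    by (rule compactE_image[OF K open_koranyi_ball])
  have "hcells.content q K \<le> hcells.content q (\<Union>p0\<in>I. {p\<in>K. koranyi_dist p p0 < r p0})"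
    using I(3) by (intro hcells.content_mono) blast
  also have "\<dots> \<le> (\<Sum>p0\<in>I. hcells.content q {p\<in>K. koranyi_dist p p0 < r p0})"
    using I(2) by (rule hcells.content_finite_UN_le)
  also have "\<dots> = 0" using r(2) I(1) by (intro sum.neutral) blast
  finally show False using pos by simp
qed

lemma koranyi_ball_diam:
  assumes "koranyi_dist p p0 < r" "koranyi_dist q p0 < r" shows "koranyi_dist p q \<le> 2 * r"
  using koranyi.triangle[of p p0 q] koranyi.commute[of p0 q] assms by simp

text \<open>
  Near a density point \<open>p0\<close> of \<open>K\<close> the sum of the first components of two points is within \<open>c\<close> of
  \<open>2 * fst p0\<close>. So for the angles with \<open>|Re (fst p0 * cis (-\<theta>))| \<ge> c\<close> the kernel bound is
  available with constant \<open>c\<close>. These sets of angles, for \<open>c = 1 / (j + 1)\<close>, exhaust almost all angles.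
\<close>

lemma projection_off_axis:
  assumes K: "compact K" and off: "\<And>p. p \<in> K \<Longrightarrow> fst p \<noteq> 0" and pos: "hcells.content (2 powr (-s)) K \<noteq> 0"
    and \<sigma>: "1 \<le> \<sigma>" "\<sigma> < 2" "2 * \<sigma> - 1 < s"
  shows "AE \<theta> in lborel. \<theta> \<in> {0..<pi} \<longrightarrow>
    (\<forall>r. 0 < r \<longrightarrow> r \<le> \<sigma> \<longrightarrow> hausdorff_measure koranyi_dist r (vertical_proj \<theta> ` K) \<noteq> 0)"
proof -
  \<comment> \<open>Close enough to \<open>1\<close> that \<open>2 * \<sigma> - \<beta> < s\<close>.\<close>
  define \<beta> where "\<beta> = max (1/2) ((1 + (2 * \<sigma> - s)) / 2)"
  have \<beta>: "0 < \<beta>" "\<beta> < 1" "2 * \<sigma> - s < \<beta>" using \<sigma> by (auto simp: \<beta>_def max_def)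
  obtain p0 where p0: "p0 \<in> K" "\<And>r. 0 < r \<Longrightarrow> hcells.content (2 powr (-s)) {p\<in>K. koranyi_dist p p0 < r} \<noteq> 0"
    using content_density_point[OF K pos] by blast
  define \<Theta> where "\<Theta> j = {\<theta>\<in>{0..<pi}. 1 / real (Suc j) \<le> \<bar>Re (fst p0 * cis (-\<theta>))\<bar>}" for j
  have "AE \<theta> in lborel. \<theta> \<in> \<Theta> j \<longrightarrow>
    (\<forall>r. 0 < r \<longrightarrow> r \<le> \<sigma> \<longrightarrow> hausdorff_measure koranyi_dist r (vertical_proj \<theta> ` K) \<noteq> 0)" for j
  proof -
    define c where "c = 1 / real (Suc j)"
    have c: "0 < c" "c \<le> 1" by (simp_all add: c_def)
    define V where "V = 2 * norm (fst p0) + c"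
    define E where "E = {p\<in>K. koranyi_dist p p0 < c / 2}"
    have near: "norm (fst p + fst q - 2 * fst p0) \<le> c" if "p \<in> E" "q \<in> E" for p q
    proof -
      have "norm (fst p + fst q - 2 * fst p0) \<le> norm (fst p - fst p0) + norm (fst q - fst p0)"
        using norm_triangle_ineq[of "fst p - fst p0" "fst q - fst p0"] by (simp add: algebra_simps)
      then show ?thesis
        using norm_fst_diff_le_koranyi[of p p0] norm_fst_diff_le_koranyi[of q p0] that by (simp add: E_def)
    qed
    have V: "norm (fst p + fst q) \<le> V" if "p \<in> E" "q \<in> E" for p q
      using norm_triangle_ineq[of "fst p + fst q - 2 * fst p0" "2 * fst p0"] near[OF that]
      by (simp add: V_def norm_mult)
    have transversal: "c \<le> \<bar>Re ((fst p + fst q) * cis (-\<theta>))\<bar>" if "p \<in> E" "q \<in> E" "\<theta> \<in> \<Theta> j" for p q \<theta>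
    proof -
      define h where "h = (fst p + fst q - 2 * fst p0) * cis (-\<theta>)"
      have "\<bar>Re h\<bar> \<le> c" using abs_Re_le_cmod[of h] near[OF that(1,2)] by (simp add: h_def norm_mult)
      moreover have "(fst p + fst q) * cis (-\<theta>) = h + 2 * (fst p0 * cis (-\<theta>))" by (simp add: h_def algebra_simps)
      then have "Re ((fst p + fst q) * cis (-\<theta>)) = Re h + 2 * Re (fst p0 * cis (-\<theta>))" by simp
      moreover have "c \<le> \<bar>Re (fst p0 * cis (-\<theta>))\<bar>" using that(3) by (simp add: \<Theta>_def c_def)
      ultimately show ?thesis by linarith
    qed
    obtain C where C: "0 \<le> C" "\<And>p q \<Theta> \<eta>. p \<noteq> q \<Longrightarrow> koranyi_dist p q \<le> 1 \<Longrightarrow> norm (fst p + fst q) \<le> V \<Longrightarrow>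
        \<Theta> \<subseteq> {0..<pi} \<Longrightarrow> (\<forall>\<theta>\<in>\<Theta>. c \<le> \<bar>Re ((fst p + fst q) * cis (-\<theta>))\<bar>) \<Longrightarrow> 0 < \<eta> \<Longrightarrow>
        (\<integral>\<^sup>+\<theta>. ennreal (max (koranyi_dist (vertical_proj \<theta> p) (vertical_proj \<theta> q)) \<eta> powr (-\<sigma>)) * indicator \<Theta> \<theta> \<partial>lborel)
          \<le> ennreal (C * koranyi_dist p q powr (-(2 * \<sigma> - \<beta>)))"
      using vertical_proj_kernel_integral[of c V \<sigma> \<beta>] c \<sigma> \<beta> by (auto simp: V_def)
    have diam: "koranyi_dist p q \<le> 1" if "p \<in> E" "q \<in> E" for p q
      using koranyi_ball_diam[of p p0 "c/2" q] that c by (simp add: E_def)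
    have E: "E \<subseteq> K" by (auto simp: E_def)
    have E_pos: "hcells.content (2 powr (-s)) E \<noteq> 0" unfolding E_def by (rule p0(2)) (use c in simp)
    show ?thesis
    proof (rule projections_positive_if_kernel_bound[where t = "2 * \<sigma> - \<beta>" and E = E and C = C and s = s])
      have "\<Theta> j = {0..<pi} \<inter> {\<theta>. 1 / real (Suc j) \<le> \<bar>Re (fst p0 * cis (-\<theta>))\<bar>}" by (auto simp: \<Theta>_def)
      moreover have "closed {\<theta>. 1 / real (Suc j) \<le> \<bar>Re (fst p0 * cis (-\<theta>))\<bar>}"
        by (intro closed_Collect_le continuous_intros)
      ultimately show "\<Theta> j \<in> sets borel" by simp
      fix p q :: heis and \<eta> :: real assume "p \<in> E" "q \<in> E" "p \<noteq> q" "0 < \<eta>"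
      then show "(\<integral>\<^sup>+\<theta>. ennreal (max (koranyi_dist (vertical_proj \<theta> p) (vertical_proj \<theta> q)) \<eta> powr (-\<sigma>)) * indicator (\<Theta> j) \<theta> \<partial>lborel)
          \<le> ennreal (C * koranyi_dist p q powr (-(2 * \<sigma> - \<beta>)))"
        using diam V transversal by (intro C(2)) (auto simp: \<Theta>_def)
    next
      show "\<Theta> j \<subseteq> {0..<pi}" by (auto simp: \<Theta>_def)
    next
      fix p q assume "p \<in> E" "q \<in> E"
      then show "koranyi_dist p q \<le> 1" by (rule diam)
    qed (use \<sigma> \<beta> C(1) K E E_pos in simp_all)
  qed
  then have "AE \<theta> in lborel. \<forall>j. \<theta> \<in> \<Theta> j \<longrightarrow>
    (\<forall>r. 0 < r \<longrightarrow> r \<le> \<sigma> \<longrightarrow> hausdorff_measure koranyi_dist r (vertical_proj \<theta> ` K) \<noteq> 0)"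
    unfolding AE_all_countable by blast
  with AE_Re_rotation_nonzero[OF off[OF p0(1)]] show ?thesis
  proof eventually_elim
    case (elim \<theta>)
    obtain j where "inverse (real (Suc j)) < \<bar>Re (fst p0 * cis (-\<theta>))\<bar>"
      using reals_Archimedean[of "\<bar>Re (fst p0 * cis (-\<theta>))\<bar>"] elim(1) by auto
    then have "\<theta> \<in> \<Theta> j" if "\<theta> \<in> {0..<pi}" using that by (simp add: \<Theta>_def inverse_eq_divide)
    then show ?case using elim(2) by blast
  qed
qed

text \<open>
  Every vertical projection fixes the points of the axis, so the kernel bound holds with exponent \<open>\<sigma>\<close> itself.
\<close>

lemma projection_on_axis:
  assumes K: "compact K" and on: "\<And>p. p \<in> K \<Longrightarrow> fst p = 0" and pos: "hcells.content (2 powr (-s)) K \<noteq> 0"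
    and \<sigma>: "0 < \<sigma>" "\<sigma> < s"
  shows "AE \<theta> in lborel. \<theta> \<in> {0..<pi} \<longrightarrow>
    (\<forall>r. 0 < r \<longrightarrow> r \<le> \<sigma> \<longrightarrow> hausdorff_measure koranyi_dist r (vertical_proj \<theta> ` K) \<noteq> 0)"
proof -
  obtain p0 where p0: "p0 \<in> K" "\<And>r. 0 < r \<Longrightarrow> hcells.content (2 powr (-s)) {p\<in>K. koranyi_dist p p0 < r} \<noteq> 0"
    using content_density_point[OF K pos] by blast
  define E where "E = {p\<in>K. koranyi_dist p p0 < 1 / 2}"
  have proj: "vertical_proj \<theta> p = p" if "p \<in> K" for \<theta> p
    using on[OF that] by (simp add: vertical_proj_eq symp_def prod_eq_iff)
  have E: "E \<subseteq> K" by (auto simp: E_def)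
  have E_pos: "hcells.content (2 powr (-s)) E \<noteq> 0" unfolding E_def by (rule p0(2)) simp
  show ?thesis
  proof (rule projections_positive_if_kernel_bound[where t = \<sigma> and E = E and C = pi and s = s])
    fix p q :: heis and \<eta> :: real assume pq: "p \<in> E" "q \<in> E" "p \<noteq> q" "0 < \<eta>"
    have "0 < koranyi_dist p q" using pq(3) koranyi.mdist_pos_less[of p q] by simp
    then have "max (koranyi_dist p q) \<eta> powr (-\<sigma>) \<le> koranyi_dist p q powr (-\<sigma>)" using \<sigma> by (intro powr_neg_le) auto
    then have "pi * max (koranyi_dist p q) \<eta> powr (-\<sigma>) \<le> pi * koranyi_dist p q powr (-\<sigma>)" by simp
    moreover have "(\<integral>\<^sup>+\<theta>. ennreal (max (koranyi_dist (vertical_proj \<theta> p) (vertical_proj \<theta> q)) \<eta> powr (-\<sigma>)) * indicator {0..<pi} \<theta> \<partial>lborel)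
       = ennreal (pi * max (koranyi_dist p q) \<eta> powr (-\<sigma>))"
      using pq(1,2) by (simp add: proj E_def nn_integral_cmult ennreal_mult) (simp add: mult.commute)
    ultimately show "(\<integral>\<^sup>+\<theta>. ennreal (max (koranyi_dist (vertical_proj \<theta> p) (vertical_proj \<theta> q)) \<eta> powr (-\<sigma>)) * indicator {0..<pi} \<theta> \<partial>lborel)
       \<le> ennreal (pi * koranyi_dist p q powr (-\<sigma>))" by (simp add: ennreal_leI)
  next
    fix p q assume "p \<in> E" "q \<in> E"
    then show "koranyi_dist p q \<le> 1" using koranyi_ball_diam[of p p0 "1/2" q] by (simp add: E_def)
  qed (use \<sigma> K E E_pos in simp_all)
qed

text \<open>
  The axis and the sets \<open>Z m\<close> are closed and cover the group, so one of them meets the analytic set in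
  positive content and the intersection contains a compact set of positive content. On the axis the exponent \<open>\<sigma> < s\<close>
  suffices, which follows from \<open>\<sigma> \<le> 2 * \<sigma> - 1\<close>.
\<close>

lemma analytic_projection_dim_ge:
  fixes f :: "(nat \<Rightarrow> nat) \<Rightarrow> heis"
  assumes f: "continuous_on UNIV f"
    and s: "ennreal s < hausdorff_dim koranyi_dist (range f)"
    and \<sigma>: "1 \<le> \<sigma>" "\<sigma> < 2" "2 * \<sigma> - 1 < s"
  shows "AE \<theta> in lborel. \<theta> \<in> {0..<pi} \<longrightarrow> ennreal \<sigma> \<le> hausdorff_dim koranyi_dist (vertical_proj \<theta> ` range f)"
proof -
  define A where "A = range f"
  define q where "q = 2 powr (-s)"
  have q: "0 < q" "q < 1" using \<sigma> by (simp_all add: q_def powr_less_one)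
  have "0 < s" using \<sigma> by simp
  have "hausdorff_measure koranyi_dist s A \<noteq> 0"
  proof
    assume "hausdorff_measure koranyi_dist s A = 0"
    then have "hausdorff_dim koranyi_dist A \<le> ennreal s"
      unfolding hausdorff_dim_def using \<open>0 < s\<close> by (intro Inf_lower) blast
    then show False using s by (simp add: A_def leD)
  qed
  then have pos: "hcells.content q A \<noteq> 0"
    using content_null_imp_hausdorff_null[OF \<open>0 < s\<close>] unfolding q_def by blast
  define Z0 where "Z0 = {p::heis. fst p = 0}"
  define Z where "Z m = {p::heis. 1 / real (Suc m) \<le> norm (fst p)}" for m
  have closed: "closed Z0" "closed (Z m)" for m
    unfolding Z0_def Z_def by (intro closed_Collect_eq closed_Collect_le continuous_intros)+
  have union: "A \<subseteq> (A \<inter> Z0) \<union> (\<Union>m. A \<inter> Z m)"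
  proof
    fix p assume "p \<in> A"
    show "p \<in> (A \<inter> Z0) \<union> (\<Union>m. A \<inter> Z m)"
    proof (cases "fst p = 0")
      case False
      then obtain m where "inverse (real (Suc m)) < norm (fst p)" using reals_Archimedean[of "norm (fst p)"] by auto
      then have "p \<in> Z m" by (simp add: Z_def inverse_eq_divide)
      with \<open>p \<in> A\<close> show ?thesis by blast
    qed (use \<open>p \<in> A\<close> in \<open>simp add: Z0_def\<close>)
  qed
  have "hcells.content q (A \<inter> Z0) \<noteq> 0 \<or> (\<exists>m. hcells.content q (A \<inter> Z m) \<noteq> 0)"
  proof (rule ccontr)
    assume none: "\<not> ?thesis"
    have "hcells.content q A \<le> hcells.content q (A \<inter> Z0) + hcells.content q (\<Union>m. A \<inter> Z m)"
      using union by (rule order_trans[OF hcells.content_mono hcells.content_Un_le])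
    also have "\<dots> \<le> hcells.content q (A \<inter> Z0) + (\<Sum>m. hcells.content q (A \<inter> Z m))"
      by (intro add_left_mono hcells.content_UN_le)
    also have "\<dots> = 0" using none by simp
    finally show False using pos by simp
  qed
  then have "\<exists>K. K \<subseteq> A \<and> (AE \<theta> in lborel. \<theta> \<in> {0..<pi} \<longrightarrow>
    (\<forall>r. 0 < r \<longrightarrow> r \<le> \<sigma> \<longrightarrow> hausdorff_measure koranyi_dist r (vertical_proj \<theta> ` K) \<noteq> 0))"
  proof
    assume "hcells.content q (A \<inter> Z0) \<noteq> 0"
    then obtain K where K: "compact K" "K \<subseteq> A \<inter> Z0" "hcells.content q K \<noteq> 0"
      using hcells.analytic_inner_compact[OF q f closed(1)] unfolding A_def by blast
    then show ?thesis
      using projection_on_axis[of K s \<sigma>] \<sigma> by (intro exI[of _ K]) (auto simp: Z0_def q_def)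
  next
    assume "\<exists>m. hcells.content q (A \<inter> Z m) \<noteq> 0"
    then obtain m K where K: "compact K" "K \<subseteq> A \<inter> Z m" "hcells.content q K \<noteq> 0"
      using hcells.analytic_inner_compact[OF q f closed(2)] unfolding A_def by blast
    have "fst p \<noteq> 0" if "p \<in> K" for p using that K(2) by (auto simp: Z_def)
    then show ?thesis
      using projection_off_axis[of K s \<sigma>] \<sigma> K by (intro exI[of _ K]) (auto simp: q_def)
  qed
  then obtain K where K: "K \<subseteq> A" and ae: "AE \<theta> in lborel. \<theta> \<in> {0..<pi} \<longrightarrow>
    (\<forall>r. 0 < r \<longrightarrow> r \<le> \<sigma> \<longrightarrow> hausdorff_measure koranyi_dist r (vertical_proj \<theta> ` K) \<noteq> 0)" by blast
  from ae show ?thesis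
  proof eventually_elim
    case (elim \<theta>)
    have "vertical_proj \<theta> ` K \<subseteq> vertical_proj \<theta> ` range f" using K unfolding A_def by (rule image_mono)
    from hausdorff_dim_ge[OF this] show ?case using elim by blast
  qed
qed

lemma hausdorff_dim_empty_le: "hausdorff_dim koranyi_dist {} \<le> 1"
proof -
  have "hausdorff_measure koranyi_dist 1 {} = 0" by (rule content_null_imp_hausdorff_null) simp_all
  then have "hausdorff_dim koranyi_dist {} \<le> ennreal 1"
    unfolding hausdorff_dim_def by (intro Inf_lower) force
  then show ?thesis by simp
qed

theorem theorem1p1:
  fixes A :: "heis set"
  assumes "analytic_in koranyi.mtopology A"
    and "hausdorff_dim koranyi_dist A > 1"
  shows "AE \<theta>\<in>{0..<pi} in lebesgue.
           hausdorff_dim koranyi_dist (vertical_proj \<theta> ` A)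
             \<ge> min ((1 + hausdorff_dim koranyi_dist A) / 2) 2"
proof -
  define D where "D = hausdorff_dim koranyi_dist A"
  have "A \<noteq> {}" using assms(2) hausdorff_dim_empty_le by auto
  then obtain f :: "(nat \<Rightarrow> nat) \<Rightarrow> heis" where
      "continuous_map (product_topology (\<lambda>_. discrete_topology UNIV) UNIV) koranyi.mtopology f" and A: "range f = A"
    using assms(1) unfolding analytic_in_def by blast
  moreover have "discrete_topology (UNIV :: nat set) = euclidean"
    by (simp add: discrete_topology_unique open_discrete flip: open_openin)
  ultimately have f: "continuous_on UNIV f"
    by (simp add: koranyi_mtopology euclidean_product_topology)
  have half: "(1 + ennreal d) / 2 = ennreal ((1 + d) / 2)" if "0 \<le> d" for d
  proof -
    have "(1 + ennreal d) / 2 = ennreal (1 + d) / ennreal 2" using that by simp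
    also have "\<dots> = ennreal ((1 + d) / 2)" using that by (intro divide_ennreal) auto
    finally show ?thesis .
  qed
  define S where "S = {x::rat. 1 \<le> x \<and> x < 2 \<and> ennreal (2 * of_rat x - 1) < D}"
  have "AE \<theta> in lborel. \<theta> \<in> {0..<pi} \<longrightarrow> ennreal (of_rat x) \<le> hausdorff_dim koranyi_dist (vertical_proj \<theta> ` A)"
    if x: "x \<in> S" for x
  proof -
    have "ennreal (2 * of_rat x - 1) < D" using x by (simp add: S_def)
    then obtain s' where s': "ennreal (2 * of_rat x - 1) < s'" "s' < D" using dense by blast
    then obtain s where s: "s' = ennreal s" "0 \<le> s" by (cases s') auto
    have x12: "1 \<le> (of_rat x :: real)" "(of_rat x :: real) < 2"
      using x of_rat_less[where 'a=real, of x 2] by (simp_all add: S_def)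
    then have "0 \<le> 2 * (of_rat x :: real) - 1" by linarith
    then have "2 * of_rat x - 1 < s" using s'(1) unfolding s(1) by (subst (asm) ennreal_less_iff)
    then show ?thesis
      using analytic_projection_dim_ge[OF f, of s "of_rat x"] s'(2) s A x12 by (simp add: D_def)
  qed
  then have "AE \<theta> in lborel. \<forall>x\<in>S. \<theta> \<in> {0..<pi} \<longrightarrow>
      ennreal (of_rat x) \<le> hausdorff_dim koranyi_dist (vertical_proj \<theta> ` A)"
    by (subst AE_ball_countable) (auto simp: S_def)
  then have "AE \<theta> in lebesgue. \<forall>x\<in>S. \<theta> \<in> {0..<pi} \<longrightarrow>
      ennreal (of_rat x) \<le> hausdorff_dim koranyi_dist (vertical_proj \<theta> ` A)"
    by (rule AE_completion)
  then show ?thesis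
  proof eventually_elim
    case (elim \<theta>)
    show ?case
    proof
      assume \<theta>: "\<theta> \<in> {0..<pi}"
      show "min ((1 + hausdorff_dim koranyi_dist A) / 2) 2 \<le> hausdorff_dim koranyi_dist (vertical_proj \<theta> ` A)"
      proof (rule ccontr)
        assume "\<not> ?thesis"
        then have "hausdorff_dim koranyi_dist (vertical_proj \<theta> ` A) < min ((1 + D) / 2) 2"
          by (simp only: D_def not_le)
        moreover have "1 < min ((1 + D) / 2) 2"
        proof (cases D)
          case (real d)
          then have "1 < d" using assms(2) by (simp add: D_def[symmetric] one_less_ennreal)
          then have "1 < (1 + d) / 2" by simp
          then have "ennreal 1 < ennreal ((1 + d) / 2)" by (intro ennreal_lessI) auto
          then show ?thesis using half[OF real(1)] \<open>1 < d\<close> real(2) by simp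
        qed (simp add: ennreal_top_divide)
        ultimately have "max 1 (hausdorff_dim koranyi_dist (vertical_proj \<theta> ` A)) < min ((1 + D) / 2) 2"
          by (simp only: max_less_iff_conj)
        then obtain x :: rat where x: "max 1 (hausdorff_dim koranyi_dist (vertical_proj \<theta> ` A)) < ennreal (of_rat x)"
            "ennreal (of_rat x) < min ((1 + D) / 2) 2"
          using ennreal_rat_dense by blast
        have x1: "1 < (of_rat x :: real)" using x(1) by (simp add: one_less_ennreal)
        have "ennreal (of_rat x) < ennreal 2" using x(2) by simp
        then have x2: "(of_rat x :: real) < 2" using x1 by (simp add: ennreal_less_iff del: ennreal_numeral)
        have "ennreal (2 * of_rat x - 1) < D"
        proof (cases D)
          case (real d)
          then have "ennreal (of_rat x) < ennreal ((1 + d) / 2)" using x(2) half[OF real(1)] real(2) by simp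
          then have "of_rat x < (1 + d) / 2" using x1 by (simp add: ennreal_less_iff)
          then have "2 * of_rat x - 1 < d" by simp
          moreover have "0 \<le> 2 * (of_rat x :: real) - 1" using x1 by linarith
          ultimately show ?thesis unfolding real(2) by (subst ennreal_less_iff)
        qed simp
        then have "x \<in> S" using x1 x2 of_rat_less[where 'a=real, of x 2] by (simp add: S_def)
        then show False using elim \<theta> x(1) by (auto simp: leD)
      qed
    qed
  qed
qed

end
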